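(* Let $\Omega\subset\mathbb{R}^n$, $n\ge 2$, be a regular domain, let $f:\mathbb{R}\to\mathbb{R}$ be Lipschitz continuous, let $F$ be a primitive of $f$ (of arbitrary sign), let $\kappa\neq 0$ be a constant, and let $u\in C^3(\Omega)$ be a bounded solution of $$\begin{cases}\Delta u+f(u)=0 & \text{in }\Omega,\\ u>0 & \text{in }\Omega,\\ u=0 & \text{on }\partial\Omega,\\ \partial_\nu u=-\kappa & \text{on }\partial\Omega.\end{cases}$$ Define $P(x)=|\nabla u(x)|^2+2F(u(x))$ and assume that $$P(x)\le \kappa^2+2F(0)\quad\text{for all } x\in\Omega .$$ Then $H(p)\le 0$ for every $p\in\partial\Omega$. Moreover, if there exists $p\in\partial\Omega$ such that $H(p)=0$, then $P$ is constant, $u$ is $1$-dimensional, and $\Omega$ is either a half-space or a slab, that is, the domain between two parallel hyperplanes.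
   Context: A regular domain is a connected open set $\Omega\subset\mathbb{R}^n$, bounded or not, with nonempty smooth boundary. $\nu$ denotes the outward unit normal to $\partial\Omega$. The boundary conditions are understood in the classical sense ($u$ is of class $C^1$ up to $\partial\Omega$). $H(p)$ denotes the mean curvature of $\partial\Omega$ at $p$, normalized as the average of the principal curvatures, with the sign convention that $H>0$ on the boundary of a ball; equivalently, $\Delta u=\partial^2_{\nu\nu}u+(n-1)H\,\partial_\nu u$ on $\partial\Omega$ for functions $u$ that are constant on $\partial\Omega$. The function $u$ is called $1$-dimensional if there exist $\vec a\in\mathbb{R}^n$, $x_0\in\mathbb{R}^n$ and a real function $g$ of one variable such that $u(x)=g(\vec a\cdot(x-x_0))$ for all $x\in\Omega$. *)

theory Defs
  imports "HOL-Analysis.Analysis"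
begin

definition partial_deriv :: "'a::euclidean_space \<Rightarrow> ('a \<Rightarrow> real) \<Rightarrow> 'a \<Rightarrow> real" where
  "partial_deriv b f x = frechet_derivative f (at x) b"

definition gradient :: "('a::euclidean_space \<Rightarrow> real) \<Rightarrow> 'a \<Rightarrow> 'a" where
  "gradient f x = (\<Sum>b\<in>Basis. partial_deriv b f x *\<^sub>R b)"

lemma GDERIV_gradient:
  assumes "f differentiable at x"
  shows "GDERIV f x :> gradient f x"
proof -
  have D: "(f has_derivative frechet_derivative f (at x)) (at x)"
    using assms by (simp add: frechet_derivative_works)
  then interpret bounded_linear "frechet_derivative f (at x)"
    by (rule has_derivative_bounded_linear)
  have "frechet_derivative f (at x) h = h \<bullet> gradient f x" for h
  proof -
    have "frechet_derivative f (at x) h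
        = frechet_derivative f (at x) (\<Sum>b\<in>Basis. (h \<bullet> b) *\<^sub>R b)"
      by (simp add: euclidean_representation)
    also have "\<dots> = h \<bullet> gradient f x"
      by (simp add: gradient_def partial_deriv_def sum scaleR inner_sum_right mult.commute)
    finally show ?thesis .
  qed
  then have "frechet_derivative f (at x) = (\<lambda>h. h \<bullet> gradient f x)" by blast
  with D show ?thesis by (simp add: gderiv_def)
qed

definition laplacian :: "('a::euclidean_space \<Rightarrow> real) \<Rightarrow> 'a \<Rightarrow> real" where
  "laplacian f x = (\<Sum>b\<in>Basis. partial_deriv b (partial_deriv b f) x)"

text \<open>The class \<open>C\<^sup>k(S)\<close>; meant for open \<open>S\<close>, since the derivatives are full
  (not one-sided) ones.\<close>

primrec Ck_on :: "nat \<Rightarrow> ('a::euclidean_space \<Rightarrow> real) \<Rightarrow> 'a set \<Rightarrow> bool" where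
  "Ck_on 0 f S \<longleftrightarrow> continuous_on S f"
| "Ck_on (Suc k) f S \<longleftrightarrow>
     (\<forall>x\<in>S. f differentiable at x) \<and> (\<forall>b\<in>Basis. Ck_on k (partial_deriv b f) S)"

definition smooth_on :: "('a::euclidean_space \<Rightarrow> real) \<Rightarrow> 'a set \<Rightarrow> bool" where
  "smooth_on f S \<longleftrightarrow> (\<forall>k. Ck_on k f S)"

text \<open>Near each of its points a smooth boundary is the regular zero level set of a smooth
  function that is negative exactly on the \<open>\<Omega>\<close> side.\<close>

definition local_defining_function ::
    "'a::euclidean_space set \<Rightarrow> 'a \<Rightarrow> 'a set \<Rightarrow> ('a \<Rightarrow> real) \<Rightarrow> bool" where
  "local_defining_function \<Omega> p U \<rho> \<longleftrightarrow>
     open U \<and> p \<in> U \<and> smooth_on \<rho> U \<and> (\<forall>x\<in>U. gradient \<rho> x \<noteq> 0) \<and>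
     \<Omega> \<inter> U = {x \<in> U. \<rho> x < 0}"

definition regular_domain :: "'a::euclidean_space set \<Rightarrow> bool" where
  "regular_domain \<Omega> \<longleftrightarrow>
     open \<Omega> \<and> connected \<Omega> \<and> frontier \<Omega> \<noteq> {} \<and>
     (\<forall>p\<in>frontier \<Omega>. \<exists>U \<rho>. local_defining_function \<Omega> p U \<rho>)"

text \<open>The direction of \<open>\<nabla>\<rho>(p)\<close> does not depend on the local defining function \<open>\<rho>\<close>.\<close>

definition outward_normal :: "'a::euclidean_space set \<Rightarrow> 'a \<Rightarrow> 'a" where
  "outward_normal \<Omega> p =
     (THE \<nu>. \<exists>U \<rho>. local_defining_function \<Omega> p U \<rho> \<and> \<nu> = sgn (gradient \<rho> p))"

definition boundary_tangent_space :: "'a::euclidean_space set \<Rightarrow> 'a \<Rightarrow> 'a set" where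
  "boundary_tangent_space \<Omega> p = {v. v \<bullet> outward_normal \<Omega> p = 0}"

text \<open>The Weingarten map \<open>v \<mapsto> D\<^sub>v \<nu>\<close> on tangent vectors. The normal is only differentiated
  within \<open>\<partial>\<Omega>\<close>; a derivative within \<open>\<partial>\<Omega>\<close> is not unique as a linear map on the whole space, but
  its values on tangent vectors are, and only those are used below. With the outward normal, all
  principal curvatures of a sphere bounding a ball are positive.\<close>

definition shape_operator :: "'a::euclidean_space set \<Rightarrow> 'a \<Rightarrow> 'a \<Rightarrow> 'a" where
  "shape_operator \<Omega> p = frechet_derivative (outward_normal \<Omega>) (at p within frontier \<Omega>)"

definition curvature_space :: "'a::euclidean_space set \<Rightarrow> 'a \<Rightarrow> real \<Rightarrow> 'a set" where
  "curvature_space \<Omega> p k =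
     {v \<in> boundary_tangent_space \<Omega> p. shape_operator \<Omega> p v = k *\<^sub>R v}"

definition principal_curvatures :: "'a::euclidean_space set \<Rightarrow> 'a \<Rightarrow> real set" where
  "principal_curvatures \<Omega> p = {k. \<exists>v\<in>curvature_space \<Omega> p k. v \<noteq> 0}"

text \<open>The average counts each principal curvature with its multiplicity.\<close>

definition mean_curvature :: "'a::euclidean_space set \<Rightarrow> 'a \<Rightarrow> real" where
  "mean_curvature \<Omega> p =
     (\<Sum>k\<in>principal_curvatures \<Omega> p. real (dim (curvature_space \<Omega> p k)) * k)
       / (real DIM('a) - 1)"

definition C1_up_to_boundary :: "'a::euclidean_space set \<Rightarrow> ('a \<Rightarrow> real) \<Rightarrow> bool" where
  "C1_up_to_boundary \<Omega> u \<longleftrightarrow>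
     continuous_on (closure \<Omega>) u \<and> (\<forall>x\<in>\<Omega>. u differentiable at x) \<and>
     (\<exists>G. continuous_on (closure \<Omega>) G \<and> (\<forall>x\<in>\<Omega>. G x = gradient u x))"

text \<open>The gradient at a boundary point is the limit of the gradient from inside \<open>\<Omega>\<close>.\<close>

definition normal_derivative :: "'a::euclidean_space set \<Rightarrow> ('a \<Rightarrow> real) \<Rightarrow> 'a \<Rightarrow> real" where
  "normal_derivative \<Omega> u p = Lim (at p within \<Omega>) (gradient u) \<bullet> outward_normal \<Omega> p"

definition P_function ::
    "(real \<Rightarrow> real) \<Rightarrow> ('a::euclidean_space \<Rightarrow> real) \<Rightarrow> 'a \<Rightarrow> real" where
  "P_function F u x = (norm (gradient u x))\<^sup>2 + 2 * F (u x)"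

definition one_dimensional :: "'a::euclidean_space set \<Rightarrow> ('a \<Rightarrow> real) \<Rightarrow> bool" where
  "one_dimensional \<Omega> u \<longleftrightarrow>
     (\<exists>(a::'a) (x0::'a) (g::real \<Rightarrow> real). \<forall>x\<in>\<Omega>. u x = g (a \<bullet> (x - x0)))"

definition half_space :: "'a::euclidean_space set \<Rightarrow> bool" where
  "half_space \<Omega> \<longleftrightarrow> (\<exists>a b. a \<noteq> 0 \<and> \<Omega> = {x. a \<bullet> x < b})"

definition slab :: "'a::euclidean_space set \<Rightarrow> bool" where
  "slab \<Omega> \<longleftrightarrow> (\<exists>a b c. a \<noteq> 0 \<and> b < c \<and> \<Omega> = {x. b < a \<bullet> x \<and> a \<bullet> x < c})"

end

theory Submission
  imports Defs
begin

text \<open>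
  Let \<open>Q = \<kappa>\<^sup>2 + 2 F 0 - P \<ge> 0\<close>, let \<open>e\<close> be the inner normal at a boundary point \<open>p\<close>, and let
  \<open>g\<close> be the one-dimensional solution, \<open>g'' = - f g\<close>, \<open>g 0 = 0\<close>, \<open>g' 0 = \<kappa>\<close>. The usual argument computes
  the normal derivative of \<open>P\<close> at \<open>p\<close>, which needs \<open>u\<close> to be \<open>C\<^sup>2\<close> up to the boundary.
  Here only \<open>C\<^sup>1\<close> is used. The bound on \<open>P\<close> says that \<open>u\<close>, measured in the parameter of \<open>g\<close>, is
  \<open>1\<close>-Lipschitz. Integrating it vertically from the boundary gives \<open>u \<le> g \<psi>\<close> near \<open>p\<close>, where \<open>\<psi>\<close> is a
  quadratic polynomial bounding the height above \<open>\<partial>\<Omega>\<close>, with Laplacian close to \<open>- (n - 1) H p\<close>. So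
  \<open>V = g \<psi> - u\<close> is nonnegative, vanishes to first order at \<open>p\<close>, and satisfies
  \<open>\<Delta>V \<le> L V - \<kappa> (n - 1) H p\<close> up to a small error.

  If \<open>H p > 0\<close>, Hopf's lemma contradicts the vanishing of the gradient of \<open>V\<close> at \<open>p\<close>. If \<open>H p = 0\<close>, then either \<open>Q\<close>
  vanishes near \<open>p\<close>, or Hopf's lemma gives linear growth of \<open>Q\<close> and hence \<open>V \<ge> c r\<^sup>2\<close> in the middle of
  the tangent ball of radius \<open>r\<close>, which for small \<open>r\<close> again contradicts Hopf's lemma for \<open>V\<close>.
  Where \<open>Q = 0\<close> and \<open>\<nabla>u \<noteq> 0\<close>, equality in the Cauchy-Schwarz inequality makes \<open>u\<close> planar. Planarity
  spreads through regular points by the strong maximum principle for \<open>Q\<close>, and across critical hyperplanes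
  because there the bound on \<open>P\<close> forces \<open>u - g (e \<bullet> (x - p))\<close> to have a sign. Finally \<open>\<Omega>\<close> is
  a connected component of the set where \<open>g (e \<bullet> (x - p)) > 0\<close>.
\<close>

subsection \<open>Partial derivatives, gradients and Laplacians\<close>

text \<open>The inequality for \<open>Q\<close> carries the coefficient 2 |f u| / |gradient u|. It
  is bounded near the boundary, where |gradient u| is close to \<kappa>, and near regular points,
  but not at critical ones; this is why critical hyperplanes need a comparison of their own. The
  difficulty there is that y'^2 \<le> 2 (F (g \<tau>) - F y) admits many solutions leaving the
  turning value, among them the constant one. The parameter of \<open>g\<close> is time as a
  function of height, dt = dg / sqrt (Pmax - 2 F g). As this integrand may degenerate on the range
  of \<open>u\<close>, it is truncated from below; the truncation only slows \<open>u\<close> down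
  and is invisible to \<open>g\<close> while its slope stays above \<kappa> / 2. Hopf's lemma has to
  be quantitative. For zero curvature the error \<eta> in the inequality for \<open>V\<close> cannot
  be removed, but on a ball of radius r it enters only as \<eta> r^2, the same order as the lower
  bound c r^2 for \<open>V\<close>. So \<eta> has to be small against c only; it is fixed first,
  then the slack \<epsilon> in \<psi>, then the neighbourhood of \<open>p\<close>, and r
  last.\<close>

lemma partial_deriv_eq:
  assumes "(f has_derivative D) (at x)"
  shows "partial_deriv b f x = D b"
  using frechet_derivative_at[OF assms] by (simp add: partial_deriv_def)

lemma gradient_inner_Basis:
  "b \<in> Basis \<Longrightarrow> gradient f x \<bullet> b = partial_deriv b f x"
  "b \<in> Basis \<Longrightarrow> b \<bullet> gradient f x = partial_deriv b f x"
  by (simp_all add: gradient_def inner_sum_left inner_sum_right inner_Basis if_distrib cong: if_cong)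

lemma has_derivative_gradient:
  assumes "f differentiable at x"
  shows "(f has_derivative (\<lambda>h. h \<bullet> gradient f x)) (at x)"
  using GDERIV_gradient[OF assms] by (simp add: gderiv_def)

lemma gradient_eqI:
  assumes "(f has_derivative (\<lambda>h. h \<bullet> G)) (at x)"
  shows "gradient f x = G"
proof (rule euclidean_eqI)
  fix b :: 'a assume "b \<in> Basis"
  then show "gradient f x \<bullet> b = G \<bullet> b"
    using partial_deriv_eq[OF assms, of b] by (metis gradient_inner_Basis(1) inner_commute)
qed

lemma norm_gradient_sq: "(norm (gradient f x))\<^sup>2 = (\<Sum>b\<in>Basis. (partial_deriv b f x)\<^sup>2)"
  by (subst norm_eq_sqrt_inner, subst euclidean_inner)
     (simp add: gradient_inner_Basis power2_eq_square sum_nonneg)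

text \<open>Existence of the second derivatives without their continuity: this is what tests at
  interior minima use, and by the second difference argument below it already makes the Hessian
  symmetric.\<close>

definition twice_diff_on :: "('a::euclidean_space \<Rightarrow> real) \<Rightarrow> 'a set \<Rightarrow> bool" where
  "twice_diff_on f S \<longleftrightarrow>
     (\<forall>x\<in>S. f differentiable at x \<and> (\<forall>b\<in>Basis. partial_deriv b f differentiable at x))"

lemma twice_diff_on_subset: "twice_diff_on f S \<Longrightarrow> T \<subseteq> S \<Longrightarrow> twice_diff_on f T"
  by (auto simp: twice_diff_on_def)

lemma twice_diff_onD:
  assumes "twice_diff_on f S" "x \<in> S"
  shows "f differentiable at x" "b \<in> Basis \<Longrightarrow> partial_deriv b f differentiable at x"
    "isCont f x" "(f has_derivative (\<lambda>h. h \<bullet> gradient f x)) (at x)"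
  using assms differentiable_imp_continuous_within[of f x UNIV] has_derivative_gradient
  by (auto simp: twice_diff_on_def)

lemma partial_deriv_cong_open:
  assumes "open S" "x \<in> S" "\<And>y. y \<in> S \<Longrightarrow> f y = g y"
  shows "partial_deriv b f x = partial_deriv b g x"
proof -
  have "(f has_derivative D) (at x) \<longleftrightarrow> (g has_derivative D) (at x)" for D
    using has_derivative_transform_within_open[of f D x UNIV S g]
      has_derivative_transform_within_open[of g D x UNIV S f] assms by auto
  then show ?thesis by (simp add: partial_deriv_def frechet_derivative_def)
qed

lemma gradient_cong_open:
  assumes "open S" "x \<in> S" "\<And>y. y \<in> S \<Longrightarrow> f y = g y"
  shows "gradient f x = gradient g x"
  unfolding gradient_def using partial_deriv_cong_open[OF assms] by simp

text \<open>For use with functions whose gradient field \<open>G\<close> is known explicitly: since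
  \<open>S\<close> is open, the partial derivatives may be replaced by the components of
  \<open>G\<close> before they are differentiated again.\<close>

lemma twice_diff_onI:
  assumes S: "open S"
    and G: "\<And>y. y \<in> S \<Longrightarrow> (f has_derivative (\<lambda>h. h \<bullet> G y)) (at y)"
    and H: "\<And>y b. y \<in> S \<Longrightarrow> b \<in> Basis \<Longrightarrow> ((\<lambda>y. G y \<bullet> b) has_derivative D y b) (at y)"
  shows "twice_diff_on f S" and "\<And>x. x \<in> S \<Longrightarrow> laplacian f x = (\<Sum>b\<in>Basis. D x b b)"
    and "\<And>x. x \<in> S \<Longrightarrow> gradient f x = G x"
proof -
  have pd: "partial_deriv b f y = G y \<bullet> b" if "y \<in> S" for y b
    using partial_deriv_eq[OF G[OF that]] by (simp add: inner_commute)
  have pdd: "(partial_deriv b f has_derivative D y b) (at y)" if "y \<in> S" "b \<in> Basis" for y b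
    using has_derivative_transform_within_open[OF H[OF that] S, of "partial_deriv b f"] pd that
    by simp
  show "twice_diff_on f S"
    using G pdd by (auto simp: twice_diff_on_def differentiable_def)
  show "laplacian f x = (\<Sum>b\<in>Basis. D x b b)" if "x \<in> S" for x
    using partial_deriv_eq[OF pdd[OF that]] by (simp add: laplacian_def)
  show "gradient f x = G x" if "x \<in> S" for x
    using G that by (simp add: gradient_eqI)
qed

lemma has_derivative_gradient_inner:
  assumes "twice_diff_on f S" "open S" "x \<in> S" "b \<in> Basis"
  shows "((\<lambda>y. gradient f y \<bullet> b) has_derivative (\<lambda>h. h \<bullet> gradient (partial_deriv b f) x)) (at x)"
  using has_derivative_gradient[OF twice_diff_onD(2)[OF assms(1,3,4)]] assms(4)
  by (simp add: gradient_inner_Basis)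

lemma twice_diff_lincomb:
  assumes S: "open S" and f: "twice_diff_on f S" and g: "twice_diff_on g S"
  shows "twice_diff_on (\<lambda>x. a * f x + c * g x) S"
    and "\<And>x. x \<in> S \<Longrightarrow> laplacian (\<lambda>x. a * f x + c * g x) x = a * laplacian f x + c * laplacian g x"
    and "\<And>x. x \<in> S \<Longrightarrow> gradient (\<lambda>x. a * f x + c * g x) x = a *\<^sub>R gradient f x + c *\<^sub>R gradient g x"
proof -
  let ?G = "\<lambda>y. a *\<^sub>R gradient f y + c *\<^sub>R gradient g y"
  let ?D = "\<lambda>y b h. a * (h \<bullet> gradient (partial_deriv b f) y) + c * (h \<bullet> gradient (partial_deriv b g) y)"
  have G: "((\<lambda>x. a * f x + c * g x) has_derivative (\<lambda>h. h \<bullet> ?G y)) (at y)" if "y \<in> S" for y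
    using twice_diff_onD(4)[OF f that] twice_diff_onD(4)[OF g that]
    by (auto intro!: derivative_eq_intros simp: inner_add_right)
  have H: "((\<lambda>y. ?G y \<bullet> b) has_derivative ?D y b) (at y)" if "y \<in> S" "b \<in> Basis" for y b
    using has_derivative_add[OF has_derivative_mult_right[OF has_derivative_gradient_inner[OF f S that]]
      has_derivative_mult_right[OF has_derivative_gradient_inner[OF g S that]], of a c]
    by (simp add: inner_add_left)
  note * = twice_diff_onI[OF S G H]
  show "twice_diff_on (\<lambda>x. a * f x + c * g x) S" by (rule *(1))
  show "laplacian (\<lambda>x. a * f x + c * g x) x = a * laplacian f x + c * laplacian g x" if "x \<in> S" for x
  proof -
    have "laplacian f x = (\<Sum>b\<in>Basis. b \<bullet> gradient (partial_deriv b f) x)" for f :: "'a \<Rightarrow> real"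
      unfolding laplacian_def by (rule sum.cong) (auto simp: gradient_inner_Basis inner_commute)
    moreover have "laplacian (\<lambda>x. a * f x + c * g x) x = (\<Sum>b\<in>Basis. ?D x b b)"
      by (rule *(2)) (use that in auto)
    ultimately show ?thesis by (simp add: sum.distrib sum_distrib_left)
  qed
  show "gradient (\<lambda>x. a * f x + c * g x) x = ?G x" if "x \<in> S" for x
    by (rule *(3)) (use that in auto)
qed

lemma twice_diff_compose:
  fixes g g' g'' :: "real \<Rightarrow> real"
  assumes S: "open S" and f: "twice_diff_on f S"
    and g: "\<And>t. (g has_real_derivative g' t) (at t)"
    and g': "\<And>t. (g' has_real_derivative g'' t) (at t)"
  shows "twice_diff_on (\<lambda>x. g (f x)) S"
    and "\<And>x. x \<in> S \<Longrightarrow> laplacian (\<lambda>x. g (f x)) x =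
           g'' (f x) * (norm (gradient f x))\<^sup>2 + g' (f x) * laplacian f x"
    and "\<And>x. x \<in> S \<Longrightarrow> gradient (\<lambda>x. g (f x)) x = g' (f x) *\<^sub>R gradient f x"
proof -
  let ?G = "\<lambda>y. g' (f y) *\<^sub>R gradient f y"
  let ?D = "\<lambda>y b h. g' (f y) * (h \<bullet> gradient (partial_deriv b f) y)
              + g'' (f y) * (h \<bullet> gradient f y) * (gradient f y \<bullet> b)"
  have G: "((\<lambda>x. g (f x)) has_derivative (\<lambda>h. h \<bullet> ?G y)) (at y)" if "y \<in> S" for y
    using has_derivative_compose[OF twice_diff_onD(4)[OF f that]
        g[of "f y", unfolded has_field_derivative_def]]
    by (simp add: mult.commute)
  have H: "((\<lambda>y. ?G y \<bullet> b) has_derivative ?D y b) (at y)" if "y \<in> S" "b \<in> Basis" for y b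
  proof -
    have 1: "((\<lambda>y. g' (f y)) has_derivative (\<lambda>h. g'' (f y) * (h \<bullet> gradient f y))) (at y)"
      using has_derivative_compose[OF twice_diff_onD(4)[OF f that(1)]
        g'[of "f y", unfolded has_field_derivative_def]]
      by simp
    show ?thesis
      using has_derivative_mult[OF 1 has_derivative_gradient_inner[OF f S that]]
      by (simp add: inner_scaleR_left)
  qed
  note * = twice_diff_onI[OF S G H]
  show "twice_diff_on (\<lambda>x. g (f x)) S" by (rule *(1))
  show "laplacian (\<lambda>x. g (f x)) x =
           g'' (f x) * (norm (gradient f x))\<^sup>2 + g' (f x) * laplacian f x" if "x \<in> S" for x
  proof -
    have "laplacian f x = (\<Sum>b\<in>Basis. b \<bullet> gradient (partial_deriv b f) x)"
      unfolding laplacian_def by (rule sum.cong) (auto simp: gradient_inner_Basis inner_commute)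
    moreover have "(norm (gradient f x))\<^sup>2 = (\<Sum>b\<in>Basis. (b \<bullet> gradient f x) * (gradient f x \<bullet> b))"
      unfolding norm_gradient_sq
      by (rule sum.cong) (auto simp: gradient_inner_Basis inner_commute power2_eq_square)
    moreover have "laplacian (\<lambda>x. g (f x)) x = (\<Sum>b\<in>Basis. ?D x b b)"
      by (rule *(2)) (use that in auto)
    ultimately show ?thesis
      by (simp add: sum.distrib sum_distrib_left mult.assoc)
  qed
  show "gradient (\<lambda>x. g (f x)) x = ?G x" if "x \<in> S" for x
    by (rule *(3)) (use that in auto)
qed

lemma Ck_on_imp_twice_diff_on: "Ck_on (Suc (Suc k)) f S \<Longrightarrow> twice_diff_on f S"
  by (auto simp: twice_diff_on_def)

lemma line_has_derivative:
  fixes f :: "'a::euclidean_space \<Rightarrow> real"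
  assumes "f differentiable at (x + t *\<^sub>R h)"
  shows "((\<lambda>t. f (x + t *\<^sub>R h)) has_real_derivative (h \<bullet> gradient f (x + t *\<^sub>R h))) (at t)"
proof -
  have "((\<lambda>t. x + t *\<^sub>R h) has_derivative (\<lambda>s. s *\<^sub>R h)) (at t)"
    by (auto intro!: derivative_eq_intros)
  from has_derivative_compose[OF this has_derivative_gradient[OF assms]]
  show ?thesis by (simp add: has_field_derivative_def mult_commute_abs)
qed

text \<open>The second derivative is given at 0 only. If it were negative, \<phi>' would be negative
  just to the right of 0 and \<phi> would drop below its minimum.\<close>

lemma second_derivative_nonneg_at_min:
  fixes \<phi> \<phi>' :: "real \<Rightarrow> real"
  assumes d: "0 < d" and D1: "\<And>t. \<bar>t\<bar> < d \<Longrightarrow> (\<phi> has_real_derivative \<phi>' t) (at t)"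
    and D2: "(\<phi>' has_real_derivative l) (at 0)"
    and min: "\<And>t. \<bar>t\<bar> < d \<Longrightarrow> \<phi> 0 \<le> \<phi> t"
  shows "\<phi>' 0 = 0" and "0 \<le> l"
proof -
  show 0: "\<phi>' 0 = 0"
    using DERIV_local_min[OF D1[of 0] d] min d by simp
  show "0 \<le> l"
  proof (rule ccontr)
    assume "\<not> 0 \<le> l"
    then obtain d' where d': "d' > 0" "\<And>h. 0 < h \<Longrightarrow> h < d' \<Longrightarrow> \<phi>' h < 0"
      using DERIV_neg_dec_right[OF D2] 0 by auto
    define t where "t = min d d' / 2"
    have t: "0 < t" "t < d" "t < d'" using d d'(1) by (auto simp: t_def)
    have "\<phi> t < \<phi> 0"
    proof (rule DERIV_neg_imp_decreasing_open[OF t(1)])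
      show "\<exists>y. (\<phi> has_real_derivative y) (at x) \<and> y < 0" if "0 < x" "x < t" for x
        using D1[of x] d'(2)[of x] that t by auto
      show "continuous_on {0..t} \<phi>"
        by (rule continuous_at_imp_continuous_on) (use D1 t DERIV_isCont in force)
    qed
    with min[of t] t show False by auto
  qed
qed

lemma local_min_gradient_laplacian:
  assumes S: "open S" and f: "twice_diff_on f S" and x: "x \<in> S"
    and min: "\<And>y. y \<in> S \<Longrightarrow> f x \<le> f y"
  shows "gradient f x = 0" and "0 \<le> laplacian f x"
proof -
  obtain d where d: "d > 0" "ball x d \<subseteq> S" using S x open_contains_ball by blast
  have *: "partial_deriv b f x = 0 \<and> 0 \<le> partial_deriv b (partial_deriv b f) x" if b: "b \<in> Basis" for b
  proof -
    have inS: "x + t *\<^sub>R b \<in> S" if "\<bar>t\<bar> < d" for t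
      using d(2) that b by (auto simp: dist_norm norm_minus_commute)
    have 1: "((\<lambda>t. f (x + t *\<^sub>R b)) has_real_derivative partial_deriv b f (x + t *\<^sub>R b)) (at t)"
      if "\<bar>t\<bar> < d" for t
      using line_has_derivative[OF twice_diff_onD(1)[OF f inS[OF that]]] b
      by (simp add: gradient_inner_Basis)
    have 2: "((\<lambda>t. partial_deriv b f (x + t *\<^sub>R b)) has_real_derivative
        partial_deriv b (partial_deriv b f) x) (at 0)"
      using line_has_derivative[of "partial_deriv b f" x 0 b] twice_diff_onD(2)[OF f x b] b
      by (simp add: gradient_inner_Basis)
    show ?thesis
      using second_derivative_nonneg_at_min[OF d(1) 1 2] min inS by simp
  qed
  show "gradient f x = 0" unfolding gradient_def using * by simp
  show "0 \<le> laplacian f x" unfolding laplacian_def using * by (simp add: sum_nonneg)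
qed

subsection \<open>Symmetry of second derivatives, Hopf's lemma and the strong maximum principle\<close>

text \<open>The mean value theorem in direction \<open>b\<close>, applied to the increment of
  \<open>f\<close> in direction \<open>c\<close>, turns the second difference into t times a
  difference of values of \<open>partial_deriv b f\<close>; differentiability of that function at
  the single point \<open>x\<close> evaluates it.\<close>

lemma second_difference:
  assumes S: "open S" "twice_diff_on f S" "x \<in> S" and b: "b \<in> Basis" and c: "c \<in> Basis"
    and e: "e > 0"
  shows "\<exists>d>0. \<forall>t. 0 < t \<and> t < d \<longrightarrow>
    \<bar>f (x + t *\<^sub>R b + t *\<^sub>R c) - f (x + t *\<^sub>R b) - f (x + t *\<^sub>R c) + f x
      - t\<^sup>2 * partial_deriv c (partial_deriv b f) x\<bar> \<le> e * t\<^sup>2"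
proof -
  let ?p = "partial_deriv b f"
  obtain d1 where d1: "d1 > 0" "ball x d1 \<subseteq> S" using S open_contains_ball by blast
  have "(?p has_derivative (\<lambda>h. h \<bullet> gradient ?p x)) (at x)"
    using has_derivative_gradient twice_diff_onD(2)[OF S(2,3) b] by blast
  \<comment> \<open>The expansion is used at two points, at distance at most 2 t and t from
    \<open>x\<close>, so thirds of \<open>e\<close> add up.\<close>
  with e obtain d2 where d2: "d2 > 0"
    "\<And>y. norm (y - x) < d2 \<Longrightarrow> \<bar>?p y - ?p x - (y - x) \<bullet> gradient ?p x\<bar> \<le> e / 3 * norm (y - x)"
    unfolding has_derivative_at_alt real_norm_def
    by (metis zero_less_divide_iff zero_less_numeral)
  show ?thesis
  proof (intro exI[of _ "min d1 d2 / 2"] conjI allI impI)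
    show "0 < min d1 d2 / 2" using d1 d2 by simp
    fix t assume t: "0 < t \<and> t < min d1 d2 / 2"
    let ?F = "\<lambda>s. f ((x + t *\<^sub>R c) + s *\<^sub>R b) - f (x + s *\<^sub>R b)"
    have nrm: "norm (s *\<^sub>R b + u *\<^sub>R c) \<le> \<bar>s\<bar> + \<bar>u\<bar>" for s u
      using norm_triangle_ineq[of "s *\<^sub>R b" "u *\<^sub>R c"] b c by simp
    have inS: "x + (s *\<^sub>R b + u *\<^sub>R c) \<in> S" if "\<bar>s\<bar> \<le> t" "\<bar>u\<bar> \<le> t" for s u
    proof -
      have "dist (x + (s *\<^sub>R b + u *\<^sub>R c)) x < d1"
        using nrm[of s u] that t by (simp add: dist_norm)
      then show ?thesis using d1 by (auto simp: dist_commute)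
    qed
    have D: "(?F has_real_derivative (?p ((x + t *\<^sub>R c) + s *\<^sub>R b) - ?p (x + s *\<^sub>R b))) (at s)"
      if "0 \<le> s" "s \<le> t" for s
    proof -
      have 1: "(x + t *\<^sub>R c) + s *\<^sub>R b \<in> S" "x + s *\<^sub>R b \<in> S"
        using inS[of s t] inS[of s 0] that t by (simp_all add: algebra_simps)
      show ?thesis
        using DERIV_diff[OF line_has_derivative[OF twice_diff_onD(1)[OF S(2) 1(1)]]
            line_has_derivative[OF twice_diff_onD(1)[OF S(2) 1(2)]]] b
        by (simp add: gradient_inner_Basis)
    qed
    obtain s where s: "0 < s" "s < t"
      and mvt: "?F t - ?F 0 = (t - 0) * (?p ((x + t *\<^sub>R c) + s *\<^sub>R b) - ?p (x + s *\<^sub>R b))"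
      using MVT2[of 0 t ?F "\<lambda>s. ?p ((x + t *\<^sub>R c) + s *\<^sub>R b) - ?p (x + s *\<^sub>R b)"] D t by auto
    let ?A = "?p ((x + t *\<^sub>R c) + s *\<^sub>R b)" and ?B = "?p (x + s *\<^sub>R b)"
    let ?g = "gradient ?p x"
    have A: "\<bar>?A - ?p x - (s *\<^sub>R b + t *\<^sub>R c) \<bullet> ?g\<bar> \<le> e / 3 * (2 * t)"
    proof -
      have n: "norm (s *\<^sub>R b + t *\<^sub>R c) \<le> 2 * t" using nrm[of s t] s t by simp
      moreover have "(x + t *\<^sub>R c) + s *\<^sub>R b - x = s *\<^sub>R b + t *\<^sub>R c" by simp
      ultimately have "\<bar>?A - ?p x - (s *\<^sub>R b + t *\<^sub>R c) \<bullet> ?g\<bar> \<le> e / 3 * norm (s *\<^sub>R b + t *\<^sub>R c)"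
        using d2(2)[of "(x + t *\<^sub>R c) + s *\<^sub>R b"] t by (simp add: add.commute)
      also have "\<dots> \<le> e / 3 * (2 * t)" using n e by (intro mult_left_mono) auto
      finally show ?thesis .
    qed
    have B: "\<bar>?B - ?p x - (s *\<^sub>R b) \<bullet> ?g\<bar> \<le> e / 3 * t"
    proof -
      have n: "norm (s *\<^sub>R b) \<le> t" using s t b by simp
      then have "\<bar>?B - ?p x - (s *\<^sub>R b) \<bullet> ?g\<bar> \<le> e / 3 * norm (s *\<^sub>R b)"
        using d2(2)[of "x + s *\<^sub>R b"] t by simp
      also have "\<dots> \<le> e / 3 * t" using n e by (intro mult_left_mono) auto
      finally show ?thesis .
    qed
    have "\<bar>?A - ?B - t * (c \<bullet> ?g)\<bar> \<le> e * t"
      using A B unfolding inner_add_left inner_scaleR_left by linarith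
    then have "t * \<bar>?A - ?B - t * (c \<bullet> ?g)\<bar> \<le> t * (e * t)" using t by (intro mult_left_mono) auto
    moreover have "t * \<bar>?A - ?B - t * (c \<bullet> ?g)\<bar> = \<bar>t * (?A - ?B) - t\<^sup>2 * (c \<bullet> ?g)\<bar>"
      using t by (simp add: abs_mult[of t, symmetric, of "_ - _"] abs_mult_pos' algebra_simps power2_eq_square)
    ultimately show "\<bar>f (x + t *\<^sub>R b + t *\<^sub>R c) - f (x + t *\<^sub>R b) - f (x + t *\<^sub>R c) + f x
      - t\<^sup>2 * partial_deriv c ?p x\<bar> \<le> e * t\<^sup>2"
      using mvt c by (simp add: gradient_inner_Basis algebra_simps power2_eq_square)
  qed
qed

text \<open>The second difference is symmetric in \<open>b\<close> and \<open>c\<close>, so both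
  mixed derivatives approximate the same number. With \<open>e\<close> a third of their distance,
  two errors of size \<open>e\<close> cannot bridge the gap.\<close>

lemma partial_deriv_commute:
  assumes S: "open S" "twice_diff_on f S" "x \<in> S" and b: "b \<in> Basis" and c: "c \<in> Basis"
  shows "partial_deriv c (partial_deriv b f) x = partial_deriv b (partial_deriv c f) x"
proof (rule ccontr)
  let ?l = "partial_deriv c (partial_deriv b f) x" and ?r = "partial_deriv b (partial_deriv c f) x"
  assume ne: "?l \<noteq> ?r"
  define e where "e = \<bar>?l - ?r\<bar> / 3"
  have e: "e > 0" using ne by (simp add: e_def)
  obtain d1 where d1: "d1 > 0" "\<And>t. 0 < t \<and> t < d1 \<Longrightarrow> \<bar>f (x + t *\<^sub>R b + t *\<^sub>R c) - f (x + t *\<^sub>R b) - f (x + t *\<^sub>R c) + f x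
      - t\<^sup>2 * ?l\<bar> \<le> e * t\<^sup>2"
    using second_difference[OF S b c e] by blast
  obtain d2 where d2: "d2 > 0" "\<And>t. 0 < t \<and> t < d2 \<Longrightarrow> \<bar>f (x + t *\<^sub>R c + t *\<^sub>R b) - f (x + t *\<^sub>R c) - f (x + t *\<^sub>R b) + f x
      - t\<^sup>2 * ?r\<bar> \<le> e * t\<^sup>2"
    using second_difference[OF S c b e] by blast
  define t where "t = min d1 d2 / 2"
  have t: "0 < t" "t < d1" "t < d2" using d1(1) d2(1) by (auto simp: t_def)
  have "\<bar>t\<^sup>2 * ?l - t\<^sup>2 * ?r\<bar> \<le> 2 * e * t\<^sup>2"
    using d1(2)[of t] d2(2)[of t] t by (simp add: add.commute add.left_commute abs_le_iff)
  then have "t\<^sup>2 * \<bar>?l - ?r\<bar> \<le> t\<^sup>2 * (2 * e)"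
    by (simp add: right_diff_distrib[symmetric] abs_mult mult.commute)
  then have "\<bar>?l - ?r\<bar> \<le> 2 * e" using t by simp
  then show False using ne by (simp add: e_def)
qed

section \<open>Barriers, Hopf's lemma and the strong maximum principle\<close>

lemma twice_diff_dist_sq:
  fixes y :: "'a::euclidean_space"
  shows "twice_diff_on (\<lambda>x. (dist y x)\<^sup>2) UNIV"
    and "laplacian (\<lambda>x. (dist y x)\<^sup>2) x = 2 * real DIM('a)"
    and "gradient (\<lambda>x. (dist y x)\<^sup>2) x = 2 *\<^sub>R (x - y)"
proof -
  have eq: "(\<lambda>x. (dist y x)\<^sup>2) = (\<lambda>x. (x - y) \<bullet> (x - y))"
    by (simp add: dist_norm norm_minus_commute power2_norm_eq_inner fun_eq_iff)
  have G: "((\<lambda>x. (dist y x)\<^sup>2) has_derivative (\<lambda>h. h \<bullet> (2 *\<^sub>R (x - y)))) (at x)" for x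
    unfolding eq by (auto intro!: derivative_eq_intros simp: inner_commute)
  have H: "((\<lambda>x. (2 *\<^sub>R (x - y)) \<bullet> b) has_derivative (\<lambda>h. 2 * (h \<bullet> b))) (at x)" for x b
    by (auto intro!: derivative_eq_intros)
  note * = twice_diff_onI[OF open_UNIV G H]
  show "twice_diff_on (\<lambda>x. (dist y x)\<^sup>2) UNIV" using *(1) by blast
  show "laplacian (\<lambda>x. (dist y x)\<^sup>2) x = 2 * real DIM('a)" using *(2)[of x] by simp
  show "gradient (\<lambda>x. (dist y x)\<^sup>2) x = 2 *\<^sub>R (x - y)" using *(3)[of x] by simp
qed

text \<open>Comparison with the barrier exp (- a |x - y|^2) - exp (- \<alpha>) on the annulus
  between the radii r / 2 and r, with explicit constants. The choice a = \<alpha> / r^2 makes the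
  barrier invariant under scaling, so the estimate applies to a family of shrinking balls with one
  \<alpha>. The inhomogeneous term costs \<eta> r^2, which must stay below m exp (- \<alpha>), the
  least value of m exp (- a |x - y|^2) up to radius r.\<close>

lemma hopf_lower_bound:
  fixes v :: "'a::euclidean_space \<Rightarrow> real"
  assumes r: "0 < r" "r \<le> 1" and K: "0 \<le> K" and eta: "0 \<le> \<eta>" and m: "0 < m"
    and v: "twice_diff_on v (ball y r)"
    and nonneg: "\<And>x. x \<in> ball y r \<Longrightarrow> 0 \<le> v x"
    and lap: "\<And>x. x \<in> ball y r \<Longrightarrow> laplacian v x \<le> K * (norm (gradient v x) + v x) + \<eta>"
    and inner: "\<And>x. dist y x \<le> r / 2 \<Longrightarrow> m \<le> v x"
    and alpha: "2 * real DIM('a) + 3 * K + 1 \<le> \<alpha>"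
    and eta_small: "\<eta> * r\<^sup>2 * exp \<alpha> < m"
    and x: "r / 2 \<le> dist y x" "dist y x < r"
  shows "m * exp (- \<alpha>) * \<alpha> * (1 - (dist y x)\<^sup>2 / r\<^sup>2) \<le> v x"
proof -
  define a where "a = \<alpha> / r\<^sup>2"
  define \<zeta> where "\<zeta> = (\<lambda>s::real. exp (- a * s))"
  define h where "h = (\<lambda>\<rho>::real. \<zeta> (\<rho>\<^sup>2) - exp (- \<alpha>))"
  have a1: "\<alpha> \<ge> 1" using alpha K by (smt (verit) of_nat_0_le_iff)
  have a0: "a > 0" using a1 r by (simp add: a_def)
  have z1: "(\<zeta> has_real_derivative - a * \<zeta> t) (at t)" for t
    unfolding \<zeta>_def by (auto intro!: derivative_eq_intros)
  have z2: "((\<lambda>t. - a * \<zeta> t) has_real_derivative a\<^sup>2 * \<zeta> t) (at t)" for t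
    unfolding \<zeta>_def by (auto intro!: derivative_eq_intros simp: power2_eq_square)
  let ?\<phi> = "\<lambda>x. \<zeta> ((dist y x)\<^sup>2)"
  note phi = twice_diff_compose[OF open_UNIV twice_diff_dist_sq(1)[of y] z1 z2]
  have main: "m * h (dist y x) \<le> v x"
  proof (rule ccontr)
    assume "\<not> m * h (dist y x) \<le> v x"
    define \<mu> where "\<mu> = m * h (dist y x) - v x"
    have mu: "\<mu> > 0" using \<open>\<not> _\<close> by (simp add: \<mu>_def)
    have hr: "h r = 0" using r by (simp add: h_def \<zeta>_def a_def)
    have "isCont h r" unfolding h_def \<zeta>_def by (intro continuous_intros)
    then obtain d where d: "d > 0" "\<And>\<rho>. \<bar>\<rho> - r\<bar> < d \<Longrightarrow> \<bar>h \<rho> - h r\<bar> < \<mu> / m"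
      using mu m unfolding continuous_at_eps_delta dist_real_def by (metis divide_pos_pos)
    \<comment> \<open>\<open>v\<close> is controlled inside the open ball only, so the outer radius
      is shrunk until the barrier there is below \<mu>; nonnegativity of \<open>v\<close> then
      excludes a minimum of \<open>w\<close> on the outer sphere.\<close>
    define r' where "r' = max (dist y x) (r - d / 2)"
    have r': "r' < r" "dist y x \<le> r'" "\<bar>r' - r\<bar> < d" using d(1) x by (auto simp: r'_def)
    have hr': "m * h r' < \<mu>"
      using d(2)[OF r'(3)] m hr by (simp add: pos_less_divide_eq abs_less_iff mult.commute)
    define C where "C = cball y r' - ball y (r / 2)"
    have C: "C = {z. r / 2 \<le> dist y z \<and> dist y z \<le> r'}" by (auto simp: C_def)
    have "compact C" unfolding C_def by (intro compact_diff compact_cball open_ball)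
    moreover have "x \<in> C" using x r' by (auto simp: C)
    moreover have Csub: "C \<subseteq> ball y r" using r' by (auto simp: C)
    define w where "w = (\<lambda>z. v z - m * h (dist y z))"
    have "continuous_on C w" unfolding w_def h_def \<zeta>_def
      using continuous_at_imp_continuous_on twice_diff_onD(3)[OF v] Csub
      by (intro continuous_intros) blast
    ultimately obtain z where z: "z \<in> C" "\<And>t. t \<in> C \<Longrightarrow> w z \<le> w t"
      using continuous_attains_inf[of C w] by blast
    have wz: "w z \<le> - \<mu>" using z(2)[OF \<open>x \<in> C\<close>] by (simp add: w_def \<mu>_def)
    have zr: "z \<in> ball y r" using z Csub by blast
    have zeta1: "\<zeta> s \<le> 1" if "s \<ge> 0" for s using that a0 by (simp add: \<zeta>_def)
    have "dist y z \<noteq> r / 2"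
    proof
      assume "dist y z = r / 2"
      then have "m \<le> v z" using inner by simp
      moreover have "h (dist y z) \<le> 1"
        unfolding h_def using zeta1[of "(dist y z)\<^sup>2"] exp_gt_zero[of "-\<alpha>"] by (smt (verit) zero_le_power2)
      then have "m * h (dist y z) \<le> m * 1" using m by (intro mult_left_mono) auto
      ultimately show False using wz mu by (simp add: w_def)
    qed
    moreover have "dist y z \<noteq> r'"
      using wz nonneg[OF zr] hr' by (auto simp: w_def)
    ultimately have z2: "r / 2 < dist y z" "dist y z < r'" using z(1) by (auto simp: C)
    define S where "S = ball y r' - cball y (r / 2)"
    have S: "open S" "z \<in> S" "S \<subseteq> C" "S \<subseteq> ball y r" using z2 r' by (auto simp: S_def C)
    have vS: "twice_diff_on v S" and pS: "twice_diff_on ?\<phi> S"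
      using twice_diff_on_subset[OF v S(4)] twice_diff_on_subset[OF phi(1)] by auto
    note lc = twice_diff_lincomb[OF S(1) vS pS, where a = 1 and c = "- m"]
    have "1 * v z + (- m) * ?\<phi> z \<le> 1 * v t + (- m) * ?\<phi> t" if "t \<in> S" for t
      using z(2)[of t] that S(3) by (auto simp: w_def h_def algebra_simps)
    note min = local_min_gradient_laplacian[OF S(1) lc(1) S(2) this]
    define Z where "Z = ?\<phi> z"
    have Zp: "Z > 0" by (simp add: Z_def \<zeta>_def)
    have grad: "gradient v z = m *\<^sub>R gradient ?\<phi> z" using min(1) lc(3)[OF S(2)] by simp
    have lapv: "m * laplacian ?\<phi> z \<le> laplacian v z" using min(2) lc(2)[OF S(2)] by simp
    have n2: "norm (2 *\<^sub>R (z - y)) = 2 * dist y z"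
      by (simp add: dist_norm norm_minus_commute)
    have Lphi: "laplacian ?\<phi> z = a\<^sup>2 * Z * (4 * (dist y z)\<^sup>2) - a * Z * (2 * DIM('a))"
    proof -
      have n4: "(norm (2 *\<^sub>R (z - y)))\<^sup>2 = 4 * (dist y z)\<^sup>2"
        unfolding n2 by (simp add: power_mult_distrib)
      show ?thesis
        using phi(2)[of z] unfolding twice_diff_dist_sq(2,3) n4 by (simp add: Z_def)
    qed
    have gphi: "norm (gradient ?\<phi> z) = a * Z * (2 * dist y z)"
    proof -
      have "norm (gradient ?\<phi> z) = \<bar>- a * Z\<bar> * norm (2 *\<^sub>R (z - y))"
        using phi(3)[of z] unfolding twice_diff_dist_sq(3) by (simp add: Z_def abs_mult)
      then show ?thesis unfolding n2 using a0 Zp by (simp add: abs_mult)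
    qed
    have Zl: "exp (- \<alpha>) \<le> Z"
    proof -
      have "(dist y z)\<^sup>2 \<le> r\<^sup>2" using zr by (intro power_mono) auto
      then have "a * (dist y z)\<^sup>2 \<le> \<alpha>" using r a1 by (simp add: a_def divide_le_eq mult_left_mono)
      then show ?thesis by (simp add: Z_def \<zeta>_def)
    qed
    have vz: "v z \<le> m * Z"
    proof -
      have "v z \<le> m * h (dist y z)" using wz mu by (simp add: w_def)
      also have "\<dots> \<le> m * Z" using m by (simp add: h_def Z_def)
      finally show ?thesis .
    qed
    have "m * (a\<^sup>2 * Z * (4 * (dist y z)\<^sup>2) - a * Z * (2 * DIM('a)))
        \<le> K * (norm (gradient v z) + v z) + \<eta>"
      using lapv lap[OF zr] Lphi by simp
    also have "norm (gradient v z) = m * (a * Z * (2 * dist y z))"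
      using grad gphi m by simp
    also have "K * (m * (a * Z * (2 * dist y z)) + v z) \<le> K * (m * (a * Z * (2 * r)) + m * Z)"
      using K vz m a0 Zp zr by (intro mult_left_mono add_mono) auto
    finally have 1: "m * (a\<^sup>2 * Z * (4 * (dist y z)\<^sup>2) - a * Z * (2 * DIM('a)))
        \<le> K * (m * (a * Z * (2 * r)) + m * Z) + \<eta>" by simp
    \<comment> \<open>Here staying outside radius r / 2 matters: the leading term of the barrier's
      Laplacian keeps its full order a^2 r^2 and wins for large \<alpha>.\<close>
    have "r\<^sup>2 \<le> 4 * (dist y z)\<^sup>2"
      using z2(1) r power_mono[of r "2 * dist y z" 2] by (simp add: power_mult_distrib)
    then have "m * (a\<^sup>2 * Z * r\<^sup>2 - a * Z * (2 * DIM('a)))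
       \<le> m * (a\<^sup>2 * Z * (4 * (dist y z)\<^sup>2) - a * Z * (2 * DIM('a)))"
      using m Zp a0 by (intro mult_left_mono diff_mono) auto
    with 1 have "m * (a\<^sup>2 * Z * r\<^sup>2 - a * Z * (2 * DIM('a))) \<le> K * (m * (a * Z * (2 * r)) + m * Z) + \<eta>"
      by simp
    \<comment> \<open>The factor r^2 turns every a r^2 into \<alpha>. After cancelling
      \<open>m * Z\<close> and using r \<le> 1, an inequality in \<alpha>, K and the dimension
      remains, which the assumed lower bound on \<alpha> contradicts.\<close>
    then have E1: "r\<^sup>2 * (m * (a\<^sup>2 * Z * r\<^sup>2 - a * Z * (2 * DIM('a)))) \<le> r\<^sup>2 * (K * (m * (a * Z * (2 * r)) + m * Z) + \<eta>)"
      by (intro mult_left_mono) auto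
    have ar: "a * r\<^sup>2 = \<alpha>" using r by (simp add: a_def)
    have E2: "r\<^sup>2 * (m * (a\<^sup>2 * Z * r\<^sup>2 - a * Z * (2 * DIM('a)))) = m * Z * ((a * r\<^sup>2) * (a * r\<^sup>2 - 2 * DIM('a)))"
      by (simp add: algebra_simps power2_eq_square)
    have E3: "r\<^sup>2 * (K * (m * (a * Z * (2 * r)) + m * Z) + \<eta>) = m * Z * (K * (2 * (a * r\<^sup>2) * r + r\<^sup>2)) + \<eta> * r\<^sup>2"
      by (simp add: algebra_simps power2_eq_square)
    have E4: "\<eta> * r\<^sup>2 < m * Z"
    proof -
      have "\<eta> * r\<^sup>2 < m * exp (- \<alpha>)" using eta_small by (simp add: exp_minus field_simps)
      also have "\<dots> \<le> m * Z" using Zl m by simp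
      finally show ?thesis .
    qed
    have "m * Z * (\<alpha> * (\<alpha> - 2 * DIM('a))) < m * Z * (K * (2 * \<alpha> * r + r\<^sup>2)) + m * Z * 1"
      using E1 E4 unfolding E2 E3 ar by linarith
    then have "m * Z * (\<alpha> * (\<alpha> - 2 * DIM('a))) < m * Z * (K * (2 * \<alpha> * r + r\<^sup>2) + 1)"
      by (simp add: distrib_left)
    then have "\<alpha> * (\<alpha> - 2 * DIM('a)) < K * (2 * \<alpha> * r + r\<^sup>2) + 1"
      using m Zp by (simp add: mult_less_cancel_left_pos)
    also have "\<dots> \<le> K * (2 * \<alpha> * 1 + 1) + 1"
      using K r a1 power_le_one[of r 2] by (intro add_mono mult_left_mono) auto
    finally have "\<alpha> * (\<alpha> - 2 * DIM('a) - 2 * K) < K + 1" by (simp add: algebra_simps)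
    moreover have "1 * (K + 1) \<le> \<alpha> * (\<alpha> - 2 * DIM('a) - 2 * K)"
      using a1 alpha K by (intro mult_mono) auto
    ultimately show False by simp
  qed
  have "\<alpha> * (1 - (dist y x)\<^sup>2 / r\<^sup>2) \<le> exp (\<alpha> * (1 - (dist y x)\<^sup>2 / r\<^sup>2)) - 1"
    using exp_ge_add_one_self[of "\<alpha> * (1 - (dist y x)\<^sup>2 / r\<^sup>2)"] by linarith
  then have "exp (- \<alpha>) * (\<alpha> * (1 - (dist y x)\<^sup>2 / r\<^sup>2)) \<le> exp (- \<alpha>) * (exp (\<alpha> * (1 - (dist y x)\<^sup>2 / r\<^sup>2)) - 1)"
    by (intro mult_left_mono) auto
  also have "\<dots> = h (dist y x)"
  proof -
    have "exp (- \<alpha>) * exp (\<alpha> * (1 - (dist y x)\<^sup>2 / r\<^sup>2)) = \<zeta> ((dist y x)\<^sup>2)"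
      unfolding exp_add[symmetric] \<zeta>_def a_def by (simp add: algebra_simps)
    then show ?thesis by (simp add: h_def right_diff_distrib)
  qed
  finally have "m * (exp (- \<alpha>) * (\<alpha> * (1 - (dist y x)\<^sup>2 / r\<^sup>2))) \<le> m * h (dist y x)"
    using m by (intro mult_left_mono) auto
  with main show ?thesis by (simp add: mult.assoc)
qed

lemma positive_lower_bound_compact:
  fixes v :: "'a::t2_space \<Rightarrow> real"
  assumes "compact C" "continuous_on C v" "\<And>x. x \<in> C \<Longrightarrow> 0 < v x"
  shows "\<exists>m>0. \<forall>x\<in>C. m \<le> v x"
proof (cases "C = {}")
  case True then show ?thesis by (intro exI[of _ 1]) auto
next
  case False
  then show ?thesis using continuous_attains_inf[OF assms(1) False assms(2)] assms(3) by blast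
qed

text \<open>If \<open>v x1\<close> were positive, the largest ball about \<open>x1\<close> without
  zeros of \<open>v\<close> would touch a zero \<open>z\<close>. Hopf's lemma gives linear growth
  from \<open>z\<close>, but \<open>z\<close> is an interior minimum, where the gradient vanishes.
  The distance bound d / 2 keeps the touching ball inside \<open>ball x0 d\<close>.\<close>

lemma strong_max_principle_ball:
  fixes v :: "'a::euclidean_space \<Rightarrow> real"
  assumes d: "0 < d" and K: "0 \<le> K" and v: "twice_diff_on v (ball x0 d)"
    and nonneg: "\<And>x. x \<in> ball x0 d \<Longrightarrow> 0 \<le> v x"
    and lap: "\<And>x. x \<in> ball x0 d \<Longrightarrow> laplacian v x \<le> K * (norm (gradient v x) + v x)"
    and zero: "v x0 = 0" and d1: "d \<le> 1" and x1: "dist x0 x1 < d / 2"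
  shows "v x1 = 0"
proof (rule ccontr)
  assume ne: "v x1 \<noteq> 0"
  define A where "A = {z \<in> cball x1 (dist x1 x0). v z = 0}"
  have sub: "cball x1 (dist x1 x0) \<subseteq> ball x0 d"
  proof
    fix z assume "z \<in> cball x1 (dist x1 x0)"
    then show "z \<in> ball x0 d" using dist_triangle[of x0 z x1] x1 by (simp add: dist_commute)
  qed
  have cont: "continuous_on T v" if "T \<subseteq> ball x0 d" for T
    using continuous_at_imp_continuous_on twice_diff_onD(3)[OF v] that by blast
  have "compact A"
  proof -
    have "closed A" unfolding A_def
      by (rule continuous_closed_preimage_constant[OF cont[OF sub] closed_cball])
    moreover have "bounded A" by (rule bounded_subset[OF bounded_cball, of _ x1 "dist x1 x0"]) (auto simp: A_def)
    ultimately show ?thesis by (simp add: compact_eq_bounded_closed)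
  qed
  moreover have "x0 \<in> A" using zero by (simp add: A_def)
  ultimately obtain z where z: "z \<in> A" "\<And>t. t \<in> A \<Longrightarrow> dist x1 z \<le> dist x1 t"
    using distance_attains_inf[of A x1] by (auto simp: compact_imp_closed)
  define \<rho> where "\<rho> = dist x1 z"
  have zx: "\<rho> \<le> dist x1 x0" "v z = 0" using z by (auto simp: A_def \<rho>_def)
  have rho: "\<rho> > 0" using zx(2) ne by (auto simp: \<rho>_def)
  have bsub: "ball x1 \<rho> \<subseteq> ball x0 d" using sub subset_ball[OF zx(1), of x1] ball_subset_cball[of x1 "dist x1 x0"] by blast
  have pos: "0 < v t" if "t \<in> ball x1 \<rho>" for t
    using z(2)[of t] nonneg[of t] that bsub zx(1) by (force simp: A_def \<rho>_def)
  obtain m where m: "m > 0" "\<And>t. t \<in> cball x1 (\<rho> / 2) \<Longrightarrow> m \<le> v t"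
  proof -
    have "cball x1 (\<rho> / 2) \<subseteq> ball x1 \<rho>" using rho by auto
    then show ?thesis
      using positive_lower_bound_compact[OF compact_cball cont, of x1 "\<rho> / 2"] bsub pos that by blast
  qed
  define \<alpha> where "\<alpha> = 2 * real DIM('a) + 3 * K + 1"
  have ap: "\<alpha> > 0" using K by (simp add: \<alpha>_def add_nonneg_pos)
  have r1: "\<rho> \<le> 1" using zx(1) x1 d1 by (simp add: dist_commute)
  have hopf: "m * exp (- \<alpha>) * \<alpha> * (1 - (dist x1 x)\<^sup>2 / \<rho>\<^sup>2) \<le> v x"
    if "\<rho> / 2 \<le> dist x1 x" "dist x1 x < \<rho>" for x
    by (rule hopf_lower_bound[OF rho r1 K order.refl m(1) twice_diff_on_subset[OF v bsub]])
       (use that m(2) nonneg bsub lap m(1) in \<open>auto simp: \<alpha>_def subset_iff\<close>)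
  define c where "c = m * exp (- \<alpha>) * \<alpha>"
  have c: "c > 0" using m ap by (simp add: c_def)
  have zin: "z \<in> ball x0 d" using z sub by (auto simp: A_def)
  have g0: "gradient v z = 0"
    using local_min_gradient_laplacian(1)[OF open_ball v zin] nonneg zx(2) by simp
  \<comment> \<open>On the segment from \<open>z\<close> towards \<open>x1\<close> the vanishing
    gradient yields v < c t for small t, whereas Hopf's bound is c (1 - (1 - t)^2), which is at
    least c t for t \<le> 1.\<close>
  have "((\<lambda>t. v (z + t *\<^sub>R (x1 - z))) has_real_derivative ((x1 - z) \<bullet> gradient v (z + 0 *\<^sub>R (x1 - z)))) (at 0)"
    by (rule line_has_derivative) (use twice_diff_onD(1)[OF v zin] in simp)
  then have "((\<lambda>t. v (z + t *\<^sub>R (x1 - z)) - c * t) has_real_derivative (0 - c)) (at 0)"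
    using g0 by (auto intro!: derivative_eq_intros)
  from DERIV_neg_dec_right[OF this] c obtain \<delta> where \<delta>: "\<delta> > 0"
    "\<And>t. 0 < t \<Longrightarrow> t < \<delta> \<Longrightarrow> v (z + t *\<^sub>R (x1 - z)) - c * t < 0"
    using zx(2) by auto
  define t where "t = min \<delta> 1 / 2"
  have t: "0 < t" "t < \<delta>" "t \<le> 1 / 2" using \<delta>(1) by (auto simp: t_def)
  define x where "x = z + t *\<^sub>R (x1 - z)"
  have "x1 - x = (1 - t) *\<^sub>R (x1 - z)" by (simp add: x_def algebra_simps)
  then have dx: "dist x1 x = (1 - t) * \<rho>" using t by (simp add: dist_norm \<rho>_def)
  have "\<rho> / 2 \<le> dist x1 x" "dist x1 x < \<rho>" using rho t by (simp_all add: dx)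
  from hopf[OF this] have "c * (1 - (1 - t)\<^sup>2) \<le> v x"
    using rho by (simp add: dx c_def power_mult_distrib)
  moreover have "c * t \<le> c * (1 - (1 - t)\<^sup>2)"
  proof -
    have "t * t \<le> t * 1" using t by (intro mult_left_mono) auto
    then have "t \<le> 1 - (1 - t)\<^sup>2" by (simp add: power2_eq_square algebra_simps)
    then show ?thesis using c by simp
  qed
  ultimately show False using \<delta>(2)[OF t(1,2)] by (simp add: x_def)
qed

text \<open>The zero set is closed by continuity and open by the version on balls. The constant
  \<open>K\<close> may vary from point to point, since openness is a local matter.\<close>

lemma strong_max_principle:
  fixes v :: "'a::euclidean_space \<Rightarrow> real"
  assumes S: "open S" "connected S" and v: "twice_diff_on v S"
    and nonneg: "\<And>x. x \<in> S \<Longrightarrow> 0 \<le> v x"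
    and lap: "\<And>x. x \<in> S \<Longrightarrow> \<exists>d>0. \<exists>K. \<forall>y\<in>ball x d \<inter> S. laplacian v y \<le> K * (norm (gradient v y) + v y)"
    and zero: "x0 \<in> S" "v x0 = 0" and x: "x \<in> S"
  shows "v x = 0"
proof -
  define Z where "Z = {x \<in> S. v x = 0}"
  have "continuous_on S v"
    using continuous_at_imp_continuous_on twice_diff_onD(3)[OF v] by blast
  then have "closedin (top_of_set S) Z"
    unfolding Z_def by (rule continuous_closedin_preimage_constant)
  moreover have "openin (top_of_set S) Z"
  proof -
    have "\<exists>e>0. ball z e \<subseteq> Z" if z: "z \<in> Z" for z
    proof -
      have zS: "z \<in> S" "v z = 0" using z by (auto simp: Z_def)
      obtain d1 where d1: "d1 > 0" "ball z d1 \<subseteq> S" using S(1) zS(1) open_contains_ball by blast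
      obtain d2 K where d2: "d2 > 0"
        "\<And>y. y \<in> ball z d2 \<inter> S \<Longrightarrow> laplacian v y \<le> K * (norm (gradient v y) + v y)"
        using lap[OF zS(1)] by blast
      define d where "d = min (min d1 d2) 1"
      have d: "d > 0" "d \<le> 1" "ball z d \<subseteq> S" "ball z d \<subseteq> ball z d2"
        using d1 d2(1) by (auto simp: d_def subset_iff)
      have lap': "laplacian v y \<le> \<bar>K\<bar> * (norm (gradient v y) + v y)" if "y \<in> ball z d" for y
      proof -
        have "y \<in> S" using that d by blast
        have "laplacian v y \<le> K * (norm (gradient v y) + v y)" using d2(2) that d by blast
        also have "\<dots> \<le> \<bar>K\<bar> * (norm (gradient v y) + v y)"
          using nonneg[OF \<open>y \<in> S\<close>] by (intro mult_right_mono) auto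
        finally show ?thesis .
      qed
      have "v y = 0" if "dist z y < d / 2" for y
        by (rule strong_max_principle_ball[OF d(1) _ twice_diff_on_subset[OF v d(3)] _ lap' zS(2) d(2) that])
           (use nonneg d in \<open>auto simp: subset_iff\<close>)
      then have "ball z (d / 2) \<subseteq> Z" using d by (auto simp: Z_def subset_iff)
      then show ?thesis using d(1) by (intro exI[of _ "d / 2"]) auto
    qed
    then have "open Z" by (simp add: open_contains_ball)
    then show ?thesis by (rule open_openin_trans[OF S(1)]) (auto simp: Z_def)
  qed
  ultimately have "Z = S" using S(2) zero unfolding connected_clopen by (auto simp: Z_def)
  then show ?thesis using x by (auto simp: Z_def)
qed

subsection \<open>The one-dimensional problem\<close>

text \<open>A choice of primitive as a function of the integrand, so that the integral operator for
  the differential equation can be written down as a map; it is meaningful for continuous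
  \<open>h\<close>.\<close>

definition antiderivative :: "(real \<Rightarrow> real) \<Rightarrow> real \<Rightarrow> real" where
  "antiderivative h = (SOME H. (\<forall>t. (H has_real_derivative h t) (at t)) \<and> H 0 = 0)"

lemma antiderivative:
  assumes "continuous_on UNIV h"
  shows "(antiderivative h has_real_derivative h t) (at t)" and "antiderivative h 0 = 0"
proof -
  have "isCont h x" for x using assms by (simp add: continuous_on_eq_continuous_at)
  then obtain H where "\<And>x. (H has_vector_derivative h x) (at x)"
    using einterval_antiderivative[of "-\<infinity>" \<infinity> h] by auto
  then have "(\<forall>t. ((\<lambda>t. H t - H 0) has_real_derivative h t) (at t)) \<and> H 0 - H 0 = 0"
    by (auto simp: has_real_derivative_iff_has_vector_derivative intro!: derivative_eq_intros)
  then have "(\<forall>t. (antiderivative h has_real_derivative h t) (at t)) \<and> antiderivative h 0 = 0"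
    unfolding antiderivative_def by (rule someI[of "\<lambda>H. (\<forall>t. (H has_real_derivative h t) (at t)) \<and> H 0 = 0" "\<lambda>t. H t - H 0"])
  then show "(antiderivative h has_real_derivative h t) (at t)" and "antiderivative h 0 = 0" by auto
qed

text \<open>Two derivatives multiply cosh (l t) by l^2, so integrating twice a bound by cosh (l t)
  gains the factor 1 / l^2. This gain becomes the contraction constant in the existence
  proof.\<close>

lemma double_antiderivative_bound_pos:
  fixes J J' h :: "real \<Rightarrow> real"
  assumes J: "\<And>t. (J has_real_derivative J' t) (at t)" "\<And>t. (J' has_real_derivative h t) (at t)"
    and 0: "J 0 = 0" "J' 0 = 0" and h: "\<And>t. h t \<le> C * cosh (l * t)"
    and l: "l > 0" and t: "0 \<le> (t::real)"
  shows "J t \<le> C / l\<^sup>2 * (cosh (l * t) - 1)"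
proof -
  have 1: "J' t \<le> C / l * sinh (l * t)" if "t \<ge> 0" for t
  proof -
    have "C / l * sinh (l * 0) - J' 0 \<le> C / l * sinh (l * t) - J' t"
    proof (rule DERIV_nonneg_imp_nondecreasing[OF that], intro exI conjI)
      fix x :: real
      show "((\<lambda>t. C / l * sinh (l * t) - J' t) has_real_derivative (C * cosh (l * x) - h x)) (at x)"
        using l by (auto intro!: derivative_eq_intros J)
      show "0 \<le> C * cosh (l * x) - h x" using h[of x] by simp
    qed
    then show ?thesis using 0 by simp
  qed
  have "C / l\<^sup>2 * (cosh (l * 0) - 1) - J 0 \<le> C / l\<^sup>2 * (cosh (l * t) - 1) - J t"
  proof (rule DERIV_nonneg_imp_nondecreasing[OF t], intro exI conjI)
    fix x :: real assume "0 \<le> x"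
    show "((\<lambda>t. C / l\<^sup>2 * (cosh (l * t) - 1) - J t) has_real_derivative (C / l * sinh (l * x) - J' x)) (at x)"
      using l by (auto intro!: derivative_eq_intros J simp: power2_eq_square)
    show "0 \<le> C / l * sinh (l * x) - J' x" using 1[OF \<open>0 \<le> x\<close>] by simp
  qed
  then show ?thesis using 0 by simp
qed

lemma double_antiderivative_bound:
  fixes J J' h :: "real \<Rightarrow> real"
  assumes J: "\<And>t. (J has_real_derivative J' t) (at t)" "\<And>t. (J' has_real_derivative h t) (at t)"
    and 0: "J 0 = 0" "J' 0 = 0" and h: "\<And>t. \<bar>h t\<bar> \<le> C * cosh (l * t)"
    and l: "l > 0"
  shows "\<bar>J t\<bar> \<le> C / l\<^sup>2 * cosh (l * t)"
proof -
  have C: "C \<ge> 0" using h[of 0] by simp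
  have pos: "J t \<le> C / l\<^sup>2 * cosh (l * t)"
    if J: "\<And>t. (J has_real_derivative J' t) (at t)" "\<And>t. (J' has_real_derivative h t) (at t)"
    and 0: "J 0 = 0" "J' 0 = 0" and h: "\<And>t. h t \<le> C * cosh (l * t)" for J J' h and t :: real
  proof -
    have pp: "J t \<le> C / l\<^sup>2 * (cosh (l * t) - 1)"
    proof (cases "t \<ge> 0")
      case True
      then show ?thesis by (rule double_antiderivative_bound_pos[OF J 0 h l])
    next
      case False
      have "J (- (- t)) \<le> C / l\<^sup>2 * (cosh (l * (- t)) - 1)"
      proof (rule double_antiderivative_bound_pos[where J = "\<lambda>t. J (- t)" and J' = "\<lambda>t. - J' (- t)" and h = "\<lambda>t. h (- t)"])
        show "((\<lambda>t. J (- t)) has_real_derivative - J' (- t)) (at t)" for t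
          using J(1)[of "- t"] DERIV_mirror[of J "J' (- t)" t] by simp
        show "((\<lambda>t. - J' (- t)) has_real_derivative h (- t)) (at t)" for t
          using DERIV_minus[OF J(2)[of "- t", unfolded DERIV_mirror]] by simp
        show "h (- t) \<le> C * cosh (l * t)" for t using h[of "- t"] by simp
      qed (use 0 l False in auto)
      then show ?thesis by simp
    qed
    also have "\<dots> \<le> C / l\<^sup>2 * cosh (l * t)" using C by (intro mult_left_mono) auto
    finally show ?thesis .
  qed
  have "J t \<le> C / l\<^sup>2 * cosh (l * t)" by (rule pos[OF J 0]) (use h abs_le_D1 in blast)
  moreover have "- J t \<le> C / l\<^sup>2 * cosh (l * t)"
    by (rule pos[where J = "\<lambda>t. - J t", OF DERIV_minus[OF J(1)] DERIV_minus[OF J(2)]])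
       (use 0 h abs_le_D2 in auto)
  ultimately show ?thesis by (simp add: abs_le_iff)
qed

text \<open>Global existence in a single fixed point argument: the solution is sought as cosh (l t)
  times a bounded continuous function. In this weighted norm the twice integrated equation is a
  contraction on the whole real line, so no local solutions have to be glued.\<close>

lemma second_order_ode_exists:
  fixes f :: "real \<Rightarrow> real"
  assumes f: "L-lipschitz_on UNIV f"
  shows "\<exists>g g'. (\<forall>t. (g has_real_derivative g' t) (at t)) \<and>
    (\<forall>t. (g' has_real_derivative - f (g t)) (at t)) \<and> g 0 = 0 \<and> g' 0 = \<kappa>"
proof -
  have L: "L \<ge> 0" using f lipschitz_on_nonneg by blast
  have fL: "\<bar>f a - f b\<bar> \<le> L * \<bar>a - b\<bar>" for a b
    using lipschitz_onD[OF f, of a b] by (simp add: dist_real_def)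
  have fcont: "continuous_on UNIV f" using f by (rule lipschitz_on_continuous_on)
  \<comment> \<open>With l^2 = 2 L + 1 the contraction constant L / l^2 is at most 1 / 2; moreover l
    \<ge> 1 makes \<kappa> t / cosh (l t) bounded.\<close>
  define l where "l = sqrt (2 * L + 1)"
  have l2: "l\<^sup>2 = 2 * L + 1" using L by (simp add: l_def)
  have l1: "l \<ge> 1" using L by (simp add: l_def)
  define h where "h = (\<lambda>\<phi> :: real \<Rightarrow>\<^sub>C real. \<lambda>s. f (cosh (l * s) * apply_bcontfun \<phi> s))"
  have hcont: "continuous_on UNIV (h \<phi>)" for \<phi>
    unfolding h_def
    by (intro continuous_on_compose2[OF fcont] continuous_intros) auto
  define A where "A = (\<lambda>\<phi>. antiderivative (h \<phi>))"
  define B where "B = (\<lambda>\<phi>. antiderivative (A \<phi>))"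
  have A: "(A \<phi> has_real_derivative h \<phi> t) (at t)" "A \<phi> 0 = 0" for \<phi> t
    unfolding A_def using antiderivative[OF hcont] by auto
  have "continuous_on UNIV (A \<phi>)" for \<phi>
    using A(1) DERIV_isCont by (blast intro: continuous_at_imp_continuous_on)
  then have B: "(B \<phi> has_real_derivative A \<phi> t) (at t)" "B \<phi> 0 = 0" for \<phi> t
    unfolding B_def using antiderivative by auto
  have cosh_ge: "\<bar>t\<bar> \<le> 2 * cosh (l * t)" for t
  proof -
    have "\<bar>t\<bar> \<le> \<bar>l * t\<bar>" using l1 by (simp add: abs_mult mult_le_cancel_right1)
    also have "\<dots> \<le> exp \<bar>l * t\<bar>" using exp_ge_add_one_self[of "\<bar>l * t\<bar>"] by linarith
    also have "\<dots> \<le> exp (l * t) + exp (- (l * t))" by (cases "l * t \<ge> 0") auto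
    finally show ?thesis by (simp add: cosh_field_def)
  qed
  have "\<exists>\<psi> :: real \<Rightarrow>\<^sub>C real. \<forall>t. apply_bcontfun \<psi> t = (\<kappa> * t - B \<phi> t) / cosh (l * t)" for \<phi>
  proof -
    obtain M where M: "\<And>t. \<bar>apply_bcontfun \<phi> t\<bar> \<le> M"
      using bounded_apply_bcontfun[of \<phi>] by (auto simp: bounded_iff)
    have hb: "\<bar>h \<phi> t\<bar> \<le> (\<bar>f 0\<bar> + L * M) * cosh (l * t)" for t
    proof -
      have "\<bar>h \<phi> t\<bar> \<le> \<bar>f 0\<bar> + L * \<bar>cosh (l * t) * apply_bcontfun \<phi> t\<bar>"
        using fL[of "cosh (l * t) * apply_bcontfun \<phi> t" 0] by (simp add: h_def)
      also have "\<dots> \<le> \<bar>f 0\<bar> * cosh (l * t) + L * (cosh (l * t) * M)"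
      proof (intro add_mono mult_left_mono L)
        show "\<bar>f 0\<bar> \<le> \<bar>f 0\<bar> * cosh (l * t)" using cosh_real_ge_1[of "l * t"] by (simp add: mult_le_cancel_left1)
        show "\<bar>cosh (l * t) * apply_bcontfun \<phi> t\<bar> \<le> cosh (l * t) * M"
          using M[of t] by (simp add: abs_mult)
      qed
      finally show ?thesis by (simp add: algebra_simps)
    qed
    have Bb: "\<bar>B \<phi> t\<bar> \<le> (\<bar>f 0\<bar> + L * M) / l\<^sup>2 * cosh (l * t)" for t
      by (rule double_antiderivative_bound[OF B(1) A(1) B(2) A(2) hb]) (use l1 in auto)
    have "(\<lambda>t. (\<kappa> * t - B \<phi> t) / cosh (l * t)) \<in> bcontfun"
    proof (rule bcontfun_normI)
      have "continuous_on UNIV (B \<phi>)"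
        using B(1) DERIV_isCont by (blast intro: continuous_at_imp_continuous_on)
      then show "continuous_on UNIV (\<lambda>t. (\<kappa> * t - B \<phi> t) / cosh (l * t))"
        by (intro continuous_intros) auto
      fix t
      have "\<bar>\<kappa> * t - B \<phi> t\<bar> \<le> \<bar>\<kappa>\<bar> * \<bar>t\<bar> + \<bar>B \<phi> t\<bar>" using abs_triangle_ineq4[of "\<kappa> * t" "B \<phi> t"] by (simp add: abs_mult)
      also have "\<dots> \<le> \<bar>\<kappa>\<bar> * (2 * cosh (l * t)) + (\<bar>f 0\<bar> + L * M) / l\<^sup>2 * cosh (l * t)"
        by (intro add_mono mult_left_mono cosh_ge Bb) auto
      finally have "\<bar>\<kappa> * t - B \<phi> t\<bar> \<le> (2 * \<bar>\<kappa>\<bar> + (\<bar>f 0\<bar> + L * M) / l\<^sup>2) * cosh (l * t)"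
        by (simp add: algebra_simps)
      then show "norm ((\<kappa> * t - B \<phi> t) / cosh (l * t)) \<le> 2 * \<bar>\<kappa>\<bar> + (\<bar>f 0\<bar> + L * M) / l\<^sup>2"
        by (simp add: pos_divide_le_eq)
    qed
    then obtain \<psi> where \<psi>: "(\<lambda>t. (\<kappa> * t - B \<phi> t) / cosh (l * t)) = apply_bcontfun \<psi>"
      by (rule bcontfunE)
    show ?thesis by (rule exI[of _ \<psi>]) (use fun_cong[OF \<psi>] in simp)
  qed
  then have "\<exists>T. \<forall>\<phi> t. apply_bcontfun (T \<phi>) t = (\<kappa> * t - B \<phi> t) / cosh (l * t)"
    by (intro choice allI)
  then obtain T :: "(real \<Rightarrow>\<^sub>C real) \<Rightarrow> (real \<Rightarrow>\<^sub>C real)"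
    where T: "\<And>\<phi> t. apply_bcontfun (T \<phi>) t = (\<kappa> * t - B \<phi> t) / cosh (l * t)"
    by blast
  have "\<exists>!\<phi>. T \<phi> = \<phi>"
  proof (rule banach_fix_type[where c = "1 / 2"])
    show "\<forall>\<phi> \<psi>. dist (T \<phi>) (T \<psi>) \<le> 1 / 2 * dist \<phi> \<psi>"
    proof (intro allI dist_bound)
      fix \<phi> \<psi> :: "real \<Rightarrow>\<^sub>C real" and t :: real
      let ?d = "dist \<phi> \<psi>"
      have "\<bar>B \<psi> t - B \<phi> t\<bar> \<le> (L * ?d) / l\<^sup>2 * cosh (l * t)"
      proof (rule double_antiderivative_bound)
        show "((\<lambda>t. B \<psi> t - B \<phi> t) has_real_derivative (A \<psi> t - A \<phi> t)) (at t)" for t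
          by (intro DERIV_diff B)
        show "((\<lambda>t. A \<psi> t - A \<phi> t) has_real_derivative (h \<psi> t - h \<phi> t)) (at t)" for t
          by (intro DERIV_diff A)
        show "\<bar>h \<psi> t - h \<phi> t\<bar> \<le> L * ?d * cosh (l * t)" for t
        proof -
          have "\<bar>h \<psi> t - h \<phi> t\<bar> \<le> L * \<bar>cosh (l * t) * (apply_bcontfun \<psi> t - apply_bcontfun \<phi> t)\<bar>"
            using fL by (simp add: h_def right_diff_distrib)
          also have "\<dots> \<le> L * (cosh (l * t) * ?d)"
            using dist_bounded[of \<psi> t \<phi>] L
            by (intro mult_left_mono) (auto simp: abs_mult dist_real_def dist_commute)
          finally show ?thesis by (simp add: mult_ac)
        qed
      qed (use A(2) B(2) l1 in auto)
      also have "\<dots> \<le> (1 / 2 * ?d) * cosh (l * t)"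
      proof (rule mult_right_mono)
        have "L * ?d * 2 \<le> ?d * l\<^sup>2" unfolding l2 by (simp add: algebra_simps)
        then show "L * ?d / l\<^sup>2 \<le> 1 / 2 * ?d" using l1 by (simp add: divide_le_eq)
      qed auto
      finally have "\<bar>B \<psi> t - B \<phi> t\<bar> / cosh (l * t) \<le> 1 / 2 * ?d"
        by (simp add: pos_divide_le_eq)
      moreover have "dist (T \<phi> t) (T \<psi> t) = \<bar>B \<psi> t - B \<phi> t\<bar> / cosh (l * t)"
        by (simp add: T dist_real_def diff_divide_distrib[symmetric] abs_divide)
      ultimately show "dist (T \<phi> t) (T \<psi> t) \<le> 1 / 2 * ?d" by simp
    qed
  qed auto
  then obtain \<phi> where \<phi>: "T \<phi> = \<phi>" by blast
  define g where "g = (\<lambda>t. \<kappa> * t - B \<phi> t)"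
  define g' where "g' = (\<lambda>t. \<kappa> - A \<phi> t)"
  have "h \<phi> t = f (g t)" for t
  proof -
    have "apply_bcontfun \<phi> t = g t / cosh (l * t)" using T[of \<phi> t] by (simp add: \<phi> g_def)
    then show ?thesis by (simp add: h_def)
  qed
  then have "(g has_real_derivative g' t) (at t)" "(g' has_real_derivative - f (g t)) (at t)" for t
    unfolding g_def[abs_def] g'_def using A(1)[of \<phi> t] B(1)[of \<phi> t]
    by (auto intro!: derivative_eq_intros)
  moreover have "g 0 = 0" "g' 0 = \<kappa>" by (simp_all add: g_def g'_def A B)
  ultimately show ?thesis by blast
qed

text \<open>Gronwall's argument for the squared distance in phase space. The form is made for
  segments parametrised by the unit interval: \<open>c\<close> absorbs their speed, and at the end
  points only continuity is required, because a segment may start on the boundary of the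
  domain.\<close>

lemma second_order_ode_unique:
  fixes f :: "real \<Rightarrow> real"
  assumes f: "L-lipschitz_on UNIV f"
    and cont: "continuous_on {0..1} y1" "continuous_on {0..1} z1"
      "continuous_on {0..1} y2" "continuous_on {0..1} z2"
    and D: "\<And>t. 0 < t \<Longrightarrow> t < 1 \<Longrightarrow> (y1 has_real_derivative z1 t) (at t)"
      "\<And>t. 0 < t \<Longrightarrow> t < 1 \<Longrightarrow> (z1 has_real_derivative c * f (y1 t)) (at t)"
      "\<And>t. 0 < t \<Longrightarrow> t < 1 \<Longrightarrow> (y2 has_real_derivative z2 t) (at t)"
      "\<And>t. 0 < t \<Longrightarrow> t < 1 \<Longrightarrow> (z2 has_real_derivative c * f (y2 t)) (at t)"
    and init: "y1 0 = y2 0" "z1 0 = z2 0"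
  shows "y1 1 = y2 1"
proof -
  have L: "L \<ge> 0" using f lipschitz_on_nonneg by blast
  define K where "K = 1 + \<bar>c\<bar> * L"
  define N where "N = (\<lambda>t. exp (- K * t) * ((y1 t - y2 t)\<^sup>2 + (z1 t - z2 t)\<^sup>2))"
  have "N 1 \<le> N 0"
  proof (rule DERIV_nonpos_imp_decreasing_open[of 0 1 N])
    show "continuous_on {0..1} N" unfolding N_def by (intro continuous_intros cont)
    fix t :: real assume t: "0 < t" "t < 1"
    let ?a = "y1 t - y2 t" and ?b = "z1 t - z2 t"
    let ?N' = "exp (- K * t) * (2 * ?a * ?b + 2 * ?b * (c * (f (y1 t) - f (y2 t))) - K * (?a\<^sup>2 + ?b\<^sup>2))"
    have "(N has_real_derivative ?N') (at t)"
      unfolding N_def using D[OF t]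
      by (auto intro!: derivative_eq_intros simp: algebra_simps power2_eq_square)
    moreover have "?N' \<le> 0"
    proof -
      have fL: "\<bar>f (y1 t) - f (y2 t)\<bar> \<le> L * \<bar>?a\<bar>"
        using lipschitz_onD[OF f, of "y1 t" "y2 t"] by (simp add: dist_real_def)
      have "2 * ?a * ?b \<le> 2 * \<bar>?a\<bar> * \<bar>?b\<bar>"
        using abs_ge_self[of "2 * ?a * ?b"] by (simp only: abs_mult abs_numeral)
      moreover have "2 * ?b * (c * (f (y1 t) - f (y2 t))) \<le> 2 * \<bar>?a\<bar> * \<bar>?b\<bar> * (\<bar>c\<bar> * L)"
      proof -
        have "2 * ?b * (c * (f (y1 t) - f (y2 t))) \<le> \<bar>2 * ?b * (c * (f (y1 t) - f (y2 t)))\<bar>"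
          by (rule abs_ge_self)
        also have "\<dots> = 2 * \<bar>?b\<bar> * \<bar>c\<bar> * \<bar>f (y1 t) - f (y2 t)\<bar>"
            by (simp only: abs_mult abs_numeral mult.assoc)
        also have "\<dots> \<le> 2 * \<bar>?b\<bar> * \<bar>c\<bar> * (L * \<bar>?a\<bar>)" using fL by (intro mult_left_mono) auto
        finally show ?thesis by (simp add: mult_ac)
      qed
      ultimately have "2 * ?a * ?b + 2 * ?b * (c * (f (y1 t) - f (y2 t))) \<le> K * (2 * \<bar>?a\<bar> * \<bar>?b\<bar>)"
        by (simp add: K_def algebra_simps)
      also have "\<dots> \<le> K * (\<bar>?a\<bar>\<^sup>2 + \<bar>?b\<bar>\<^sup>2)"
        using L by (intro mult_left_mono sum_squares_bound) (simp add: K_def)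
      finally show ?thesis by (simp add: mult_le_0_iff)
    qed
    ultimately show "\<exists>y. (N has_real_derivative y) (at t) \<and> y \<le> 0" by blast
  qed simp
  then have "(y1 1 - y2 1)\<^sup>2 + (z1 1 - z2 1)\<^sup>2 \<le> 0"
    using init by (simp add: N_def mult_le_0_iff)
  then show ?thesis by (simp add: sum_power2_le_zero_iff)
qed

section \<open>Energy, turning points and comparison with the one-dimensional solution\<close>

lemma ode_energy:
  fixes g g' f F :: "real \<Rightarrow> real"
  assumes "\<And>t. (g has_real_derivative g' t) (at t)"
    and "\<And>t. (g' has_real_derivative - f (g t)) (at t)"
    and "\<And>t. (F has_real_derivative f t) (at t)"
  shows "(g' t)\<^sup>2 + 2 * F (g t) = (g' s)\<^sup>2 + 2 * F (g s)"
proof (rule DERIV_isconst_all[of "\<lambda>t. (g' t)\<^sup>2 + 2 * F (g t)"])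
  show "\<forall>x. ((\<lambda>t. (g' t)\<^sup>2 + 2 * F (g t)) has_real_derivative 0) (at x)"
  proof
    fix x
    show "((\<lambda>t. (g' t)\<^sup>2 + 2 * F (g t)) has_real_derivative 0) (at x)"
      using assms DERIV_chain2[OF assms(3)[of "g x"] assms(1)[of x]]
      by (auto intro!: derivative_eq_intros simp: power2_eq_square)
  qed
qed

text \<open>If \<open>g'\<close> and \<open>f (g t)\<close> vanished together at \<open>t0\<close>,
  the constant \<open>g t0\<close> would solve the same initial value problem, so \<open>g\<close>
  would be constant, against \<open>g' 0 \<noteq> 0\<close>. The step \<open>h\<close> rescales time
  to fit the uniqueness lemma.\<close>

lemma ode_turning_point:
  fixes f :: "real \<Rightarrow> real"
  assumes f: "L-lipschitz_on UNIV f"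
    and g: "\<And>t. (g has_real_derivative g' t) (at t)"
    and g': "\<And>t. (g' has_real_derivative - f (g t)) (at t)"
    and ne: "g' 0 \<noteq> 0" and t0: "g' t0 = 0"
  shows "f (g t0) \<noteq> 0"
proof
  assume f0: "f (g t0) = 0"
  have "g (t0 + 1 * h) = g t0" for h
  proof -
    have lin: "((\<lambda>s. t0 + s * h) has_real_derivative h) (at s)" for s
      by (auto intro!: derivative_eq_intros)
    have D1: "((\<lambda>s. g (t0 + s * h)) has_real_derivative h * g' (t0 + s * h)) (at s)" for s
      using DERIV_chain2[OF g lin, of s] by (simp only: mult.commute[of "g' _"])
    have D2: "((\<lambda>s. h * g' (t0 + s * h)) has_real_derivative (- h\<^sup>2) * f (g (t0 + s * h))) (at s)" for s
      using DERIV_cmult[OF DERIV_chain2[OF g' lin], of h s] by (simp add: power2_eq_square mult_ac)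
    have D3: "((\<lambda>_. g t0) has_real_derivative 0) (at s)"
      "((\<lambda>_. 0) has_real_derivative (- h\<^sup>2) * f (g t0)) (at s)" for s :: real
      using f0 by simp_all
    have co: "continuous_on {0..1} y" if "\<And>s. (y has_real_derivative y' s) (at s)" for y y' :: "real \<Rightarrow> real"
      using that DERIV_isCont by (blast intro: continuous_at_imp_continuous_on)
    show ?thesis
      by (rule second_order_ode_unique[OF f co[OF D1] co[OF D2] co[OF D3(1)] co[OF D3(2)] D1 D2 D3(1) D3(2)])
         (use t0 in simp_all)
  qed
  from this[of "t - t0" for t] have "g = (\<lambda>_. g t0)" by (simp add: fun_eq_iff)
  then have "(g has_real_derivative 0) (at 0)" using DERIV_const[of "g t0" "at 0"] by simp
  then show False using g[of 0] ne DERIV_unique by blast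
qed

text \<open>For a solution with energy E this is the inverse function: time as a function of height.
  Truncation at c^2 makes it increasing and differentiable on all of the real line, also where E - 2
  F is small or negative, and it only decreases the integrand; hence a function of slope at most
  sqrt (E - 2 F) still has slope at most 1 in the new parameter.\<close>

lemma truncated_speed_function:
  fixes F :: "real \<Rightarrow> real"
  assumes F: "continuous_on UNIV F" and c: "c > 0"
  shows "\<exists>\<Phi>. (\<forall>t. (\<Phi> has_real_derivative 1 / sqrt (max (E - 2 * F t) (c\<^sup>2))) (at t)) \<and>
    strict_mono \<Phi> \<and> \<Phi> 0 = 0"
proof -
  let ?h = "\<lambda>t. 1 / sqrt (max (E - 2 * F t) (c\<^sup>2))"
  have pos: "max (E - 2 * F t) (c\<^sup>2) > 0" for t using c by (simp add: less_max_iff_disj)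
  then have "\<forall>t\<in>UNIV. sqrt (max (E - 2 * F t) (c\<^sup>2)) \<noteq> 0"
    using real_sqrt_gt_zero less_irrefl by metis
  then have "continuous_on UNIV ?h"
    by (intro continuous_on_divide continuous_on_real_sqrt continuous_on_max continuous_on_diff
        continuous_on_mult continuous_on_const F)
  note A = antiderivative[OF this]
  have "strict_mono (antiderivative ?h)"
  proof (rule strict_monoI)
    fix x y :: real assume "x < y"
    then show "antiderivative ?h x < antiderivative ?h y"
    proof (rule DERIV_pos_imp_increasing)
      fix t
      have "0 < ?h t" using pos[of t] by simp
      then show "\<exists>z. (antiderivative ?h has_real_derivative z) (at t) \<and> 0 < z" using A(1) by blast
    qed
  qed
  then show ?thesis using A by blast
qed

text \<open>Among the functions starting at the turning value with at most the speed prescribed by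
  the energy, \<open>g\<close> descends fastest. The speed is not Lipschitz at the turning value, so
  the comparison is made with \<open>g\<close> given a head start \<epsilon>, when it already moves,
  and then \<epsilon> tends to 0.\<close>

lemma turning_point_comparison:
  fixes f F g g' :: "real \<Rightarrow> real"
  assumes F: "\<And>t. (F has_real_derivative f t) (at t)" and fc: "continuous_on UNIV f"
    and g: "\<And>t. (g has_real_derivative g' t) (at t)"
    and g': "\<And>t. (g' has_real_derivative - f (g t)) (at t)"
    and turn: "g' t0 = 0" "f (g t0) > 0"
  shows "\<exists>d>0. \<forall>\<sigma> y y'. 0 < \<sigma> \<longrightarrow> \<sigma> < d \<longrightarrow> continuous_on {0..\<sigma>} y \<longrightarrow> y 0 = g t0 \<longrightarrow>
     (\<forall>s. 0 < s \<longrightarrow> s < \<sigma> \<longrightarrow> (y has_real_derivative y' s) (at s) \<and> (y' s)\<^sup>2 \<le> 2 * F (g t0) - 2 * F (y s)) \<longrightarrow>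
     g (t0 + \<sigma>) \<le> y \<sigma>"
proof -
  have cg: "isCont g t" for t using g DERIV_isCont by blast
  have cF: "continuous_on UNIV F" using F DERIV_isCont by (blast intro: continuous_at_imp_continuous_on)
  have "isCont (\<lambda>t. f (g t)) t0"
    using continuous_on_compose2[OF fc continuous_at_imp_continuous_on[of UNIV g]] cg
    by (simp add: continuous_on_eq_continuous_at)
  then obtain d where d: "d > 0" "\<And>t. \<bar>t - t0\<bar> < d \<Longrightarrow> \<bar>f (g t) - f (g t0)\<bar> < f (g t0)"
    using turn(2) unfolding continuous_at_eps_delta dist_real_def by blast
  have fpos: "f (g t) > 0" if "\<bar>t - t0\<bar> < d" for t using d(2)[OF that] by simp
  have g'dec: "g' b < g' a" if "t0 \<le> a" "a < b" "b < t0 + d" for a b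
    by (rule DERIV_neg_imp_decreasing[OF that(2)])
       (use g' fpos that in \<open>force simp: abs_less_iff\<close>)
  have g'neg: "g' a < 0" if "t0 < a" "a < t0 + d" for a
    using g'dec[of t0 a] that turn(1) by simp
  have gdec: "g b \<le> g t0" if "t0 \<le> b" "b < t0 + d" for b
  proof (rule DERIV_nonpos_imp_nonincreasing[OF that(1)])
    fix x assume "t0 \<le> x" "x \<le> b"
    then show "\<exists>y. (g has_real_derivative y) (at x) \<and> y \<le> 0"
      using g g'neg[of x] turn(1) that by (intro exI[of _ "g' x"]) (auto simp: le_less)
  qed
  show ?thesis
  proof (intro exI[of _ "d / 2"] conjI allI impI)
    show "0 < d / 2" using d by simp
    fix \<sigma> y y'
    assume \<sigma>: "0 < \<sigma>" "\<sigma> < d / 2" and yc: "continuous_on {0..\<sigma>} y" and y0: "y 0 = g t0"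
      and yD: "\<forall>s. 0 < s \<longrightarrow> s < \<sigma> \<longrightarrow> (y has_real_derivative y' s) (at s) \<and> (y' s)\<^sup>2 \<le> 2 * F (g t0) - 2 * F (y s)"
    have key: "g (t0 + \<epsilon> + \<sigma>) \<le> y \<sigma>" if e: "0 < \<epsilon>" "\<epsilon> < d / 2" for \<epsilon>
    proof -
      \<comment> \<open>\<open>c\<close> is the speed reached after the head start. From then on
        \<open>g\<close> is faster, so the truncation at \<open>c\<close> does not affect it, while
        it merely enlarges the speed allowed to \<open>y\<close>.\<close>
      define c where "c = - g' (t0 + \<epsilon>)"
      have c: "c > 0" using g'neg[of "t0 + \<epsilon>"] e by (simp add: c_def)
      let ?G = "\<lambda>t. sqrt (max (2 * F (g t0) - 2 * F t) (c\<^sup>2))"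
      obtain \<Phi> where \<Phi>: "\<And>t. (\<Phi> has_real_derivative 1 / ?G t) (at t)" "strict_mono \<Phi>"
        using truncated_speed_function[OF cF c] by blast
      have Gpos: "?G t > 0" for t using c by (simp add: less_max_iff_disj)
      have "\<Phi> (y 0) + 0 \<le> \<Phi> (y \<sigma>) + \<sigma>"
      proof (rule DERIV_nonneg_imp_increasing_open[of 0 \<sigma> "\<lambda>s. \<Phi> (y s) + s"])
        have "continuous_on UNIV \<Phi>" using \<Phi>(1) DERIV_isCont by (blast intro: continuous_at_imp_continuous_on)
        then show "continuous_on {0..\<sigma>} (\<lambda>s. \<Phi> (y s) + s)"
          by (intro continuous_intros continuous_on_compose2[OF _ yc]) auto
        fix s assume s: "0 < s" "s < \<sigma>"
        have "((\<lambda>s. \<Phi> (y s) + s) has_real_derivative (1 / ?G (y s) * y' s + 1)) (at s)"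
          using yD s by (intro derivative_intros DERIV_chain2[OF \<Phi>(1)]) auto
        moreover have "0 \<le> 1 / ?G (y s) * y' s + 1"
        proof -
          have "\<bar>y' s\<bar> = sqrt ((y' s)\<^sup>2)" by simp
          also have "\<dots> \<le> ?G (y s)" using yD s by (intro real_sqrt_le_mono) (auto simp: le_max_iff_disj)
          finally have "- ?G (y s) \<le> y' s" by simp
          then show ?thesis using Gpos[of "y s"] by (simp add: field_simps)
        qed
        ultimately show "\<exists>z. ((\<lambda>s. \<Phi> (y s) + s) has_real_derivative z) (at s) \<and> 0 \<le> z" by blast
      qed (use \<sigma> in auto)
      moreover have "\<Phi> (g (t0 + \<epsilon> + \<sigma>)) + \<sigma> = \<Phi> (g (t0 + \<epsilon> + 0)) + 0"
      proof (rule DERIV_isconst_end[of 0 \<sigma> "\<lambda>s. \<Phi> (g (t0 + \<epsilon> + s)) + s"])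
        have D: "((\<lambda>s. \<Phi> (g (t0 + \<epsilon> + s)) + s) has_real_derivative (1 / ?G (g (t0 + \<epsilon> + s)) * g' (t0 + \<epsilon> + s) + 1)) (at s)" for s
        proof -
          have "((\<lambda>s. g (t0 + \<epsilon> + s)) has_real_derivative g' (t0 + \<epsilon> + s)) (at s)"
            using g[of "t0 + \<epsilon> + s"] by (simp add: DERIV_shift add.commute)
          then show ?thesis by (intro derivative_intros DERIV_chain2[OF \<Phi>(1)])
        qed
        then show "continuous_on {0..\<sigma>} (\<lambda>s. \<Phi> (g (t0 + \<epsilon> + s)) + s)"
          using DERIV_isCont by (blast intro: continuous_at_imp_continuous_on)
        fix s assume s: "0 < s" "s < \<sigma>"
        have "2 * F (g t0) - 2 * F (g (t0 + \<epsilon> + s)) = (g' (t0 + \<epsilon> + s))\<^sup>2"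
          using ode_energy[OF g g' F, of t0 "t0 + \<epsilon> + s"] turn(1) by simp
        moreover have "c \<le> - g' (t0 + \<epsilon> + s)"
          using g'dec[of "t0 + \<epsilon>" "t0 + \<epsilon> + s"] e s \<sigma> by (simp add: c_def)
        moreover from this c have "c\<^sup>2 \<le> (- g' (t0 + \<epsilon> + s))\<^sup>2" by (intro power_mono) auto
        ultimately have "?G (g (t0 + \<epsilon> + s)) = - g' (t0 + \<epsilon> + s)" using c by (simp add: max_def)
        then have "1 / ?G (g (t0 + \<epsilon> + s)) * g' (t0 + \<epsilon> + s) + 1 = 0"
          using Gpos[of "g (t0 + \<epsilon> + s)"] by (simp add: divide_eq_eq)
        then show "((\<lambda>s. \<Phi> (g (t0 + \<epsilon> + s)) + s) has_real_derivative 0) (at s)"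
          using D[of s] by simp
      qed (use \<sigma> in auto)
      moreover have "\<Phi> (g (t0 + \<epsilon>)) \<le> \<Phi> (g t0)"
        using gdec[of "t0 + \<epsilon>"] e \<Phi>(2) by (simp add: strict_mono_less_eq)
      ultimately have "\<Phi> (g (t0 + \<epsilon> + \<sigma>)) \<le> \<Phi> (y \<sigma>)" using y0 by simp
      then show ?thesis using \<Phi>(2) by (simp add: strict_mono_less_eq)
    qed
    have "((\<lambda>\<epsilon>. g (t0 + \<epsilon> + \<sigma>)) \<longlongrightarrow> g (t0 + 0 + \<sigma>)) (at_right 0)"
      by (intro isCont_tendsto_compose[OF cg] tendsto_intros)
    moreover have "\<forall>\<^sub>F \<epsilon> in at_right 0. g (t0 + \<epsilon> + \<sigma>) \<le> y \<sigma>"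
      unfolding eventually_at_right_field using key d(1) by (intro exI[of _ "d / 2"]) auto
    ultimately have "g (t0 + 0 + \<sigma>) \<le> y \<sigma>"
      by (rule tendsto_upperbound) simp
    then show "g (t0 + \<sigma>) \<le> y \<sigma>" by simp
  qed
qed

subsection \<open>Hessians, spectral theorem and defining functions\<close>

text \<open>The derivative of the gradient field as a vector-valued map. Its symmetry is not built
  in but follows from \<open>partial_deriv_commute\<close>.\<close>

definition hessian :: "('a::euclidean_space \<Rightarrow> real) \<Rightarrow> 'a \<Rightarrow> 'a \<Rightarrow> 'a" where
  "hessian f x h = (\<Sum>b\<in>Basis. (h \<bullet> gradient (partial_deriv b f) x) *\<^sub>R b)"

lemma has_derivative_hessian:
  assumes "twice_diff_on f S" "x \<in> S"
  shows "(gradient f has_derivative hessian f x) (at x)"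
  unfolding gradient_def[abs_def] hessian_def[abs_def]
  using twice_diff_onD(2)[OF assms]
  by (intro has_derivative_sum has_derivative_scaleR_left)
     (use has_derivative_gradient in \<open>auto simp: gradient_def\<close>)

lemma hessian_inner:
  "hessian f x a \<bullet> c = (\<Sum>b\<in>Basis. \<Sum>d\<in>Basis. (a \<bullet> d) * (c \<bullet> b) * partial_deriv d (partial_deriv b f) x)"
proof -
  have "a \<bullet> gradient (partial_deriv b f) x = (\<Sum>d\<in>Basis. (a \<bullet> d) * partial_deriv d (partial_deriv b f) x)" for b
    by (subst euclidean_inner) (simp add: gradient_inner_Basis)
  then show ?thesis
    by (simp add: hessian_def inner_sum_left inner_sum_right sum_distrib_left inner_commute[of _ c] mult_ac)
qed

lemma hessian_symmetric:
  assumes "open S" "twice_diff_on f S" "x \<in> S"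
  shows "hessian f x a \<bullet> c = a \<bullet> hessian f x c"
proof -
  have "hessian f x a \<bullet> c = hessian f x c \<bullet> a"
    unfolding hessian_inner
    by (subst sum.swap) (intro sum.cong refl, simp add: partial_deriv_commute[OF assms])
  then show ?thesis by (simp add: inner_commute)
qed

text \<open>Peano's form of the remainder: differentiability of the gradient at \<open>p\<close>
  alone suffices, by the mean value theorem for \<open>f\<close> on the segment minus its quadratic
  part.\<close>

lemma second_order_taylor:
  assumes S: "open S" "twice_diff_on f S" "p \<in> S" and e: "e > 0"
  shows "\<exists>d>0. \<forall>z. norm z < d \<longrightarrow> p + z \<in> S \<and>
     \<bar>f (p + z) - f p - gradient f p \<bullet> z - (z \<bullet> hessian f p z) / 2\<bar> \<le> e * (norm z)\<^sup>2"
proof -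
  let ?H = "hessian f p"
  have H: "(gradient f has_derivative ?H) (at p)" by (rule has_derivative_hessian[OF S(2,3)])
  then have lin: "linear ?H" by (rule has_derivative_linear)
  obtain d1 where d1: "d1 > 0" "ball p d1 \<subseteq> S" using S open_contains_ball by blast
  obtain d2 where d2: "d2 > 0"
    "\<And>y. norm (y - p) < d2 \<Longrightarrow> norm (gradient f y - gradient f p - ?H (y - p)) \<le> e * norm (y - p)"
    using H e unfolding has_derivative_at_alt by blast
  show ?thesis
  proof (intro exI[of _ "min d1 d2"] conjI allI impI)
    show "0 < min d1 d2" using d1 d2 by simp
    fix z :: 'a assume z: "norm z < min d1 d2"
    have inS: "p + t *\<^sub>R z \<in> S" "norm (t *\<^sub>R z) < d2" if "0 \<le> t" "t \<le> 1" for t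
    proof -
      have "norm (t *\<^sub>R z) \<le> 1 * norm z" using that by (simp add: mult_left_le_one_le)
      then show "norm (t *\<^sub>R z) < d2" "p + t *\<^sub>R z \<in> S" using z d1(2) by (auto simp: dist_norm)
    qed
    show "p + z \<in> S" using inS[of 1] by simp
    let ?\<phi> = "\<lambda>t. f (p + t *\<^sub>R z) - t * (gradient f p \<bullet> z) - t\<^sup>2 / 2 * (z \<bullet> ?H z)"
    let ?\<phi>' = "\<lambda>t. z \<bullet> gradient f (p + t *\<^sub>R z) - gradient f p \<bullet> z - t * (z \<bullet> ?H z)"
    have D: "(?\<phi> has_real_derivative ?\<phi>' t) (at t)" if "0 \<le> t" "t \<le> 1" for t
      using line_has_derivative[OF twice_diff_onD(1)[OF S(2) inS(1)[OF that]]]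
      by (auto intro!: derivative_eq_intros)
    obtain t where t: "0 < t" "t < 1" "?\<phi> 1 - ?\<phi> 0 = (1 - 0) * ?\<phi>' t"
      using MVT2[of 0 1 ?\<phi> ?\<phi>'] D by auto
    have "?\<phi>' t = z \<bullet> (gradient f (p + t *\<^sub>R z) - gradient f p - ?H (t *\<^sub>R z))"
      using lin by (simp add: inner_diff_right linear_scale inner_commute)
    moreover have "\<bar>z \<bullet> (gradient f (p + t *\<^sub>R z) - gradient f p - ?H (t *\<^sub>R z))\<bar>
      \<le> norm z * norm (gradient f (p + t *\<^sub>R z) - gradient f p - ?H (t *\<^sub>R z))"
      by (rule Cauchy_Schwarz_ineq2)
    moreover have "norm (gradient f (p + t *\<^sub>R z) - gradient f p - ?H (t *\<^sub>R z)) \<le> e * norm z"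
    proof -
      have "norm (gradient f (p + t *\<^sub>R z) - gradient f p - ?H (t *\<^sub>R z)) \<le> e * norm (t *\<^sub>R z)"
        using d2(2)[of "p + t *\<^sub>R z"] inS(2)[of t] t by simp
      also have "\<dots> \<le> e * norm z" using t e by (simp add: mult_left_le_one_le)
      finally show ?thesis .
    qed
    then have "norm z * norm (gradient f (p + t *\<^sub>R z) - gradient f p - ?H (t *\<^sub>R z)) \<le> norm z * (e * norm z)"
      by (intro mult_left_mono) auto
    ultimately have "\<bar>?\<phi>' t\<bar> \<le> norm z * (e * norm z)" by linarith
    then have "\<bar>?\<phi> 1 - ?\<phi> 0\<bar> \<le> norm z * (e * norm z)" unfolding t(3) by simp
    then show "\<bar>f (p + z) - f p - gradient f p \<bullet> z - (z \<bullet> ?H z) / 2\<bar> \<le> e * (norm z)\<^sup>2"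
      by (simp add: power2_eq_square algebra_simps)
  qed
qed

text \<open>A maximum of the Rayleigh quotient on the unit sphere of \<open>W\<close> is an
  eigenvector. Symmetry is assumed on \<open>W\<close> only, since the shape operator is determined
  only on tangent vectors.\<close>

lemma self_adjoint_eigenvector:
  fixes S :: "'a::euclidean_space \<Rightarrow> 'a"
  assumes lin: "linear S" and W: "subspace W" and inv: "\<And>v. v \<in> W \<Longrightarrow> S v \<in> W"
    and sym: "\<And>v w. v \<in> W \<Longrightarrow> w \<in> W \<Longrightarrow> S v \<bullet> w = v \<bullet> S w" and ne: "W \<noteq> {0}"
  shows "\<exists>b\<in>W. \<exists>l. norm b = 1 \<and> S b = l *\<^sub>R b"
proof -
  have "compact (W \<inter> sphere 0 1)"
    using closed_subspace[OF W] compact_sphere by (rule closed_Int_compact)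
  moreover obtain v where v: "v \<in> W" "v \<noteq> 0" using ne W subspace_0 by blast
  then have "(1 / norm v) *\<^sub>R v \<in> W \<inter> sphere 0 1" using W subspace_scale by auto
  then have "W \<inter> sphere 0 1 \<noteq> {}" by blast
  moreover have "continuous_on (W \<inter> sphere 0 1) (\<lambda>v. S v \<bullet> v)"
    using linear_continuous_on[OF lin[unfolded linear_conv_bounded_linear]]
    by (intro continuous_intros)
  ultimately obtain b where b: "b \<in> W" "norm b = 1"
    and max: "\<And>v. v \<in> W \<Longrightarrow> norm v = 1 \<Longrightarrow> S v \<bullet> v \<le> S b \<bullet> b"
    using continuous_attains_sup[of "W \<inter> sphere 0 1" "\<lambda>v. S v \<bullet> v"]
    by (metis (no_types, lifting) IntD1 IntD2 IntI mem_sphere_0)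
  define l where "l = S b \<bullet> b"
  have bb: "b \<bullet> b = 1" using b by (simp add: norm_eq_1)
  have q: "S v \<bullet> v \<le> l * (v \<bullet> v)" if "v \<in> W" for v
  proof (cases "v = 0")
    case False
    let ?u = "(1 / norm v) *\<^sub>R v"
    have "S ?u \<bullet> ?u \<le> l" using max[of ?u] that False W subspace_scale by (auto simp: l_def)
    moreover have "S ?u \<bullet> ?u = (S v \<bullet> v) / (v \<bullet> v)"
      using lin by (simp add: linear_scale power2_norm_eq_inner[symmetric] power2_eq_square)
    ultimately have "(S v \<bullet> v) / (v \<bullet> v) \<le> l" by linarith
    then show ?thesis using False by (simp add: pos_divide_le_eq)
  qed (use lin linear_0 in auto)
  define w where "w = S b - l *\<^sub>R b"
  have wW: "w \<in> W" unfolding w_def by (intro subspace_diff[OF W] inv[OF b(1)] subspace_scale[OF W] b(1))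
  have wb: "w \<bullet> b = 0" using bb by (simp add: w_def inner_diff_left l_def)
  have "S b \<bullet> w = 0"
  proof (rule ccontr)
    assume ne: "S b \<bullet> w \<noteq> 0"
    \<comment> \<open>Maximality tested along \<open>b + t *\<^sub>R w\<close>: a linear term in t
      bounded by a quadratic one for all t must vanish, which t = a / D below makes
      explicit.\<close>
    have ineq: "2 * t * (S b \<bullet> w) \<le> t\<^sup>2 * (l * (w \<bullet> w) - S w \<bullet> w)" for t
    proof -
      have "S (b + t *\<^sub>R w) \<bullet> (b + t *\<^sub>R w) \<le> l * ((b + t *\<^sub>R w) \<bullet> (b + t *\<^sub>R w))"
        using q W b wW by (simp add: subspace_add subspace_scale)
      moreover have "S w \<bullet> b = S b \<bullet> w" using sym[OF wW b(1)] by (simp add: inner_commute)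
      ultimately show ?thesis
        using lin wb bb
        by (simp add: linear_add linear_scale inner_add_left inner_add_right inner_commute[of b w]
            l_def algebra_simps power2_eq_square)
    qed
    define D where "D = \<bar>l * (w \<bullet> w) - S w \<bullet> w\<bar> + 1"
    have D: "D > 0" "l * (w \<bullet> w) - S w \<bullet> w < D" by (auto simp: D_def)
    define a where "a = S b \<bullet> w"
    have "2 * (a / D) * a \<le> (a / D)\<^sup>2 * (l * (w \<bullet> w) - S w \<bullet> w)"
      using ineq[of "a / D"] by (simp add: a_def)
    also have "\<dots> \<le> (a / D)\<^sup>2 * D" using D by (intro mult_left_mono) auto
    finally have "2 * a\<^sup>2 \<le> a\<^sup>2" using D by (simp add: power2_eq_square field_simps)
    then show False using ne by (simp add: a_def)
  qed
  then have "w \<bullet> w = 0" using wb by (simp add: w_def inner_diff_left inner_diff_right inner_commute algebra_simps)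
  then show ?thesis using b by (intro bexI[of _ b] exI[of _ l]) (auto simp: w_def)
qed

text \<open>Induction on the dimension: by symmetry, the orthogonal complement in \<open>W\<close>
  of an eigenvector is again invariant.\<close>

lemma self_adjoint_eigenbasis:
  fixes S :: "'a::euclidean_space \<Rightarrow> 'a"
  assumes lin: "linear S" and W: "subspace W" and inv: "\<And>v. v \<in> W \<Longrightarrow> S v \<in> W"
    and sym: "\<And>v w. v \<in> W \<Longrightarrow> w \<in> W \<Longrightarrow> S v \<bullet> w = v \<bullet> S w"
  shows "\<exists>T k. finite T \<and> pairwise orthogonal T \<and> span T = W \<and>
    (\<forall>b\<in>T. norm b = 1 \<and> S b = k b *\<^sub>R b)"
  using W inv sym
proof (induction "dim W" arbitrary: W rule: less_induct)
  case less
  show ?case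
  proof (cases "W = {0}")
    case True
    then show ?thesis by (intro exI[of _ "{}"]) auto
  next
    case False
    from self_adjoint_eigenvector[OF lin less.prems False] obtain b l
      where b: "b \<in> W" "norm b = 1" "S b = l *\<^sub>R b" by blast
    define W' where "W' = W \<inter> {v. b \<bullet> v = 0}"
    have W': "subspace W'" unfolding W'_def
      using less.prems(1) by (intro subspace_inter subspace_hyperplane) auto
    have "b \<notin> W'" using b(2) by (auto simp: W'_def norm_eq_1)
    moreover have "W' \<subseteq> W" by (auto simp: W'_def)
    ultimately have "W' \<subset> W" using b(1) by blast
    then have "dim W' < dim W"
      using dim_psubset[of W' W] W' less.prems(1) by (metis span_eq_iff)
    moreover have "S v \<in> W'" if "v \<in> W'" for v
      using that less.prems(2,3)[of v] less.prems(3)[of b v] b by (auto simp: W'_def)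
    moreover have "S v \<bullet> w = v \<bullet> S w" if "v \<in> W'" "w \<in> W'" for v w
      using that less.prems(3) by (auto simp: W'_def)
    ultimately obtain T k where T: "finite T" "pairwise orthogonal T" "span T = W'"
      "\<And>c. c \<in> T \<Longrightarrow> norm c = 1 \<and> S c = k c *\<^sub>R c"
      using less.hyps[OF _ W'] by metis
    have TW: "T \<subseteq> W'" using T(3) span_superset by blast
    then have bT: "b \<notin> T" using \<open>b \<notin> W'\<close> by blast
    show ?thesis
    proof (intro exI[of _ "insert b T"] exI[of _ "k(b := l)"] conjI ballI)
      show "pairwise orthogonal (insert b T)"
        using T(2) TW by (auto simp: pairwise_insert orthogonal_def W'_def inner_commute)
      show "span (insert b T) = W"
      proof
        show "span (insert b T) \<subseteq> W"
          using b(1) TW less.prems(1) by (intro span_minimal) (auto simp: W'_def)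
        show "W \<subseteq> span (insert b T)"
        proof
          fix v assume v: "v \<in> W"
          have "v - (b \<bullet> v) *\<^sub>R b \<in> W'"
            using v b less.prems(1)
            by (auto simp: W'_def subspace_diff subspace_scale inner_diff_right norm_eq_1)
          then have "v - (b \<bullet> v) *\<^sub>R b \<in> span T" using T(3) by simp
          then show "v \<in> span (insert b T)" by (auto simp: span_insert)
        qed
      qed
      fix c assume "c \<in> insert b T"
      then show "norm c = 1" "S c = (k(b := l)) c *\<^sub>R c" using T(4) b bT by auto
    qed (use T in auto)
  qed
qed

lemma orthonormal_expand:
  fixes T :: "'a::euclidean_space set"
  assumes T: "finite T" "pairwise orthogonal T" "\<And>b. b \<in> T \<Longrightarrow> norm b = 1" and v: "v \<in> span T"
  shows "v = (\<Sum>b\<in>T. (b \<bullet> v) *\<^sub>R b)"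
    and "v \<bullet> w = (\<Sum>b\<in>T. (b \<bullet> v) * (b \<bullet> w))"
proof -
  show *: "v = (\<Sum>b\<in>T. (b \<bullet> v) *\<^sub>R b)"
    using orthonormal_basis_expand[OF T(2,3) v T(1)] by (simp add: inner_commute)
  show "v \<bullet> w = (\<Sum>b\<in>T. (b \<bullet> v) * (b \<bullet> w))"
    by (subst *) (simp add: inner_sum_left)
qed

text \<open>Links the definition of mean curvature, a sum over distinct eigenvalues weighted by the
  dimensions of their eigenspaces, with the trace in an orthonormal eigenbasis. The eigenspace of
  \<open>l\<close> is spanned by the basis vectors whose eigenvalue is \<open>l\<close>.\<close>

lemma eigenvalue_multiplicity_sum:
  fixes S :: "'a::euclidean_space \<Rightarrow> 'a"
  assumes lin: "linear S" and T: "finite T" "pairwise orthogonal T" "span T = W"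
    and eig: "\<And>b. b \<in> T \<Longrightarrow> norm b = 1 \<and> S b = k b *\<^sub>R b"
  shows "(\<Sum>l\<in>{l. \<exists>v\<in>{v \<in> W. S v = l *\<^sub>R v}. v \<noteq> 0}. real (dim {v \<in> W. S v = l *\<^sub>R v}) * l) = (\<Sum>b\<in>T. k b)"
proof -
  have space: "{v \<in> W. S v = l *\<^sub>R v} = span {b \<in> T. k b = l}" for l
  proof
    show "{v \<in> W. S v = l *\<^sub>R v} \<subseteq> span {b \<in> T. k b = l}"
    proof
      fix v assume v: "v \<in> {v \<in> W. S v = l *\<^sub>R v}"
      then have vT: "v \<in> span T" using T by simp
      note ex = orthonormal_expand(1)[OF T(1,2) _ vT]
      have "b \<bullet> v = 0" if "b \<in> T" "k b \<noteq> l" for b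
      proof -
        have bw: "b \<bullet> (\<Sum>c\<in>T. a c *\<^sub>R c) = a b" for a
        proof -
          have "b \<bullet> (\<Sum>c\<in>T. a c *\<^sub>R c) = (\<Sum>c\<in>T. if c = b then a b else 0)"
            unfolding inner_sum_right
          proof (rule sum.cong)
            fix c assume "c \<in> T"
            then show "b \<bullet> a c *\<^sub>R c = (if c = b then a b else 0)"
              using T(2) eig[OF that(1)] that(1)
              by (cases "c = b") (auto simp: pairwise_def orthogonal_def norm_eq_1)
          qed simp
          then show ?thesis using that(1) T(1) by simp
        qed
        have "S v = S (\<Sum>c\<in>T. (c \<bullet> v) *\<^sub>R c)" using ex eig by simp
        also have "\<dots> = (\<Sum>c\<in>T. (c \<bullet> v) *\<^sub>R S c)"
          using lin by (simp add: linear_sum linear_scale)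
        also have "\<dots> = (\<Sum>c\<in>T. ((c \<bullet> v) * k c) *\<^sub>R c)"
          by (rule sum.cong) (use eig in auto)
        finally have "b \<bullet> S v = (b \<bullet> v) * k b" using bw by simp
        then have "l * (b \<bullet> v) = (b \<bullet> v) * k b" using v by simp
        then show ?thesis using that(2) by auto
      qed
      then have "(\<Sum>b\<in>T. (b \<bullet> v) *\<^sub>R b) \<in> span {b \<in> T. k b = l}"
        by (intro span_sum) (metis (mono_tags, lifting) mem_Collect_eq scaleR_zero_left span_base span_scale span_zero)
      then show "v \<in> span {b \<in> T. k b = l}" using ex eig by simp
    qed
    show "span {b \<in> T. k b = l} \<subseteq> {v \<in> W. S v = l *\<^sub>R v}"
    proof (rule span_minimal)
      show "{b \<in> T. k b = l} \<subseteq> {v \<in> W. S v = l *\<^sub>R v}"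
        using eig T(3) span_base by auto
      show "subspace {v \<in> W. S v = l *\<^sub>R v}"
        using T(3) lin by (auto simp: subspace_def linear_0 linear_add linear_scale span_zero
            span_add span_scale scaleR_add_right)
    qed
  qed
  have dimc: "dim (span {b \<in> T. k b = l}) = card {b \<in> T. k b = l}" for l
  proof -
    have "pairwise orthogonal {b \<in> T. k b = l}" by (rule pairwise_subset[OF T(2)]) auto
    moreover have "0 \<notin> {b \<in> T. k b = l}" using eig by force
    ultimately have "independent {b \<in> T. k b = l}" by (rule pairwise_orthogonal_independent)
    then show ?thesis by (simp add: dim_eq_card_independent)
  qed
  have evs: "{l. \<exists>v\<in>{v \<in> W. S v = l *\<^sub>R v}. v \<noteq> 0} = k ` T"
  proof (intro set_eqI iffI)
    fix l assume "l \<in> {l. \<exists>v\<in>{v \<in> W. S v = l *\<^sub>R v}. v \<noteq> 0}"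
    then obtain v where "v \<in> span {b \<in> T. k b = l}" "v \<noteq> 0" unfolding space by auto
    then have "{b \<in> T. k b = l} \<noteq> {}" by force
    then show "l \<in> k ` T" by auto
  next
    fix l assume "l \<in> k ` T"
    then obtain b where "b \<in> T" "k b = l" by auto
    then show "l \<in> {l. \<exists>v\<in>{v \<in> W. S v = l *\<^sub>R v}. v \<noteq> 0}"
      using eig[of b] T(3) span_base[of b T] by auto
  qed
  have "(\<Sum>b\<in>T. k b) = (\<Sum>l\<in>k ` T. \<Sum>b\<in>{b \<in> T. k b = l}. k b)"
    by (rule sum.image_gen[OF T(1)])
  also have "\<dots> = (\<Sum>l\<in>k ` T. real (card {b \<in> T. k b = l}) * l)"
    by (intro sum.cong) auto
  finally show ?thesis unfolding space evs[unfolded space] dimc by simp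
qed

section \<open>Defining functions, the normal field and tangent directions\<close>

lemma local_defining_functionD:
  assumes "local_defining_function \<Omega> p U \<rho>"
  shows "open U" "p \<in> U" "twice_diff_on \<rho> U" "\<And>x. x \<in> U \<Longrightarrow> gradient \<rho> x \<noteq> 0"
    "\<And>x. x \<in> U \<Longrightarrow> x \<in> \<Omega> \<longleftrightarrow> \<rho> x < 0"
proof -
  have "Ck_on (Suc (Suc 0)) \<rho> U"
    using assms by (auto simp: local_defining_function_def smooth_on_def simp del: Ck_on.simps)
  then show "twice_diff_on \<rho> U" by (rule Ck_on_imp_twice_diff_on)
qed (use assms in \<open>auto simp: local_defining_function_def\<close>)

text \<open>A defining function is only known to be negative exactly on \<Omega>. Continuity
  excludes boundary points with \<rho> > 0, and the nonzero gradient makes every zero a limit of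
  points with \<rho> < 0, reached against the gradient.\<close>

lemma defining_function_zero_iff:
  assumes \<Omega>: "open \<Omega>" and D: "local_defining_function \<Omega> p U \<rho>" and x: "x \<in> U"
  shows "x \<in> frontier \<Omega> \<longleftrightarrow> \<rho> x = 0"
proof
  note D = local_defining_functionD[OF D]
  assume xf: "x \<in> frontier \<Omega>"
  then have "x \<notin> \<Omega>" using \<Omega> by (simp add: frontier_def interior_open)
  then have "\<rho> x \<ge> 0" using D(5)[OF x] by simp
  moreover have "\<not> \<rho> x > 0"
  proof
    assume "\<rho> x > 0"
    have "isCont \<rho> x" by (rule twice_diff_onD(3)[OF D(3) x])
    then obtain d where d: "d > 0" "\<And>y. dist y x < d \<Longrightarrow> \<bar>\<rho> y - \<rho> x\<bar> < \<rho> x"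
      using \<open>\<rho> x > 0\<close> unfolding continuous_at_eps_delta by (auto simp: dist_real_def)
    obtain d' where d': "d' > 0" "ball x d' \<subseteq> U" using D(1) x open_contains_ball by blast
    have "x \<in> closure \<Omega>" using xf by (simp add: frontier_def)
    then obtain y where y: "y \<in> \<Omega>" "dist y x < min d d'"
      using closure_approachable d(1) d'(1) by (metis min_less_iff_conj)
    then have "y \<in> U" using d'(2) by (auto simp: dist_commute)
    then show False using D(5)[of y] y d(2)[of y] by auto
  qed
  ultimately show "\<rho> x = 0" by simp
next
  note D = local_defining_functionD[OF D]
  assume 0: "\<rho> x = 0"
  have "x \<in> closure \<Omega>"
    unfolding closure_approachable
  proof (intro allI impI)
    fix e :: real assume e: "e > 0"
    let ?g = "gradient \<rho> x"
    obtain d' where d': "d' > 0" "ball x d' \<subseteq> U" using D(1) x open_contains_ball by blast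
    have der: "((\<lambda>t. \<rho> (x + t *\<^sub>R (- ?g))) has_real_derivative ((- ?g) \<bullet> ?g)) (at 0)"
      using line_has_derivative[of \<rho> x 0 "- ?g"] twice_diff_onD(1)[OF D(3) x] by simp
    have neg: "(- ?g) \<bullet> ?g < 0" using D(4)[OF x] by simp
    obtain d where d: "d > 0" "\<And>h. 0 < h \<Longrightarrow> h < d \<Longrightarrow> \<rho> (x + h *\<^sub>R (- ?g)) < 0"
      using DERIV_neg_dec_right[OF der neg] 0 by auto
    define h where "h = min (d / 2) (min e d' / (2 * norm ?g))"
    have ng: "norm ?g > 0" using D(4)[OF x] by simp
    have h: "0 < h" "h < d" using d(1) e d'(1) ng by (auto simp: h_def)
    have "h * norm ?g \<le> min e d' / (2 * norm ?g) * norm ?g" using ng by (intro mult_right_mono) (auto simp: h_def)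
    also have "\<dots> = min e d' / 2" using ng by simp
    finally have "h * norm ?g < e" "h * norm ?g < d'" using e d'(1) by auto
    then have "dist (x + h *\<^sub>R (- ?g)) x < e" "x + h *\<^sub>R (- ?g) \<in> ball x d'"
      using h by (simp_all add: dist_norm)
    moreover from this have "x + h *\<^sub>R (- ?g) \<in> \<Omega>" using D(5) d(2)[OF h] d'(2) by blast
    ultimately show "\<exists>y\<in>\<Omega>. dist y x < e" by blast
  qed
  moreover have "x \<notin> \<Omega>" using D(5)[OF x] 0 by simp
  ultimately show "x \<in> frontier \<Omega>" using \<Omega> by (simp add: frontier_def interior_open)
qed

text \<open>If the two unit normals a and b differed, moving from \<open>p\<close> in direction b -
  a would decrease \<rho>1 and increase \<rho>2, hence lead into \<Omega> and out of it at
  once.\<close>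

lemma defining_function_normal_unique:
  assumes \<Omega>: "open \<Omega>" and p: "p \<in> frontier \<Omega>"
    and D1: "local_defining_function \<Omega> p U1 \<rho>1" and D2: "local_defining_function \<Omega> p U2 \<rho>2"
  shows "sgn (gradient \<rho>1 p) = sgn (gradient \<rho>2 p)"
proof (rule ccontr)
  assume ne: "\<not> ?thesis"
  let ?a = "sgn (gradient \<rho>1 p)" and ?b = "sgn (gradient \<rho>2 p)"
  note L1 = local_defining_functionD[OF D1] and L2 = local_defining_functionD[OF D2]
  have n1: "norm (gradient \<rho>1 p) > 0" and n2: "norm (gradient \<rho>2 p) > 0" using L1 L2 by auto
  have ab: "?a \<bullet> ?a = 1" "?b \<bullet> ?b = 1" using n1 n2 by (simp_all add: norm_sgn flip: norm_eq_1)
  have "0 < (?a - ?b) \<bullet> (?a - ?b)" using ne by simp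
  then have lt: "?a \<bullet> ?b < 1" using ab by (simp add: inner_diff_left inner_diff_right inner_commute)
  let ?v = "?b - ?a"
  have s1: "gradient \<rho>1 p = norm (gradient \<rho>1 p) *\<^sub>R ?a" and s2: "gradient \<rho>2 p = norm (gradient \<rho>2 p) *\<^sub>R ?b"
    using n1 n2 by (simp_all add: sgn_div_norm)
  have "?v \<bullet> gradient \<rho>1 p = norm (gradient \<rho>1 p) * (?v \<bullet> ?a)" using s1 by (metis inner_scaleR_right)
  moreover have "?v \<bullet> ?a < 0" using lt ab by (simp add: inner_diff_left inner_commute[of ?b ?a])
  ultimately have neg: "?v \<bullet> gradient \<rho>1 p < 0" using n1 by (simp add: mult_less_0_iff)
  have "?v \<bullet> gradient \<rho>2 p = norm (gradient \<rho>2 p) * (?v \<bullet> ?b)" using s2 by (metis inner_scaleR_right)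
  moreover have "?v \<bullet> ?b > 0" using lt ab by (simp add: inner_diff_left inner_commute[of ?b ?a])
  ultimately have pos: "?v \<bullet> gradient \<rho>2 p > 0" using n2 by (simp add: zero_less_mult_iff)
  have z: "\<rho>1 p = 0" "\<rho>2 p = 0" using defining_function_zero_iff[OF \<Omega> D1 L1(2)] defining_function_zero_iff[OF \<Omega> D2 L2(2)] p by blast+
  have d1: "((\<lambda>t. \<rho>1 (p + t *\<^sub>R ?v)) has_real_derivative (?v \<bullet> gradient \<rho>1 p)) (at 0)"
    using line_has_derivative[of \<rho>1 p 0 ?v] twice_diff_onD(1)[OF L1(3,2)] by simp
  have d2: "((\<lambda>t. \<rho>2 (p + t *\<^sub>R ?v)) has_real_derivative (?v \<bullet> gradient \<rho>2 p)) (at 0)"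
    using line_has_derivative[of \<rho>2 p 0 ?v] twice_diff_onD(1)[OF L2(3,2)] by simp
  obtain e1 where e1: "e1 > 0" "\<And>h. 0 < h \<Longrightarrow> h < e1 \<Longrightarrow> \<rho>1 (p + h *\<^sub>R ?v) < 0"
    using DERIV_neg_dec_right[OF d1 neg] z by auto
  obtain e2 where e2: "e2 > 0" "\<And>h. 0 < h \<Longrightarrow> h < e2 \<Longrightarrow> \<rho>2 (p + h *\<^sub>R ?v) > 0"
    using DERIV_pos_inc_right[OF d2 pos] z by auto
  obtain d where d: "d > 0" "ball p d \<subseteq> U1 \<inter> U2"
    using open_contains_ball[of "U1 \<inter> U2"] L1(1,2) L2(1,2) by blast
  have nv: "norm ?v > 0" using ne by simp
  define m where "m = min (min e1 e2) (d / norm ?v)"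
  have m: "0 < m" "m \<le> e1" "m \<le> e2" "m \<le> d / norm ?v" using e1(1) e2(1) d(1) nv by (auto simp: m_def)
  define t where "t = m / 2"
  have "0 < t" "t < m" using m(1) by (auto simp: t_def)
  then have t: "0 < t" "t < e1" "t < e2" "t < d / norm ?v" using m by linarith+
  have "norm (t *\<^sub>R ?v) < d" using t(1,4) nv by (simp add: pos_less_divide_eq)
  then have "p + t *\<^sub>R ?v \<in> U1" "p + t *\<^sub>R ?v \<in> U2" using d(2) by (auto simp: dist_norm)
  from L1(5)[OF this(1)] L2(5)[OF this(2)] e1(2)[OF t(1,2)] e2(2)[OF t(1,3)] show False by linarith
qed

lemma outward_normal_eq:
  assumes \<Omega>: "open \<Omega>" and p: "p \<in> frontier \<Omega>" and D: "local_defining_function \<Omega> p U \<rho>"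
  shows "outward_normal \<Omega> p = sgn (gradient \<rho> p)"
  unfolding outward_normal_def
proof (rule the_equality)
  show "\<exists>U \<rho>'. local_defining_function \<Omega> p U \<rho>' \<and> sgn (gradient \<rho> p) = sgn (gradient \<rho>' p)"
    using D by blast
next
  fix \<nu> assume "\<exists>U \<rho>'. local_defining_function \<Omega> p U \<rho>' \<and> \<nu> = sgn (gradient \<rho>' p)"
  then obtain U' \<rho>' where "local_defining_function \<Omega> p U' \<rho>'" "\<nu> = sgn (gradient \<rho>' p)" by blast
  then show "\<nu> = sgn (gradient \<rho> p)" using defining_function_normal_unique[OF \<Omega> p _ D] by simp
qed

text \<open>Single boundary points instead of a curve: p + t (v - \<epsilon> n) lies inside and p +
  t (v + \<epsilon> n) outside for small t, so the intermediate value theorem puts a boundary point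
  between them. This approximation of tangent vectors is all that uniqueness of the derivative
  within the boundary requires.\<close>

lemma tangent_curve:
  assumes \<Omega>: "open \<Omega>" and p: "p \<in> frontier \<Omega>" and D: "local_defining_function \<Omega> p U \<rho>"
    and v: "v \<bullet> gradient \<rho> p = 0" and e: "0 < \<epsilon>" and d: "0 < \<delta>"
  shows "\<exists>t y. 0 < t \<and> t < \<delta> \<and> y \<in> frontier \<Omega> \<and> norm (y - p - t *\<^sub>R v) \<le> \<epsilon> * t"
proof -
  note L = local_defining_functionD[OF D]
  let ?n = "sgn (gradient \<rho> p)"
  have z: "\<rho> p = 0" using defining_function_zero_iff[OF \<Omega> D L(2)] p by simp
  have ng: "norm (gradient \<rho> p) > 0" using L(4)[OF L(2)] by simp
  have n1: "norm ?n = 1" using ng by (simp add: norm_sgn)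
  have nG: "?n \<bullet> gradient \<rho> p > 0" using ng by (simp add: sgn_div_norm)
  have D: "((\<lambda>t. \<rho> (p + t *\<^sub>R w)) has_real_derivative (w \<bullet> gradient \<rho> p)) (at 0)" for w
    using line_has_derivative[of \<rho> p 0 w] twice_diff_onD(1)[OF L(3,2)] by simp
  have pos: "(v + \<epsilon> *\<^sub>R ?n) \<bullet> gradient \<rho> p > 0" "(v + (- \<epsilon>) *\<^sub>R ?n) \<bullet> gradient \<rho> p < 0"
    using v e nG by (simp_all add: inner_add_left inner_diff_left)
  obtain e1 where e1: "e1 > 0" "\<And>h. 0 < h \<Longrightarrow> h < e1 \<Longrightarrow> \<rho> (p + h *\<^sub>R (v + \<epsilon> *\<^sub>R ?n)) > 0"
    using DERIV_pos_inc_right[OF D pos(1)] z by auto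
  obtain e2 where e2: "e2 > 0" "\<And>h. 0 < h \<Longrightarrow> h < e2 \<Longrightarrow> \<rho> (p + h *\<^sub>R (v + (- \<epsilon>) *\<^sub>R ?n)) < 0"
    using DERIV_neg_dec_right[OF D pos(2)] z by auto
  obtain d' where d': "d' > 0" "ball p d' \<subseteq> U" using L(1,2) open_contains_ball by blast
  define M where "M = norm v + \<epsilon>"
  have M: "M > 0" using e by (simp add: M_def add_nonneg_pos)
  define m where "m = min (min e1 e2) (min \<delta> (d' / M))"
  have "d' / M > 0" using d' M by simp
  then have m: "0 < m" "m \<le> e1" "m \<le> e2" "m \<le> \<delta>" "m \<le> d' / M"
    using e1(1) e2(1) d unfolding m_def by auto
  define t where "t = m / 2"
  have "0 < t" "t < m" using m(1) by (auto simp: t_def)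
  then have t: "0 < t" "t < e1" "t < e2" "t < \<delta>" "t < d' / M"
    using m by linarith+
  have tM: "t * M < d'" using t(5) M by (simp add: pos_less_divide_eq)
  let ?c = "\<lambda>s. p + t *\<^sub>R (v + s *\<^sub>R ?n)"
  have inU: "?c s \<in> U" if "- \<epsilon> \<le> s" "s \<le> \<epsilon>" for s
  proof -
    have "norm (v + s *\<^sub>R ?n) \<le> norm v + \<bar>s\<bar>" using norm_triangle_ineq[of v "s *\<^sub>R ?n"] n1 by simp
    then have "t * norm (v + s *\<^sub>R ?n) \<le> t * M" using t(1) that by (intro mult_left_mono) (auto simp: M_def)
    also have "\<dots> < d'" by (rule tM)
    finally have "norm (t *\<^sub>R (v + s *\<^sub>R ?n)) < d'" using t(1) by simp
    then show ?thesis using d'(2) by (auto simp: dist_norm)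
  qed
  have "continuous_on {- \<epsilon>..\<epsilon>} (\<lambda>s. \<rho> (?c s))"
  proof (rule continuous_at_imp_continuous_on, rule ballI)
    fix s assume "s \<in> {- \<epsilon>..\<epsilon>}"
    then have "isCont \<rho> (?c s)" by (intro twice_diff_onD(3)[OF L(3) inU]) auto
    moreover have "isCont ?c s" by (intro continuous_intros)
    ultimately show "isCont (\<lambda>s. \<rho> (?c s)) s" by (rule isCont_o2[rotated])
  qed
  then obtain s where s: "- \<epsilon> \<le> s" "s \<le> \<epsilon>" "\<rho> (?c s) = 0"
    using IVT'[of "\<lambda>s. \<rho> (?c s)" "- \<epsilon>" 0 \<epsilon>] e1(2)[OF t(1,2)] e2(2)[OF t(1,3)] e by auto
  have "?c s \<in> frontier \<Omega>" using defining_function_zero_iff[OF \<Omega> assms(3) inU[OF s(1,2)]] s(3) by simp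
  moreover have "norm (?c s - p - t *\<^sub>R v) \<le> \<epsilon> * t"
  proof -
    have "?c s - p - t *\<^sub>R v = (t * s) *\<^sub>R ?n" by (simp add: scaleR_add_right)
    then show ?thesis using n1 t(1) s by (simp add: abs_mult mult.commute)
  qed
  ultimately show ?thesis using t(1,4) by blast
qed

text \<open>The shape operator is some derivative within the frontier, not a unique one. Two
  derivatives within \<open>S\<close> still agree on \<open>v\<close> when \<open>S\<close> contains
  points that approximate p + t v to first order, since their difference is a derivative of
  zero.\<close>

lemma has_derivative_within_unique_direction:
  fixes h :: "'a::real_normed_vector \<Rightarrow> 'b::real_normed_vector"
  assumes A: "(h has_derivative A) (at p within S)" and B: "(h has_derivative B) (at p within S)"
    and dir: "\<And>\<epsilon> \<delta>. 0 < \<epsilon> \<Longrightarrow> 0 < \<delta> \<Longrightarrow> \<exists>t y. 0 < t \<and> t < \<delta> \<and> y \<in> S \<and> norm (y - p - t *\<^sub>R v) \<le> \<epsilon> * t"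
  shows "A v = B v"
proof -
  let ?C = "\<lambda>w. A w - B w"
  have C: "((\<lambda>x. 0) has_derivative ?C) (at p within S)" using has_derivative_diff[OF A B] by simp
  then have blC: "bounded_linear ?C" by (rule has_derivative_bounded_linear)
  then interpret C: bounded_linear ?C .
  obtain M where M: "M > 0" "\<And>w. norm (?C w) \<le> norm w * M" using C.pos_bounded by blast
  have "norm (?C v) \<le> e" if e: "e > 0" for e
  proof -
    define \<epsilon> where "\<epsilon> = min 1 (e / (2 * M))"
    have eps: "\<epsilon> > 0" "\<epsilon> \<le> 1" using e M by (auto simp: \<epsilon>_def)
    have epsM: "\<epsilon> * M \<le> e / 2"
    proof -
      have "\<epsilon> * M \<le> e / (2 * M) * M" using M by (intro mult_right_mono) (auto simp: \<epsilon>_def)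
      then show ?thesis using M by simp
    qed
    define e' where "e' = e / (2 * (norm v + 1))"
    have e': "e' > 0" using e by (simp add: e'_def add_nonneg_pos)
    have e'v: "e' * (norm v + 1) = e / 2" by (simp add: e'_def field_simps add_nonneg_eq_0_iff)
    obtain d where d: "d > 0" "\<And>y. y \<in> S \<Longrightarrow> norm (y - p) < d \<Longrightarrow> norm (0 - 0 - ?C (y - p)) \<le> e' * norm (y - p)"
      using C e' unfolding has_derivative_within_alt by blast
    have "d / (norm v + 1) > 0" using d by (simp add: add_nonneg_pos)
    from dir[OF eps(1) this] obtain t y where ty: "0 < t" "t < d / (norm v + 1)" "y \<in> S"
      "norm (y - p - t *\<^sub>R v) \<le> \<epsilon> * t" by blast
    have "norm (y - p) \<le> norm (t *\<^sub>R v) + norm (y - p - t *\<^sub>R v)" by (rule norm_triangle_sub)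
    also have "\<dots> \<le> t * norm v + 1 * t" using ty eps by (intro add_mono order_trans[OF ty(4)] mult_right_mono) auto
    finally have yp: "norm (y - p) \<le> t * (norm v + 1)" by (simp add: algebra_simps)
    also have "\<dots> < d" using ty(2) by (simp add: pos_less_divide_eq add_nonneg_pos)
    finally have "norm (0 - 0 - ?C (y - p)) \<le> e' * norm (y - p)" using d(2) ty(3) by blast
    then have "norm (?C (y - p)) \<le> e' * norm (y - p)" by (simp only: diff_0 diff_self norm_minus_cancel)
    also have "\<dots> \<le> e' * (t * (norm v + 1))" using yp e' by (intro mult_left_mono) auto
    also have "\<dots> = t * (e' * (norm v + 1))" by (simp only: mult.left_commute)
    also have "\<dots> = t * (e / 2)" unfolding e'v ..
    finally have 1: "norm (?C (y - p)) \<le> t * (e / 2)" .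
    have "norm (?C (y - p - t *\<^sub>R v)) \<le> \<epsilon> * t * M"
      by (rule order_trans[OF M(2) mult_right_mono[OF ty(4)]]) (use M(1) in simp)
    also have "\<dots> \<le> t * (e / 2)" using epsM ty(1) by (simp add: mult.commute mult.left_commute)
    finally have 2: "norm (?C (y - p - t *\<^sub>R v)) \<le> t * (e / 2)" .
    have "t * norm (?C v) = norm (?C (t *\<^sub>R v))" using ty(1) unfolding C.scaleR norm_scaleR by simp
    also have "t *\<^sub>R v = (y - p) - (y - p - t *\<^sub>R v)" by simp
    also have "norm (?C ((y - p) - (y - p - t *\<^sub>R v))) = norm (?C (y - p) - ?C (y - p - t *\<^sub>R v))"
      by (rule arg_cong[OF C.diff])
    also have "\<dots> \<le> t * (e / 2) + t * (e / 2)" by (rule order_trans[OF norm_triangle_ineq4 add_mono[OF 1 2]])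
    finally show ?thesis using ty(1) by (simp add: algebra_simps)
  qed
  then have "norm (?C v) \<le> 0" by (rule field_le_epsilon) simp
  then show ?thesis by simp
qed

subsection \<open>Geometry of the domain near a boundary point\<close>

lemma has_derivative_sgn_compose:
  fixes G :: "'a::real_normed_vector \<Rightarrow> 'b::real_inner"
  assumes G: "(G has_derivative H) (at x)" and 0: "G x \<noteq> 0"
  shows "((\<lambda>x. sgn (G x)) has_derivative (\<lambda>h. inverse (norm (G x)) *\<^sub>R H h +
    (- (inverse (norm (G x)) * (H h \<bullet> sgn (G x)) * inverse (norm (G x)))) *\<^sub>R G x)) (at x)"
proof -
  have n: "((\<lambda>x. norm (G x)) has_derivative (\<lambda>h. H h \<bullet> sgn (G x))) (at x)"
    by (rule has_derivative_compose[OF G has_derivative_norm[OF 0]])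
  have i: "((\<lambda>x. inverse (norm (G x))) has_derivative
      (\<lambda>h. - (inverse (norm (G x)) * (H h \<bullet> sgn (G x)) * inverse (norm (G x))))) (at x)"
    using Deriv.has_derivative_inverse[OF _ n] 0 by simp
  show ?thesis
    unfolding sgn_div_norm by (rule has_derivative_scaleR[OF i G, unfolded sgn_div_norm])
qed

text \<open>On the frontier the outward normal coincides with the normalised gradient of \<rho>,
  which is differentiable in the full sense. On tangent vectors the shape operator therefore equals
  that derivative; normalisation only removes the component along the gradient and divides the
  Hessian by the length of the gradient.\<close>

lemma shape_operator_hessian:
  assumes \<Omega>: "open \<Omega>" and p: "p \<in> frontier \<Omega>" and D: "local_defining_function \<Omega> p U \<rho>"
  shows "linear (shape_operator \<Omega> p)"
    and "v \<bullet> gradient \<rho> p = 0 \<Longrightarrow> shape_operator \<Omega> p v \<bullet> gradient \<rho> p = 0"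
    and "v \<bullet> gradient \<rho> p = 0 \<Longrightarrow> w \<bullet> gradient \<rho> p = 0 \<Longrightarrow>
      shape_operator \<Omega> p v \<bullet> w = (hessian \<rho> p v \<bullet> w) / norm (gradient \<rho> p)"
proof -
  note L = local_defining_functionD[OF D]
  let ?G = "gradient \<rho> p" and ?H = "hessian \<rho> p"
  let ?\<gamma> = "norm ?G"
  define DN where "DN = (\<lambda>h. inverse ?\<gamma> *\<^sub>R ?H h + (- (inverse ?\<gamma> * (?H h \<bullet> sgn ?G) * inverse ?\<gamma>)) *\<^sub>R ?G)"
  have G0: "?G \<noteq> 0" by (rule L(4)[OF L(2)])
  have "((\<lambda>x. sgn (gradient \<rho> x)) has_derivative DN) (at p)"
    unfolding DN_def by (rule has_derivative_sgn_compose[OF has_derivative_hessian[OF L(3,2)] G0])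
  then have N: "((\<lambda>x. sgn (gradient \<rho> x)) has_derivative DN) (at p within frontier \<Omega>)" by (rule has_derivative_at_withinI)
  obtain d where d: "d > 0" "ball p d \<subseteq> U" using L(1,2) open_contains_ball by blast
  have out: "(outward_normal \<Omega> has_derivative DN) (at p within frontier \<Omega>)"
  proof (rule has_derivative_transform_within[OF N d(1) p])
    fix y assume y: "y \<in> frontier \<Omega>" "dist y p < d"
    then have "local_defining_function \<Omega> y U \<rho>"
      using D d(2) by (auto simp: local_defining_function_def dist_commute)
    then show "sgn (gradient \<rho> y) = outward_normal \<Omega> y"
      using outward_normal_eq[OF \<Omega> y(1)] by simp
  qed
  then have diff: "outward_normal \<Omega> differentiable (at p within frontier \<Omega>)"
    by (auto simp: differentiable_def)
  then have S: "(outward_normal \<Omega> has_derivative shape_operator \<Omega> p) (at p within frontier \<Omega>)"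
    unfolding shape_operator_def by (simp add: frechet_derivative_works)
  then show "linear (shape_operator \<Omega> p)" by (rule has_derivative_linear)
  have eq: "shape_operator \<Omega> p v = DN v" if "v \<bullet> ?G = 0" for v
    by (rule has_derivative_within_unique_direction[OF S out tangent_curve[OF \<Omega> p D that]])
  have DG: "DN v \<bullet> ?G = 0" for v
  proof -
    have "?G \<bullet> ?G = ?\<gamma> * ?\<gamma>" by (simp add: power2_norm_eq_inner[symmetric] power2_eq_square)
    then show ?thesis using G0 by (simp add: DN_def inner_add_left inner_diff_left sgn_div_norm field_simps)
  qed
  show "shape_operator \<Omega> p v \<bullet> ?G = 0" if "v \<bullet> ?G = 0"
    using eq[OF that] DG by simp
  show "shape_operator \<Omega> p v \<bullet> w = (?H v \<bullet> w) / ?\<gamma>" if "v \<bullet> ?G = 0" "w \<bullet> ?G = 0"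
    using eq[OF that(1)] that(2) by (simp add: DN_def inner_add_left inner_diff_left inner_commute[of ?G w] divide_inverse mult.commute)
qed

text \<open>The principal directions diagonalise the Hessian of \<rho> on the tangent space, so the
  mean curvature becomes the sum of the coefficients of a quadratic form.\<close>

lemma tangent_eigenbasis:
  fixes \<Omega> :: "'a::euclidean_space set"
  assumes \<Omega>: "open \<Omega>" and p: "p \<in> frontier \<Omega>" and D: "local_defining_function \<Omega> p U \<rho>"
    and dim: "DIM('a) \<ge> 2"
  shows "\<exists>T k. finite T \<and> pairwise orthogonal T \<and> span T = {v. v \<bullet> gradient \<rho> p = 0} \<and>
    (\<forall>b\<in>T. norm b = 1) \<and> (\<Sum>b\<in>T. k b) = (real DIM('a) - 1) * mean_curvature \<Omega> p \<and>
    (\<forall>v. v \<bullet> gradient \<rho> p = 0 \<longrightarrow>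
      v \<bullet> hessian \<rho> p v = norm (gradient \<rho> p) * (\<Sum>b\<in>T. k b * (b \<bullet> v)\<^sup>2))"
proof -
  note L = local_defining_functionD[OF D]
  note sh = shape_operator_hessian[OF \<Omega> p D]
  let ?G = "gradient \<rho> p" and ?H = "hessian \<rho> p" and ?S = "shape_operator \<Omega> p"
  let ?W = "{v. v \<bullet> ?G = 0}"
  have G0: "?G \<noteq> 0" by (rule L(4)[OF L(2)])
  have bt: "boundary_tangent_space \<Omega> p = ?W"
    unfolding boundary_tangent_space_def outward_normal_eq[OF \<Omega> p D]
    using G0 by (auto simp: sgn_div_norm)
  have symm: "?S v \<bullet> w = v \<bullet> ?S w" if "v \<in> ?W" "w \<in> ?W" for v w
    using sh(3)[of v w] sh(3)[of w v] that hessian_symmetric[OF L(1,3,2), of v w]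
    by (simp add: inner_commute)
  have inv: "?S v \<in> ?W" if "v \<in> ?W" for v using sh(2) that by simp
  have "\<exists>T k. finite T \<and> pairwise orthogonal T \<and> span T = ?W \<and>
      (\<forall>b\<in>T. norm b = 1 \<and> ?S b = k b *\<^sub>R b)"
    by (rule self_adjoint_eigenbasis[OF sh(1) subspace_hyperplane2], rule inv, assumption, rule symm, assumption+)
  then obtain T k where Tk: "finite T \<and> pairwise orthogonal T \<and> span T = ?W \<and>
      (\<forall>b\<in>T. norm b = 1 \<and> ?S b = k b *\<^sub>R b)"
    by (elim exE)
  then have T: "finite T" "pairwise orthogonal T" "span T = ?W"
    and eig: "\<And>b. b \<in> T \<Longrightarrow> norm b = 1 \<and> ?S b = k b *\<^sub>R b"
    by simp_all
  have "(\<Sum>b\<in>T. k b) = (real DIM('a) - 1) * mean_curvature \<Omega> p"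
    using eigenvalue_multiplicity_sum[OF sh(1) T eig] dim
    by (simp add: mean_curvature_def principal_curvatures_def curvature_space_def bt)
  moreover have "v \<bullet> ?H v = norm ?G * (\<Sum>b\<in>T. k b * (b \<bullet> v)\<^sup>2)" if v: "v \<bullet> ?G = 0" for v
  proof -
    have vT: "v \<in> span T" using T v by simp
    note ex = orthonormal_expand[OF T(1,2) _ vT]
    have "v \<bullet> ?S v = (\<Sum>b\<in>T. (b \<bullet> v) * (b \<bullet> ?S v))" using ex(2) eig by simp
    also have "\<dots> = (\<Sum>b\<in>T. k b * (b \<bullet> v)\<^sup>2)"
    proof (rule sum.cong)
      fix b assume b: "b \<in> T"
      then have "b \<in> ?W" using T(3) span_base by blast
      then have "b \<bullet> ?S v = k b * (b \<bullet> v)" using symm[of b v] v eig[OF b] by simp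
      then show "(b \<bullet> v) * (b \<bullet> ?S v) = k b * (b \<bullet> v)\<^sup>2" by (simp add: power2_eq_square)
    qed simp
    finally show ?thesis using sh(3)[OF v v] G0 by (simp add: inner_commute)
  qed
  ultimately show ?thesis using T eig by (intro exI[of _ T] exI[of _ k]) auto
qed

text \<open>Near \<open>p\<close> the function \<rho> increases at a definite rate in the direction
  - e. So the line downwards from a point of \<Omega> meets the frontier exactly once within a short
  distance, and the part before lies in \<Omega>.\<close>

lemma vertical_descent:
  assumes \<Omega>: "open \<Omega>" and D: "local_defining_function \<Omega> p U \<rho>" and p: "p \<in> frontier \<Omega>"
    and e: "e = - sgn (gradient \<rho> p)" and r: "r > 0"
  shows "\<exists>\<delta>>0. \<forall>x\<in>\<Omega> \<inter> ball p \<delta>. \<exists>\<sigma>>0. x - \<sigma> *\<^sub>R e \<in> frontier \<Omega> \<and>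
    (\<forall>\<tau>. 0 \<le> \<tau> \<longrightarrow> \<tau> < \<sigma> \<longrightarrow> x - \<tau> *\<^sub>R e \<in> \<Omega>) \<and>
    norm (x - \<sigma> *\<^sub>R e - p) < r \<and> x - \<sigma> *\<^sub>R e \<in> U \<and> \<rho> (x - \<sigma> *\<^sub>R e) = 0"
proof -
  note L = local_defining_functionD[OF D]
  let ?G = "gradient \<rho> p"
  define \<gamma> where "\<gamma> = norm ?G"
  have g: "\<gamma> > 0" using L(4)[OF L(2)] by (simp add: \<gamma>_def)
  have e1: "norm e = 1" using L(4)[OF L(2)] by (simp add: e norm_sgn)
  have eG: "?G \<bullet> e = - \<gamma>"
    using g by (simp add: e \<gamma>_def sgn_div_norm power2_norm_eq_inner[symmetric] power2_eq_square)
  have z: "\<rho> p = 0" using defining_function_zero_iff[OF \<Omega> D L(2)] p by simp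
  have "isCont (\<lambda>x. gradient \<rho> x \<bullet> e) p"
    by (intro continuous_intros has_derivative_continuous[OF has_derivative_hessian[OF L(3,2)]])
  then obtain d1 where d1: "d1 > 0" "\<And>x. dist x p < d1 \<Longrightarrow> \<bar>gradient \<rho> x \<bullet> e - ?G \<bullet> e\<bar> < \<gamma> / 2"
    using g unfolding continuous_at_eps_delta dist_real_def by (metis half_gt_zero)
  obtain d2 where d2: "d2 > 0" "ball p d2 \<subseteq> U" using L(1,2) open_contains_ball by blast
  define d where "d = min (min d1 d2) r"
  have d: "d > 0" "d \<le> d1" "d \<le> d2" "d \<le> r" using d1(1) d2(1) r by (auto simp: d_def)
  have inU: "x \<in> U" "gradient \<rho> x \<bullet> e < - \<gamma> / 2" if "norm (x - p) < d" for x
  proof -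
    have "dist x p < d1" "dist p x < d2" using that d by (auto simp: dist_norm norm_minus_commute)
    then show "x \<in> U" "gradient \<rho> x \<bullet> e < - \<gamma> / 2" using d2(2) d1(2)[of x] unfolding eG by (auto, linarith)
  qed
  have "isCont \<rho> p" by (rule twice_diff_onD(3)[OF L(3,2)])
  \<comment> \<open>Over the length d / 2, at rate above \<gamma> / 2, \<rho> gains more than
    \<gamma> d / 4; a starting value above - \<gamma> d / 4 therefore ensures a sign change.\<close>
  moreover have "\<gamma> * d / 4 > 0" using g d by simp
  ultimately have "\<exists>d3>0. \<forall>x. dist x p < d3 \<longrightarrow> \<bar>\<rho> x - \<rho> p\<bar> < \<gamma> * d / 4"
    unfolding continuous_at_eps_delta dist_real_def by blast
  then obtain d3 where d3: "d3 > 0" "\<And>x. dist x p < d3 \<Longrightarrow> \<bar>\<rho> x\<bar> < \<gamma> * d / 4"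
    using z by auto
  show ?thesis
  proof (rule exI[of _ "min d3 (d / 4)"], intro conjI ballI)
    show "0 < min d3 (d / 4)" using d3 d by simp
    fix x assume x: "x \<in> \<Omega> \<inter> ball p (min d3 (d / 4))"
    let ?\<phi> = "\<lambda>\<tau>. \<rho> (x + \<tau> *\<^sub>R (- e))"
    let ?\<phi>' = "\<lambda>\<tau>. - (gradient \<rho> (x + \<tau> *\<^sub>R (- e)) \<bullet> e)"
    have xp: "norm (x - p) < d / 4" using x by (simp add: dist_norm norm_minus_commute)
    have nb: "norm (x + \<tau> *\<^sub>R (- e) - p) < d" if "0 \<le> \<tau>" "\<tau> \<le> d / 2" for \<tau>
    proof -
      have "norm (x + \<tau> *\<^sub>R (- e) - p) \<le> norm (x - p) + norm (\<tau> *\<^sub>R e)"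
        using norm_triangle_ineq4[of "x - p" "\<tau> *\<^sub>R e"] by (simp add: algebra_simps)
      then show ?thesis using xp that e1 d by simp
    qed
    have der: "(?\<phi> has_real_derivative ?\<phi>' \<tau>) (at \<tau>)" if "0 \<le> \<tau>" "\<tau> \<le> d / 2" for \<tau>
      using line_has_derivative[OF twice_diff_onD(1)[OF L(3) inU(1)[OF nb[OF that]]]]
      by (simp add: inner_commute)
    have pos: "?\<phi>' \<tau> > \<gamma> / 2" if "0 \<le> \<tau>" "\<tau> \<le> d / 2" for \<tau>
      using inU(2)[OF nb[OF that]] by simp
    have neg0: "?\<phi> 0 < 0" using L(5)[OF inU(1)[of x]] x xp d by simp
    have big: "?\<phi> 0 > - (\<gamma> * d / 4)" using d3(2)[of x] x by (simp add: dist_commute abs_less_iff)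
    have "\<exists>\<tau>>0. \<tau> < d / 2 \<and> ?\<phi> (d / 2) - ?\<phi> 0 = (d / 2 - 0) * ?\<phi>' \<tau>"
      by (rule MVT2) (use d der in auto)
    then obtain \<tau> where "0 < \<tau>" "\<tau> < d / 2" "?\<phi> (d / 2) - ?\<phi> 0 = (d / 2) * ?\<phi>' \<tau>" by auto
    moreover have "(d / 2) * ?\<phi>' \<tau> > (d / 2) * (\<gamma> / 2)"
      using pos[of \<tau>] calculation d(1) by (intro mult_strict_left_mono) auto
    ultimately have "?\<phi> (d / 2) > 0" using big by (simp add: mult.commute)
    moreover have "continuous_on {0..d / 2} ?\<phi>"
      using der DERIV_isCont by (intro continuous_at_imp_continuous_on) fastforce
    ultimately obtain \<sigma> where s: "0 \<le> \<sigma>" "\<sigma> \<le> d / 2" "?\<phi> \<sigma> = 0"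
      using IVT'[of ?\<phi> 0 0 "d / 2"] neg0 d(1) by auto
    have s0: "\<sigma> > 0" using s neg0 by (cases "\<sigma> = 0") auto
    have below: "x - \<tau> *\<^sub>R e \<in> \<Omega>" if "0 \<le> \<tau>" "\<tau> < \<sigma>" for \<tau>
    proof -
      have "?\<phi> \<tau> < ?\<phi> \<sigma>"
      proof (rule DERIV_pos_imp_increasing[OF that(2), of ?\<phi>])
        fix t assume t: "\<tau> \<le> t" "t \<le> \<sigma>"
        then have "0 \<le> t" "t \<le> d / 2" using that s by auto
        then show "\<exists>y. (?\<phi> has_real_derivative y) (at t) \<and> 0 < y"
          using der pos[of t] g by (intro exI[of _ "?\<phi>' t"]) auto
      qed
      then show ?thesis using s(3) L(5)[OF inU(1)[OF nb[of \<tau>]]] that s by simp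
    qed
    have "x - \<sigma> *\<^sub>R e \<in> frontier \<Omega>" "x - \<sigma> *\<^sub>R e \<in> U"
      using defining_function_zero_iff[OF \<Omega> D inU(1)[OF nb[OF s(1,2)]]] s(3) inU(1)[OF nb[OF s(1,2)]] by simp_all
    then show "\<exists>\<sigma>>0. x - \<sigma> *\<^sub>R e \<in> frontier \<Omega> \<and>
        (\<forall>\<tau>. 0 \<le> \<tau> \<longrightarrow> \<tau> < \<sigma> \<longrightarrow> x - \<tau> *\<^sub>R e \<in> \<Omega>) \<and>
        norm (x - \<sigma> *\<^sub>R e - p) < r \<and> x - \<sigma> *\<^sub>R e \<in> U \<and> \<rho> (x - \<sigma> *\<^sub>R e) = 0"
      using s0 below s(3) nb[OF s(1,2)] d(4) by (intro exI[of _ \<sigma>]) auto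
  qed
qed

text \<open>In the tangent ball |z|^2 < 2 R (e \<bullet> z), so the quadratic part of \<rho> is at
  most a multiple of R (e \<bullet> z) and, for small R, is beaten by the linear part - \<gamma> (e
  \<bullet> z).\<close>

lemma interior_ball:
  assumes \<Omega>: "open \<Omega>" and D: "local_defining_function \<Omega> p U \<rho>" and p: "p \<in> frontier \<Omega>"
    and e: "e = - sgn (gradient \<rho> p)"
  shows "\<exists>R>0. ball (p + R *\<^sub>R e) R \<subseteq> \<Omega>"
proof -
  note L = local_defining_functionD[OF D]
  let ?G = "gradient \<rho> p" and ?H = "hessian \<rho> p"
  define \<gamma> where "\<gamma> = norm ?G"
  have g: "\<gamma> > 0" using L(4)[OF L(2)] by (simp add: \<gamma>_def)
  have e1: "norm e = 1" using L(4)[OF L(2)] by (simp add: e norm_sgn)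
  have Ge: "?G = (- \<gamma>) *\<^sub>R e" using g by (simp add: e \<gamma>_def sgn_div_norm)
  have z: "\<rho> p = 0" using defining_function_zero_iff[OF \<Omega> D L(2)] p by simp
  have "bounded_linear ?H" by (rule has_derivative_bounded_linear[OF has_derivative_hessian[OF L(3,2)]])
  then obtain M where M: "M > 0" "\<And>h. norm (?H h) \<le> norm h * M" using bounded_linear.pos_bounded by blast
  obtain d where d: "d > 0" "\<And>z. norm z < d \<Longrightarrow> p + z \<in> U \<and>
     \<bar>\<rho> (p + z) - \<rho> p - ?G \<bullet> z - (z \<bullet> ?H z) / 2\<bar> \<le> 1 * (norm z)\<^sup>2"
    using second_order_taylor[OF L(1,3,2), of 1] by auto
  \<comment> \<open>The bound d / 2 keeps the ball where the Taylor estimate holds, and \<gamma> /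
    (M + 2) balances the linear against the quadratic part.\<close>
  define R where "R = min (d / 2) (\<gamma> / (M + 2))"
  have R: "R > 0" using d(1) g M(1) by (simp add: R_def)
  have R2: "R \<le> d / 2" "R \<le> \<gamma> / (M + 2)" unfolding R_def by (rule min.cobounded1, rule min.cobounded2)
  have "ball (p + R *\<^sub>R e) R \<subseteq> \<Omega>"
  proof
    fix x assume x: "x \<in> ball (p + R *\<^sub>R e) R"
    define z where "z = x - p"
    have "norm (z - R *\<^sub>R e) < R" using x by (simp add: z_def dist_norm norm_minus_commute algebra_simps)
    then have "(norm (z - R *\<^sub>R e))\<^sup>2 < R\<^sup>2" by (intro power_strict_mono) auto
    moreover have "(norm (z - R *\<^sub>R e))\<^sup>2 = (norm z)\<^sup>2 - 2 * R * (e \<bullet> z) + R\<^sup>2"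
    proof -
      have "e \<bullet> e = 1" using e1 by (simp add: norm_eq_1)
      then show ?thesis
        by (simp add: power2_norm_eq_inner inner_diff_left inner_diff_right inner_commute[of z e] power2_eq_square[of R] algebra_simps)
    qed
    ultimately have zz: "(norm z)\<^sup>2 < 2 * R * (e \<bullet> z)" by linarith
    have "0 < 2 * R * (e \<bullet> z)" by (rule le_less_trans[OF zero_le_power2 zz])
    then have ez: "e \<bullet> z > 0" using R by (simp add: zero_less_mult_iff)
    have "e \<bullet> z \<le> norm z" using norm_cauchy_schwarz[of e z] e1 by simp
    then have "(norm z)\<^sup>2 < 2 * R * norm z" using zz R by (smt (verit) mult_left_mono)
    moreover have "norm z > 0" using ez \<open>e \<bullet> z \<le> norm z\<close> by linarith
    ultimately have "norm z < 2 * R" by (simp add: power2_eq_square)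
    then have "norm z < d" using R2(1) by simp
    from d(2)[OF this] have inU: "p + z \<in> U" and
      t: "\<bar>\<rho> (p + z) - \<rho> p - ?G \<bullet> z - (z \<bullet> ?H z) / 2\<bar> \<le> (norm z)\<^sup>2" by auto
    have "z \<bullet> ?H z \<le> norm z * (norm z * M)"
      using norm_cauchy_schwarz[of z "?H z"] mult_left_mono[OF M(2)[of z], of "norm z"] by simp
    then have zHz: "z \<bullet> ?H z \<le> M * (norm z)\<^sup>2" by (simp add: power2_eq_square mult_ac)
    have "\<rho> (p + z) \<le> - \<gamma> * (e \<bullet> z) + (z \<bullet> ?H z) / 2 + (norm z)\<^sup>2"
      using t by (subst (asm) Ge) (simp add: \<open>\<rho> p = 0\<close> abs_le_iff)
    also have "\<dots> \<le> - \<gamma> * (e \<bullet> z) + (M + 2) / 2 * (norm z)\<^sup>2" using zHz by (simp add: field_simps)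
    also have "\<dots> < - \<gamma> * (e \<bullet> z) + (M + 2) / 2 * (2 * R * (e \<bullet> z))" using zz M(1) by simp
    also have "\<dots> = ((M + 2) * R - \<gamma>) * (e \<bullet> z)" by (simp add: algebra_simps)
    also have "\<dots> \<le> 0"
    proof (rule mult_nonpos_nonneg)
      show "(M + 2) * R - \<gamma> \<le> 0" using R2(2) M(1) by (simp add: field_simps)
    qed (use ez in simp)
    finally show "x \<in> \<Omega>" using L(5)[OF inU] by (simp add: z_def)
  qed
  then show ?thesis using R by blast
qed

text \<open>On the zero set the Taylor formula expresses the height s = e \<bullet> z by the
  quadratic form, so s is of order |z|^2; replacing z by its tangential part then changes the form
  by terms of order |s| |z| only. The lower estimate alone is recorded, as it is the one that bounds
  the length of vertical segments from above.\<close>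

lemma boundary_point_height:
  assumes \<Omega>: "open \<Omega>" and D: "local_defining_function \<Omega> p U \<rho>" and p: "p \<in> frontier \<Omega>"
    and e: "e = - sgn (gradient \<rho> p)" and eps: "\<epsilon> > 0"
  shows "\<exists>r>0. \<forall>z. norm z < r \<longrightarrow> \<rho> (p + z) = 0 \<longrightarrow>
     (let z' = z - (e \<bullet> z) *\<^sub>R e in
       (z' \<bullet> hessian \<rho> p z') / (2 * norm (gradient \<rho> p)) - \<epsilon> * (norm z')\<^sup>2 \<le> e \<bullet> z)"
proof -
  note L = local_defining_functionD[OF D]
  let ?G = "gradient \<rho> p" and ?H = "hessian \<rho> p"
  define \<gamma> where "\<gamma> = norm ?G"
  have g: "\<gamma> > 0" using L(4)[OF L(2)] by (simp add: \<gamma>_def)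
  have e1: "norm e = 1" using L(4)[OF L(2)] by (simp add: e norm_sgn)
  then have ee: "e \<bullet> e = 1" by (simp add: norm_eq_1)
  have Ge: "?G = (- \<gamma>) *\<^sub>R e" using g by (simp add: e \<gamma>_def sgn_div_norm)
  have z0: "\<rho> p = 0" using defining_function_zero_iff[OF \<Omega> D L(2)] p by simp
  have blH: "bounded_linear ?H" by (rule has_derivative_bounded_linear[OF has_derivative_hessian[OF L(3,2)]])
  then obtain M where M: "M > 0" "\<And>h. norm (?H h) \<le> norm h * M" using bounded_linear.pos_bounded by blast
  have Hb: "\<bar>a \<bullet> ?H b\<bar> \<le> M * (norm a * norm b)" for a b
    using Cauchy_Schwarz_ineq2[of a "?H b"] mult_left_mono[OF M(2)[of b], of "norm a"] by (simp add: mult_ac)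
  define \<epsilon>' where "\<epsilon>' = min 1 (\<epsilon> * \<gamma> / 4)"
  have e': "\<epsilon>' > 0" "\<epsilon>' \<le> 1" "\<epsilon>' \<le> \<epsilon> * \<gamma> / 4" using eps g by (auto simp: \<epsilon>'_def)
  obtain d where d: "d > 0" "\<And>z. norm z < d \<Longrightarrow> p + z \<in> U \<and>
     \<bar>\<rho> (p + z) - \<rho> p - ?G \<bullet> z - (z \<bullet> ?H z) / 2\<bar> \<le> \<epsilon>' * (norm z)\<^sup>2"
    using second_order_taylor[OF L(1,3,2) e'(1)] by auto
  define C where "C = (M / 2 + 1) / \<gamma>"
  have C: "C > 0" using M g by (simp add: C_def add_pos_pos)
  \<comment> \<open>1 / (2 C) gives |s| \<le> |z| / 2 and hence |z|^2 \<le> 2 |z'|^2; the last bound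
    makes the three mixed terms together at most half of \<epsilon> \<gamma> |z|^2.\<close>
  define r where "r = min d (min (1 / (2 * C)) (\<epsilon> * \<gamma> / (6 * M * C)))"
  have r: "r > 0" using d(1) C eps g M(1) by (simp add: r_def)
  have r2: "r \<le> d" "r \<le> 1 / (2 * C)" "r \<le> \<epsilon> * \<gamma> / (6 * M * C)" unfolding r_def by (simp_all only: min.cobounded1 min.cobounded2 min.coboundedI2)
  show ?thesis
  proof (rule exI[of _ r], intro conjI allI impI)
    show "r > 0" by fact
    fix z assume z: "norm z < r" "\<rho> (p + z) = 0"
    define s where "s = e \<bullet> z"
    define z' where "z' = z - s *\<^sub>R e"
    have t: "\<bar>\<gamma> * s - (z \<bullet> ?H z) / 2\<bar> \<le> \<epsilon>' * (norm z)\<^sup>2"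
    proof -
      have Gz: "?G \<bullet> z = - \<gamma> * s" by (subst Ge) (simp add: s_def)
      show ?thesis using d(2)[of z] z r2(1) z0 by (simp add: Gz)
    qed
    have zn: "z = z' + s *\<^sub>R e" by (simp add: z'_def)
    have "z' \<bullet> e = 0" by (simp add: z'_def inner_diff_left ee s_def inner_commute[of z e])
    then have pyth: "(norm z)\<^sup>2 = (norm z')\<^sup>2 + s\<^sup>2"
      by (subst zn) (simp add: power2_norm_eq_inner inner_add_left inner_add_right ee inner_commute[of e z'] power2_eq_square[of s])
    then have z'z: "norm z' \<le> norm z" by (metis le_add_same_cancel1 norm_ge_zero power2_le_imp_le zero_le_power2)
    have sz: "\<bar>s\<bar> \<le> norm z" using Cauchy_Schwarz_ineq2[of e z] e1 by (simp add: s_def)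
    have zHz: "\<bar>z \<bullet> ?H z\<bar> \<le> M * (norm z)\<^sup>2" using Hb[of z z] by (simp add: power2_eq_square)
    have "\<gamma> * \<bar>s\<bar> = \<bar>\<gamma> * s\<bar>" using g by (simp add: abs_mult)
    also have "\<dots> \<le> M * (norm z)\<^sup>2 / 2 + \<epsilon>' * (norm z)\<^sup>2" using t zHz by linarith
    also have "\<dots> \<le> M * (norm z)\<^sup>2 / 2 + 1 * (norm z)\<^sup>2" using e' by (intro add_left_mono mult_right_mono) auto
    also have "\<dots> = \<gamma> * (C * (norm z)\<^sup>2)" using g by (simp add: C_def field_simps)
    finally have sC: "\<bar>s\<bar> \<le> C * (norm z)\<^sup>2" using g by simp
    have Cz: "C * norm z \<le> 1 / 2"
    proof -
      have "C * norm z \<le> C * (1 / (2 * C))" using z(1) r2(2) C by (intro mult_left_mono) auto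
      then show ?thesis using C by simp
    qed
    have "\<bar>s\<bar> \<le> norm z / 2"
    proof -
      have "C * (norm z)\<^sup>2 = (C * norm z) * norm z" by (simp add: power2_eq_square)
      also have "\<dots> \<le> 1 / 2 * norm z" using Cz by (intro mult_right_mono) auto
      finally show ?thesis using sC by simp
    qed
    then have "\<bar>s\<bar>\<^sup>2 \<le> (norm z / 2)\<^sup>2" by (intro power_mono) auto
    then have "s\<^sup>2 \<le> (norm z)\<^sup>2 / 4" by (simp add: power_divide)
    then have zz': "(norm z)\<^sup>2 \<le> 2 * (norm z')\<^sup>2" using pyth zero_le_power2[of "norm z"] by linarith
    have "z \<bullet> ?H z = z' \<bullet> ?H z' + s * (z' \<bullet> ?H e) + s * (e \<bullet> ?H z')  + s * s * (e \<bullet> ?H e)"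
      by (subst (1 2) zn) (simp add: bounded_linear.linear[OF blH] linear_add linear_scale
          inner_add_left inner_add_right algebra_simps)
    moreover have "\<bar>s * (z' \<bullet> ?H e)\<bar> \<le> M * \<bar>s\<bar> * norm z"
    proof -
      have "\<bar>s\<bar> * \<bar>z' \<bullet> ?H e\<bar> \<le> \<bar>s\<bar> * (M * (norm z * 1))"
        using Hb[of z' e] z'z M(1) e1 by (intro mult_left_mono order_trans[OF Hb]) auto
      then show ?thesis by (simp add: abs_mult mult_ac)
    qed
    moreover have "\<bar>s * (e \<bullet> ?H z')\<bar> \<le> M * \<bar>s\<bar> * norm z"
    proof -
      have "\<bar>s\<bar> * \<bar>e \<bullet> ?H z'\<bar> \<le> \<bar>s\<bar> * (M * (1 * norm z))"
        using Hb[of e z'] z'z M(1) e1 by (intro mult_left_mono order_trans[OF Hb]) auto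
      then show ?thesis by (simp add: abs_mult mult_ac)
    qed
    moreover have "\<bar>s * s * (e \<bullet> ?H e)\<bar> \<le> M * \<bar>s\<bar> * norm z"
    proof -
      have "\<bar>s\<bar> * \<bar>s\<bar> * \<bar>e \<bullet> ?H e\<bar> \<le> \<bar>s\<bar> * norm z * (M * (1 * 1))"
        using sz Hb[of e e] M(1) e1 by (intro mult_mono order_trans[OF Hb]) auto
      then show ?thesis by (simp add: abs_mult mult_ac)
    qed
    ultimately have "z' \<bullet> ?H z' - 3 * (M * \<bar>s\<bar> * norm z) \<le> z \<bullet> ?H z" by linarith
    moreover have "M * \<bar>s\<bar> * norm z \<le> \<epsilon> * \<gamma> / 6 * (norm z)\<^sup>2"
    proof -
      have "M * \<bar>s\<bar> * norm z \<le> M * (C * (norm z)\<^sup>2) * norm z"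
        using sC M(1) by (intro mult_right_mono mult_left_mono) auto
      also have "\<dots> = (M * C * norm z) * (norm z)\<^sup>2" by (simp add: power2_eq_square)
      also have "\<dots> \<le> (\<epsilon> * \<gamma> / 6) * (norm z)\<^sup>2"
      proof (rule mult_right_mono)
        have "M * C * norm z \<le> M * C * (\<epsilon> * \<gamma> / (6 * M * C))" using z(1) r2(3) M(1) C by (intro mult_left_mono) auto
        then show "M * C * norm z \<le> \<epsilon> * \<gamma> / 6" using M(1) C by simp
      qed simp
      finally show ?thesis .
    qed
    moreover have "\<epsilon>' * (norm z)\<^sup>2 \<le> \<epsilon> * \<gamma> / 4 * (norm z)\<^sup>2" using e'(3) by (intro mult_right_mono) auto
    ultimately have "(z' \<bullet> ?H z') / 2 - (\<epsilon> * \<gamma> / 2) * (norm z)\<^sup>2 \<le> \<gamma> * s"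
      using t by (simp add: algebra_simps abs_le_iff)
    moreover have "(\<epsilon> * \<gamma> / 2) * (norm z)\<^sup>2 \<le> (\<epsilon> * \<gamma> / 2) * (2 * (norm z')\<^sup>2)"
      using zz' eps g by (intro mult_left_mono) auto
    ultimately have "(z' \<bullet> ?H z') / 2 - \<epsilon> * \<gamma> * (norm z')\<^sup>2 \<le> \<gamma> * s" by simp
    then have "(z' \<bullet> ?H z') / (2 * \<gamma>) - \<epsilon> * (norm z')\<^sup>2 \<le> s" using g by (simp add: field_simps)
    then show "let z' = z - (e \<bullet> z) *\<^sub>R e in
       (z' \<bullet> ?H z') / (2 * norm ?G) - \<epsilon> * (norm z')\<^sup>2 \<le> e \<bullet> z"
      by (simp add: Let_def z'_def s_def \<gamma>_def)
  qed
qed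

text \<open>The only facts about the shape of the boundary used later, freed from defining
  functions. Writing the quadratic part as a sum of squares over \<open>T\<close> lets its Laplacian
  be read off from the sum of the curvatures; \<epsilon> is the slack of the Taylor
  expansion.\<close>

lemma boundary_geometry:
  fixes \<Omega> :: "'a::euclidean_space set"
  assumes \<Omega>: "regular_domain \<Omega>" and p: "p \<in> frontier \<Omega>" and dim: "DIM('a) \<ge> 2"
    and e: "e = - outward_normal \<Omega> p"
  shows "norm e = 1 \<and> (\<exists>R>0. ball (p + R *\<^sub>R e) R \<subseteq> \<Omega>) \<and>
    (\<exists>T k. finite T \<and> (\<forall>b\<in>T. norm b = 1 \<and> b \<bullet> e = 0) \<and>
      (\<Sum>b\<in>T. k b) = (real DIM('a) - 1) * mean_curvature \<Omega> p \<and>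
      (\<forall>\<epsilon>>0. \<exists>\<delta>>0. \<forall>x\<in>\<Omega> \<inter> ball p \<delta>. \<exists>\<sigma>>0. x - \<sigma> *\<^sub>R e \<in> frontier \<Omega> \<and>
         (\<forall>\<tau>. 0 \<le> \<tau> \<longrightarrow> \<tau> < \<sigma> \<longrightarrow> x - \<tau> *\<^sub>R e \<in> \<Omega>) \<and>
         \<sigma> \<le> e \<bullet> (x - p) - (\<Sum>b\<in>T. (k b / 2 - \<epsilon>) * (b \<bullet> (x - p))\<^sup>2)))"
proof -
  have op: "open \<Omega>" using \<Omega> by (simp add: regular_domain_def)
  obtain U \<rho> where D: "local_defining_function \<Omega> p U \<rho>"
    using \<Omega> p unfolding regular_domain_def by blast
  note L = local_defining_functionD[OF D]
  let ?G = "gradient \<rho> p" and ?H = "hessian \<rho> p"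
  have e: "e = - sgn ?G" using e outward_normal_eq[OF op p D] by simp
  have G0: "norm ?G > 0" using L(4)[OF L(2)] by simp
  have e1: "norm e = 1" using G0 by (simp add: e norm_sgn)
  then have ee: "e \<bullet> e = 1" by (simp add: norm_eq_1)
  have perp: "v \<bullet> e = 0 \<longleftrightarrow> v \<bullet> ?G = 0" for v using G0 by (simp add: e sgn_div_norm)
  from tangent_eigenbasis[OF op p D dim] obtain T k where
    T: "finite T" "pairwise orthogonal T" "span T = {v. v \<bullet> ?G = 0}" "\<forall>b\<in>T. norm b = 1"
    and tr: "(\<Sum>b\<in>T. k b) = (real DIM('a) - 1) * mean_curvature \<Omega> p"
    and quad: "\<And>v. v \<bullet> ?G = 0 \<Longrightarrow> v \<bullet> ?H v = norm ?G * (\<Sum>b\<in>T. k b * (b \<bullet> v)\<^sup>2)"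
    by (elim exE conjE) blast
  have Te: "b \<bullet> e = 0" if "b \<in> T" for b
  proof -
    have "b \<in> span T" using that by (rule span_base)
    then show ?thesis using T(3) perp by auto
  qed
  have main: "\<exists>\<delta>>0. \<forall>x\<in>\<Omega> \<inter> ball p \<delta>. \<exists>\<sigma>>0. x - \<sigma> *\<^sub>R e \<in> frontier \<Omega> \<and>
         (\<forall>\<tau>. 0 \<le> \<tau> \<longrightarrow> \<tau> < \<sigma> \<longrightarrow> x - \<tau> *\<^sub>R e \<in> \<Omega>) \<and>
         \<sigma> \<le> e \<bullet> (x - p) - (\<Sum>b\<in>T. (k b / 2 - \<epsilon>) * (b \<bullet> (x - p))\<^sup>2)" if eps: "\<epsilon> > 0" for \<epsilon>
  proof -
    obtain r where r: "r > 0" "\<And>z. norm z < r \<Longrightarrow> \<rho> (p + z) = 0 \<Longrightarrow>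
     (let z' = z - (e \<bullet> z) *\<^sub>R e in (z' \<bullet> ?H z') / (2 * norm ?G) - \<epsilon> * (norm z')\<^sup>2 \<le> e \<bullet> z)"
      using boundary_point_height[OF op D p e eps] by auto
    obtain \<delta> where \<delta>: "\<delta> > 0" "\<And>x. x \<in> \<Omega> \<inter> ball p \<delta> \<Longrightarrow> \<exists>\<sigma>>0. x - \<sigma> *\<^sub>R e \<in> frontier \<Omega> \<and>
      (\<forall>\<tau>. 0 \<le> \<tau> \<longrightarrow> \<tau> < \<sigma> \<longrightarrow> x - \<tau> *\<^sub>R e \<in> \<Omega>) \<and>
      norm (x - \<sigma> *\<^sub>R e - p) < r \<and> x - \<sigma> *\<^sub>R e \<in> U \<and> \<rho> (x - \<sigma> *\<^sub>R e) = 0"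
      using vertical_descent[OF op D p e r(1)] by auto
    show ?thesis
    proof (rule exI[of _ \<delta>], intro conjI ballI)
      fix x assume "x \<in> \<Omega> \<inter> ball p \<delta>"
      from \<delta>(2)[OF this] obtain \<sigma> where \<sigma>: "\<sigma> > 0" "x - \<sigma> *\<^sub>R e \<in> frontier \<Omega>"
        "\<forall>\<tau>. 0 \<le> \<tau> \<longrightarrow> \<tau> < \<sigma> \<longrightarrow> x - \<tau> *\<^sub>R e \<in> \<Omega>"
        "norm (x - \<sigma> *\<^sub>R e - p) < r" "\<rho> (x - \<sigma> *\<^sub>R e) = 0" by blast
      define z where "z = x - \<sigma> *\<^sub>R e - p"
      define z' where "z' = z - (e \<bullet> z) *\<^sub>R e"
      have h: "(z' \<bullet> ?H z') / (2 * norm ?G) - \<epsilon> * (norm z')\<^sup>2 \<le> e \<bullet> z"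
        using r(2)[of z] \<sigma>(4,5) by (simp add: z_def z'_def Let_def)
      have z'e: "z' \<bullet> e = 0" by (simp add: z'_def inner_diff_left ee inner_commute[of z e])
      have bz: "b \<bullet> z' = b \<bullet> (x - p)" if "b \<in> T" for b
        using Te[OF that] by (simp add: z'_def z_def inner_diff_right)
      have zT: "z' \<in> span T" using z'e perp T(3) by simp
      have "(norm z')\<^sup>2 = (\<Sum>b\<in>T. (b \<bullet> (x - p))\<^sup>2)"
        using orthonormal_expand(2)[OF T(1,2) _ zT, of z'] T(4) bz
        unfolding power2_norm_eq_inner by (simp add: power2_eq_square)
      moreover have "z' \<bullet> ?H z' = norm ?G * (\<Sum>b\<in>T. k b * (b \<bullet> (x - p))\<^sup>2)"
        using quad[of z'] z'e perp bz by simp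
      ultimately have "(\<Sum>b\<in>T. k b * (b \<bullet> (x - p))\<^sup>2) / 2 - \<epsilon> * (\<Sum>b\<in>T. (b \<bullet> (x - p))\<^sup>2) \<le> e \<bullet> z"
        using h G0 by simp
      moreover have "e \<bullet> z = e \<bullet> (x - p) - \<sigma>" by (simp add: z_def inner_diff_right ee)
      moreover have "(\<Sum>b\<in>T. (k b / 2 - \<epsilon>) * (b \<bullet> (x - p))\<^sup>2)
          = (\<Sum>b\<in>T. k b * (b \<bullet> (x - p))\<^sup>2) / 2 - \<epsilon> * (\<Sum>b\<in>T. (b \<bullet> (x - p))\<^sup>2)"
        by (simp add: left_diff_distrib sum_subtractf sum_distrib_left sum_divide_distrib)
      ultimately show "\<exists>\<sigma>>0. x - \<sigma> *\<^sub>R e \<in> frontier \<Omega> \<and>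
         (\<forall>\<tau>. 0 \<le> \<tau> \<longrightarrow> \<tau> < \<sigma> \<longrightarrow> x - \<tau> *\<^sub>R e \<in> \<Omega>) \<and>
         \<sigma> \<le> e \<bullet> (x - p) - (\<Sum>b\<in>T. (k b / 2 - \<epsilon>) * (b \<bullet> (x - p))\<^sup>2)"
        using \<sigma> by (intro exI[of _ \<sigma>]) auto
    qed (rule \<delta>(1))
  qed
  have "\<exists>T k. finite T \<and> (\<forall>b\<in>T. norm b = 1 \<and> b \<bullet> e = 0) \<and>
      (\<Sum>b\<in>T. k b) = (real DIM('a) - 1) * mean_curvature \<Omega> p \<and>
      (\<forall>\<epsilon>>0. \<exists>\<delta>>0. \<forall>x\<in>\<Omega> \<inter> ball p \<delta>. \<exists>\<sigma>>0. x - \<sigma> *\<^sub>R e \<in> frontier \<Omega> \<and>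
         (\<forall>\<tau>. 0 \<le> \<tau> \<longrightarrow> \<tau> < \<sigma> \<longrightarrow> x - \<tau> *\<^sub>R e \<in> \<Omega>) \<and>
         \<sigma> \<le> e \<bullet> (x - p) - (\<Sum>b\<in>T. (k b / 2 - \<epsilon>) * (b \<bullet> (x - p))\<^sup>2))"
    using T(1,4) Te tr main by (intro exI[of _ T] exI[of _ k] conjI allI impI ballI) auto
  then show ?thesis using e1 interior_ball[OF op D p e] by (intro conjI)
qed

subsection \<open>The P-function\<close>

lemma twice_diff_affine_minus_squares:
  fixes e p :: "'a::euclidean_space" and T :: "'a set" and c :: "'a \<Rightarrow> real"
  defines "\<psi> \<equiv> \<lambda>x. e \<bullet> (x - p) - (\<Sum>b\<in>T. c b * (b \<bullet> (x - p))\<^sup>2)"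
  shows "twice_diff_on \<psi> UNIV" and "laplacian \<psi> x = - 2 * (\<Sum>b\<in>T. c b * (norm b)\<^sup>2)"
    and "gradient \<psi> x = e - (\<Sum>b\<in>T. (2 * c b * (b \<bullet> (x - p))) *\<^sub>R b)"
proof -
  let ?G = "\<lambda>x. e - (\<Sum>b\<in>T. (2 * c b * (b \<bullet> (x - p))) *\<^sub>R b)"
  let ?D = "\<lambda>x i h. - (\<Sum>b\<in>T. (2 * c b * (b \<bullet> h)) * (b \<bullet> i))"
  have G: "(\<psi> has_derivative (\<lambda>h. h \<bullet> ?G y)) (at y)" for y
  proof -
    have "(\<psi> has_derivative (\<lambda>h. e \<bullet> h - (\<Sum>b\<in>T. c b * (2 * (b \<bullet> (y - p)) * (b \<bullet> h))))) (at y)"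
      unfolding \<psi>_def by (auto intro!: derivative_eq_intros simp: mult.commute mult.left_commute)
    moreover have "(\<lambda>h. e \<bullet> h - (\<Sum>b\<in>T. c b * (2 * (b \<bullet> (y - p)) * (b \<bullet> h)))) = (\<lambda>h. h \<bullet> ?G y)"
      by (rule ext) (simp add: inner_diff_right inner_sum_right inner_commute mult_ac)
    ultimately show ?thesis by simp
  qed
  have H: "((\<lambda>y. ?G y \<bullet> i) has_derivative ?D y i) (at y)" for y i
  proof -
    have eq: "(\<lambda>y. ?G y \<bullet> i) = (\<lambda>y. e \<bullet> i - (\<Sum>b\<in>T. (2 * c b * (b \<bullet> (y - p))) * (b \<bullet> i)))"
      by (rule ext) (simp add: inner_diff_left inner_sum_left)
    show ?thesis unfolding eq by (auto intro!: derivative_eq_intros simp: sum_negf)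
  qed
  note * = twice_diff_onI[OF open_UNIV G H]
  show "twice_diff_on \<psi> UNIV" using *(1) by blast
  show "gradient \<psi> x = ?G x" using *(3)[of x] by simp
  have "laplacian \<psi> x = (\<Sum>i\<in>Basis. - (\<Sum>b\<in>T. (2 * c b * (b \<bullet> i)) * (b \<bullet> i)))"
    using *(2)[of x] by simp
  also have "\<dots> = - (\<Sum>b\<in>T. \<Sum>i\<in>Basis. (2 * c b * (b \<bullet> i)) * (b \<bullet> i))"
    by (subst sum.swap) (simp add: sum_negf)
  also have "\<dots> = - (\<Sum>b\<in>T. 2 * c b * (norm b)\<^sup>2)"
    unfolding power2_norm_eq_inner
    by (subst (3) euclidean_inner) (simp add: sum_distrib_left mult.assoc)
  finally show "laplacian \<psi> x = - 2 * (\<Sum>b\<in>T. c b * (norm b)\<^sup>2)"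
    by (simp add: sum_distrib_left sum_negf mult.assoc)
qed

lemma planar_function:
  fixes g g' g'' :: "real \<Rightarrow> real" and e p :: "'a::euclidean_space"
  assumes g: "\<And>t. (g has_real_derivative g' t) (at t)" and g': "\<And>t. (g' has_real_derivative g'' t) (at t)"
    and e: "norm e = 1"
  shows "twice_diff_on (\<lambda>x. g (t0 + e \<bullet> (x - p))) UNIV"
    and "laplacian (\<lambda>x. g (t0 + e \<bullet> (x - p))) x = g'' (t0 + e \<bullet> (x - p))"
    and "gradient (\<lambda>x. g (t0 + e \<bullet> (x - p))) x = g' (t0 + e \<bullet> (x - p)) *\<^sub>R e"
proof -
  note l = twice_diff_affine_minus_squares[of e p _ "{}", simplified]
  have h: "((\<lambda>t. g (t0 + t)) has_real_derivative g' (t0 + t)) (at t)"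
    "((\<lambda>t. g' (t0 + t)) has_real_derivative g'' (t0 + t)) (at t)" for t
  proof -
    have "((\<lambda>t. t0 + t) has_real_derivative 1) (at t)" by (auto intro!: derivative_eq_intros)
    from DERIV_chain2[OF g this] DERIV_chain2[OF g' this]
    show "((\<lambda>t. g (t0 + t)) has_real_derivative g' (t0 + t)) (at t)"
      "((\<lambda>t. g' (t0 + t)) has_real_derivative g'' (t0 + t)) (at t)" by simp_all
  qed
  note c = twice_diff_compose[OF open_UNIV l(1) h]
  show "twice_diff_on (\<lambda>x. g (t0 + e \<bullet> (x - p))) UNIV" by (rule c(1))
  show "laplacian (\<lambda>x. g (t0 + e \<bullet> (x - p))) x = g'' (t0 + e \<bullet> (x - p))"
    using c(2)[of x] l(2)[of x] l(3)[of x] e by simp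
  show "gradient (\<lambda>x. g (t0 + e \<bullet> (x - p))) x = g' (t0 + e \<bullet> (x - p)) *\<^sub>R e"
    using c(3)[of x] l(3)[of x] by simp
qed

lemma laplacian_cong_open:
  assumes "open S" "x \<in> S" "\<And>y. y \<in> S \<Longrightarrow> f y = g y"
  shows "laplacian f x = laplacian g x"
  unfolding laplacian_def
  by (intro sum.cong refl partial_deriv_cong_open[OF assms(1,2)]) (use assms in \<open>auto intro: partial_deriv_cong_open\<close>)

lemma has_derivative_real_compose:
  fixes u :: "'a::euclidean_space \<Rightarrow> real"
  assumes "u differentiable at x" "(F has_real_derivative f (u x)) (at (u x))"
  shows "((\<lambda>x. F (u x)) has_derivative (\<lambda>h. f (u x) * (h \<bullet> gradient u x))) (at x)"
  using has_derivative_compose[OF has_derivative_gradient[OF assms(1)] assms(2)[unfolded has_field_derivative_def]]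
  by simp

text \<open>Since \<open>f (u x) = - laplacian u x\<close> is differentiable although \<open>f\<close> need not be, the
  derivatives of \<open>f (u x)\<close> are rewritten as third derivatives of \<open>u\<close>, which then cancel.\<close>

lemma P_function_derivatives:
  fixes \<Omega> :: "'a::euclidean_space set"
  assumes \<Omega>: "open \<Omega>" and u: "Ck_on 3 u \<Omega>" and F: "\<And>t. (F has_real_derivative f t) (at t)"
    and eq: "\<And>x. x \<in> \<Omega> \<Longrightarrow> laplacian u x + f (u x) = 0"
  shows "twice_diff_on (P_function F u) \<Omega>"
    and "\<And>x. x \<in> \<Omega> \<Longrightarrow> gradient (P_function F u) x = 2 *\<^sub>R (hessian u x (gradient u x) + f (u x) *\<^sub>R gradient u x)"
    and "\<And>x. x \<in> \<Omega> \<Longrightarrow> laplacian (P_function F u) x =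
      2 * (\<Sum>b\<in>Basis. \<Sum>c\<in>Basis. (partial_deriv c (partial_deriv b u) x)\<^sup>2) - 2 * (f (u x))\<^sup>2"
proof -
  have u2: "twice_diff_on u \<Omega>"
    using u by (simp add: numeral_3_eq_3 twice_diff_on_def)
  have ub2: "twice_diff_on (partial_deriv b u) \<Omega>" if "b \<in> Basis" for b
    using u that by (simp add: numeral_3_eq_3 twice_diff_on_def)
  let ?d = "\<lambda>b x. partial_deriv b u x"
  let ?dd = "\<lambda>c b x. partial_deriv c (partial_deriv b u) x"
  have feq: "f (u x) = - (\<Sum>d\<in>Basis. ?dd d d x)" if "x \<in> \<Omega>" for x
    using eq[OF that] by (simp add: laplacian_def)
  let ?G = "\<lambda>y. \<Sum>c\<in>Basis. (2 * ((\<Sum>b\<in>Basis. ?d b y * ?dd c b y) - (\<Sum>d\<in>Basis. ?dd d d y) * ?d c y)) *\<^sub>R c"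
  have Gc: "?G y \<bullet> c = 2 * ((\<Sum>b\<in>Basis. ?d b y * ?dd c b y) - (\<Sum>d\<in>Basis. ?dd d d y) * ?d c y)" if "c \<in> Basis" for c y
    using that by (simp add: inner_sum_left inner_Basis if_distrib cong: if_cong)
  have G_eq: "?G y = 2 *\<^sub>R (hessian u y (gradient u y) + f (u y) *\<^sub>R gradient u y)" if y: "y \<in> \<Omega>" for y
  proof (rule euclidean_eqI)
    fix c :: 'a assume c: "c \<in> Basis"
    have "hessian u y (gradient u y) \<bullet> c = gradient u y \<bullet> hessian u y c"
      by (rule hessian_symmetric[OF \<Omega> u2 y])
    also have "\<dots> = (\<Sum>b\<in>Basis. ?d b y * ?dd c b y)"
      unfolding hessian_def inner_sum_right using c by (intro sum.cong) (auto simp: gradient_inner_Basis)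
    finally have "(2 *\<^sub>R (hessian u y (gradient u y) + f (u y) *\<^sub>R gradient u y)) \<bullet> c =
       2 * ((\<Sum>b\<in>Basis. ?d b y * ?dd c b y) + f (u y) * ?d c y)"
      using c by (simp add: inner_add_left gradient_inner_Basis)
    then show "?G y \<bullet> c = (2 *\<^sub>R (hessian u y (gradient u y) + f (u y) *\<^sub>R gradient u y)) \<bullet> c"
      unfolding Gc[OF c] by (simp add: feq[OF y])
  qed
  have G: "(P_function F u has_derivative (\<lambda>h. h \<bullet> ?G y)) (at y)" if y: "y \<in> \<Omega>" for y
  proof -
    note H = has_derivative_hessian[OF u2 y]
    have "((\<lambda>x. gradient u x \<bullet> gradient u x + 2 * F (u x)) has_derivative
      (\<lambda>h. (gradient u y \<bullet> hessian u y h + hessian u y h \<bullet> gradient u y) + 2 * (f (u y) * (h \<bullet> gradient u y)))) (at y)"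
      by (intro has_derivative_add has_derivative_inner H has_derivative_mult_right
          has_derivative_real_compose[where F = F and f = f] twice_diff_onD(1)[OF u2 y] F)
    moreover have "P_function F u = (\<lambda>x. gradient u x \<bullet> gradient u x + 2 * F (u x))"
      by (rule ext) (simp add: P_function_def power2_norm_eq_inner)
    moreover have "(\<lambda>h. (gradient u y \<bullet> hessian u y h + hessian u y h \<bullet> gradient u y) + 2 * (f (u y) * (h \<bullet> gradient u y)))
       = (\<lambda>h. h \<bullet> ?G y)"
      unfolding G_eq[OF y]
      by (rule ext) (simp add: inner_add_right hessian_symmetric[OF \<Omega> u2 y] inner_commute[of "gradient u y"])
    ultimately show ?thesis by simp
  qed
  define D where "D = (\<lambda>y c h. 2 * ((\<Sum>b\<in>Basis. ?d b y * (h \<bullet> gradient (?dd c b) y) + (h \<bullet> gradient (?d b) y) * ?dd c b y)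
     - ((\<Sum>d\<in>Basis. ?dd d d y) * (h \<bullet> gradient (?d c) y) + (\<Sum>d\<in>Basis. h \<bullet> gradient (?dd d d) y) * ?d c y)))"
  have H: "((\<lambda>y. ?G y \<bullet> c) has_derivative D y c) (at y)" if y: "y \<in> \<Omega>" and c: "c \<in> Basis" for y c
  proof -
    have d1: "(?d b has_derivative (\<lambda>h. h \<bullet> gradient (?d b) y)) (at y)" if "b \<in> Basis" for b
      using has_derivative_gradient[OF twice_diff_onD(2)[OF u2 y that]] .
    have d2: "(?dd c b has_derivative (\<lambda>h. h \<bullet> gradient (?dd c b) y)) (at y)" if "b \<in> Basis" "c \<in> Basis" for b c
      using has_derivative_gradient[OF twice_diff_onD(2)[OF ub2[OF that(1)] y that(2)]] .
    have "((\<lambda>y. 2 * ((\<Sum>b\<in>Basis. ?d b y * ?dd c b y) - (\<Sum>d\<in>Basis. ?dd d d y) * ?d c y)) has_derivative D y c) (at y)"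
      unfolding D_def
      by (intro has_derivative_mult_right has_derivative_diff has_derivative_sum has_derivative_mult d1 d2 c; assumption)
    then show ?thesis using Gc[OF c] by simp
  qed
  note * = twice_diff_onI[OF \<Omega> G H]
  show "twice_diff_on (P_function F u) \<Omega>" by (rule *(1))
  show "gradient (P_function F u) x = 2 *\<^sub>R (hessian u x (gradient u x) + f (u x) *\<^sub>R gradient u x)" if "x \<in> \<Omega>" for x
  proof -
    have "gradient (P_function F u) x = ?G x" by (rule *(3)) (use that in auto)
    then show ?thesis using G_eq[OF that] by simp
  qed
  show "laplacian (P_function F u) x =
      2 * (\<Sum>b\<in>Basis. \<Sum>c\<in>Basis. (?dd c b x)\<^sup>2) - 2 * (f (u x))\<^sup>2" if x: "x \<in> \<Omega>" for x
  proof -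
    have third: "partial_deriv c (?dd c b) x = partial_deriv b (?dd c c) x" if b: "b \<in> Basis" and c: "c \<in> Basis" for b c
    proof -
      have "partial_deriv c (?dd c b) x = partial_deriv c (?dd b c) x"
        by (rule partial_deriv_cong_open[OF \<Omega> x]) (rule partial_deriv_commute[OF \<Omega> u2 _ b c])
      also have "\<dots> = partial_deriv b (?dd c c) x"
        by (rule partial_deriv_commute[OF \<Omega> ub2[OF c] x b c])
      finally show ?thesis .
    qed
    let ?f = "\<Sum>d\<in>Basis. ?dd d d x"
    have "laplacian (P_function F u) x = (\<Sum>c\<in>Basis. D x c c)" by (rule *(2)) (use x in auto)
    also have "\<dots> = (\<Sum>c\<in>Basis. 2 * ((\<Sum>b\<in>Basis. ?d b x * partial_deriv b (?dd c c) x) + (\<Sum>b\<in>Basis. (?dd c b x)\<^sup>2)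
       - (?f * ?dd c c x + (\<Sum>d\<in>Basis. partial_deriv c (?dd d d) x) * ?d c x)))"
    proof (rule sum.cong)
      fix c :: 'a assume c: "c \<in> Basis"
      have "(\<Sum>b\<in>Basis. ?d b x * (c \<bullet> gradient (?dd c b) x) + (c \<bullet> gradient (?d b) x) * ?dd c b x)
        = (\<Sum>b\<in>Basis. ?d b x * partial_deriv b (?dd c c) x + (?dd c b x)\<^sup>2)"
      proof (rule sum.cong)
        fix b :: 'a assume b: "b \<in> Basis"
        show "?d b x * (c \<bullet> gradient (?dd c b) x) + (c \<bullet> gradient (?d b) x) * ?dd c b x
          = ?d b x * partial_deriv b (?dd c c) x + (?dd c b x)\<^sup>2"
          unfolding gradient_inner_Basis(2)[OF c] third[OF b c] by (simp add: power2_eq_square)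
      qed simp
      then show "D x c c = 2 * ((\<Sum>b\<in>Basis. ?d b x * partial_deriv b (?dd c c) x) + (\<Sum>b\<in>Basis. (?dd c b x)\<^sup>2)
       - (?f * ?dd c c x + (\<Sum>d\<in>Basis. partial_deriv c (?dd d d) x) * ?d c x))"
        unfolding D_def by (simp add: gradient_inner_Basis(2)[OF c] sum.distrib)
    qed simp
    also have "\<dots> = 2 * ((\<Sum>c\<in>Basis. \<Sum>b\<in>Basis. ?d b x * partial_deriv b (?dd c c) x) + (\<Sum>c\<in>Basis. \<Sum>b\<in>Basis. (?dd c b x)\<^sup>2)
       - (?f * ?f + (\<Sum>c\<in>Basis. \<Sum>d\<in>Basis. partial_deriv c (?dd d d) x * ?d c x)))"
      by (simp add: sum_distrib_left[symmetric] sum_subtractf sum.distrib sum_distrib_right[symmetric])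
    also have "(\<Sum>c\<in>Basis. \<Sum>b\<in>Basis. ?d b x * partial_deriv b (?dd c c) x)
        = (\<Sum>c\<in>Basis. \<Sum>d\<in>Basis. partial_deriv c (?dd d d) x * ?d c x)"
      by (subst sum.swap) (simp add: mult.commute)
    also have "(\<Sum>c\<in>Basis. \<Sum>b\<in>Basis. (?dd c b x)\<^sup>2) = (\<Sum>b\<in>Basis. \<Sum>c\<in>Basis. (?dd c b x)\<^sup>2)"
      by (rule sum.swap)
    finally show ?thesis by (simp add: feq[OF x] power2_eq_square)
  qed
qed

text \<open>Cauchy-Schwarz row by row: the Frobenius norm dominates the operator norm.\<close>

lemma norm_hessian_sq_le:
  "(norm (hessian u x v))\<^sup>2 \<le> (\<Sum>b\<in>Basis. \<Sum>c\<in>Basis. (partial_deriv c (partial_deriv b u) x)\<^sup>2) * (norm v)\<^sup>2"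
proof -
  have "(norm (hessian u x v))\<^sup>2 = (\<Sum>b\<in>Basis. (hessian u x v \<bullet> b)\<^sup>2)"
    unfolding power2_norm_eq_inner by (subst euclidean_inner) (simp add: power2_eq_square)
  also have "\<dots> = (\<Sum>b\<in>Basis. (\<Sum>c\<in>Basis. partial_deriv c (partial_deriv b u) x * (v \<bullet> c))\<^sup>2)"
  proof (rule sum.cong)
    fix b :: 'a assume "b \<in> Basis"
    then have "hessian u x v \<bullet> b = v \<bullet> gradient (partial_deriv b u) x"
      by (simp add: hessian_def inner_sum_left inner_Basis if_distrib cong: if_cong)
    also have "\<dots> = (\<Sum>c\<in>Basis. partial_deriv c (partial_deriv b u) x * (v \<bullet> c))"
      by (subst euclidean_inner) (simp add: gradient_inner_Basis mult.commute)
    finally show "(hessian u x v \<bullet> b)\<^sup>2 = (\<Sum>c\<in>Basis. partial_deriv c (partial_deriv b u) x * (v \<bullet> c))\<^sup>2" by simp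
  qed simp
  also have "\<dots> \<le> (\<Sum>b\<in>Basis. (\<Sum>c\<in>Basis. (partial_deriv c (partial_deriv b u) x)\<^sup>2) * (\<Sum>c\<in>Basis. (v \<bullet> c)\<^sup>2))"
    by (intro sum_mono Cauchy_Schwarz_ineq_sum)
  also have "(\<Sum>c\<in>Basis. (v \<bullet> c)\<^sup>2) = (norm v)\<^sup>2"
    unfolding power2_norm_eq_inner by (subst (2) euclidean_inner) (simp add: power2_eq_square)
  finally show ?thesis by (simp add: sum_distrib_right)
qed

text \<open>The gradient of \<open>Q\<close> is - 2 X, where X measures how far
  \<open>gradient u\<close> is from being an eigenvector of the Hessian for - f. Hence |f| |gradient
  u| \<le> |hessian (gradient u)| + |X|, and squaring together with the Frobenius bound compares f^2
  with the sum of squared second derivatives.\<close>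

lemma P_function_deficit:
  fixes \<Omega> :: "'a::euclidean_space set" and E :: real
  assumes \<Omega>: "open \<Omega>" and u: "Ck_on 3 u \<Omega>" and F: "\<And>t. (F has_real_derivative f t) (at t)"
    and eq: "\<And>x. x \<in> \<Omega> \<Longrightarrow> laplacian u x + f (u x) = 0"
  defines "Q \<equiv> \<lambda>x. E - P_function F u x"
  shows "twice_diff_on Q \<Omega>"
    and "\<And>x. x \<in> \<Omega> \<Longrightarrow> gradient Q x = - 2 *\<^sub>R (hessian u x (gradient u x) + f (u x) *\<^sub>R gradient u x)"
    and "\<And>x. x \<in> \<Omega> \<Longrightarrow> laplacian Q x =
      2 * (f (u x))\<^sup>2 - 2 * (\<Sum>b\<in>Basis. \<Sum>c\<in>Basis. (partial_deriv c (partial_deriv b u) x)\<^sup>2)"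
    and "\<And>x. x \<in> \<Omega> \<Longrightarrow> gradient u x \<noteq> 0 \<Longrightarrow>
      laplacian Q x \<le> 2 * \<bar>f (u x)\<bar> / norm (gradient u x) * norm (gradient Q x)"
proof -
  note P = P_function_derivatives[OF \<Omega> u F eq]
  have one: "twice_diff_on (\<lambda>x::'a. E) \<Omega>" "gradient (\<lambda>x::'a. E) x = 0" "laplacian (\<lambda>x::'a. E) x = 0" for x
    using twice_diff_onI[OF open_UNIV, of "\<lambda>x::'a. E" "\<lambda>_. 0" "\<lambda>_ _ _. 0"] twice_diff_on_subset[of "\<lambda>x::'a. E" UNIV \<Omega>] by auto
  have Qe: "Q = (\<lambda>x. 1 * E + (- 1) * P_function F u x)" by (simp add: Q_def fun_eq_iff)
  note lc = twice_diff_lincomb[OF \<Omega> one(1) P(1), where a = 1 and c = "- 1", folded Qe]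
  show "twice_diff_on Q \<Omega>" by (rule lc(1)) (auto simp: eq)
  show g: "gradient Q x = - 2 *\<^sub>R (hessian u x (gradient u x) + f (u x) *\<^sub>R gradient u x)" if "x \<in> \<Omega>" for x
    using lc(3)[OF _ that] P(2)[OF _ that] one eq by simp
  show l: "laplacian Q x =
      2 * (f (u x))\<^sup>2 - 2 * (\<Sum>b\<in>Basis. \<Sum>c\<in>Basis. (partial_deriv c (partial_deriv b u) x)\<^sup>2)" if "x \<in> \<Omega>" for x
    using lc(2)[OF _ that] P(3)[OF _ that] one eq by simp
  show "laplacian Q x \<le> 2 * \<bar>f (u x)\<bar> / norm (gradient u x) * norm (gradient Q x)"
    if x: "x \<in> \<Omega>" and g0: "gradient u x \<noteq> 0" for x
  proof -
    let ?g = "norm (gradient u x)" and ?f = "\<bar>f (u x)\<bar>"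
    let ?S = "\<Sum>b\<in>Basis. \<Sum>c\<in>Basis. (partial_deriv c (partial_deriv b u) x)\<^sup>2"
    define X where "X = hessian u x (gradient u x) + f (u x) *\<^sub>R gradient u x"
    have gp: "?g > 0" using g0 by simp
    have nX: "norm (gradient Q x) = 2 * norm X" using g[OF x] by (simp add: X_def)
    have tri: "?f * ?g \<le> norm (hessian u x (gradient u x)) + norm X"
      using norm_triangle_ineq4[of X "hessian u x (gradient u x)"] by (simp add: X_def)
    have hS: "(norm (hessian u x (gradient u x)))\<^sup>2 \<le> ?S * ?g\<^sup>2" by (rule norm_hessian_sq_le)
    \<comment> \<open>Squaring the triangle inequality needs \<open>?f * ?g - norm X\<close> to be
      nonnegative; in the other case the left side is already nonpositive.\<close>
    have "(?f * ?g)\<^sup>2 - 2 * (?f * ?g) * norm X \<le> (norm (hessian u x (gradient u x)))\<^sup>2"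
    proof (cases "?f * ?g \<le> norm X")
      case True
      have "(?f * ?g)\<^sup>2 \<le> 2 * (?f * ?g) * norm X"
      proof -
        have "(?f * ?g) * (?f * ?g) \<le> (?f * ?g) * norm X" by (rule mult_left_mono[OF True]) simp
        moreover have "0 \<le> (?f * ?g) * norm X" by simp
        ultimately show ?thesis unfolding power2_eq_square by linarith
      qed
      then show ?thesis using zero_le_power2[of "norm (hessian u x (gradient u x))"] by linarith
    next
      case False
      then have "(?f * ?g - norm X)\<^sup>2 \<le> (norm (hessian u x (gradient u x)))\<^sup>2"
        using tri by (intro power_mono) auto
      moreover have "(?f * ?g - norm X)\<^sup>2 = (?f * ?g)\<^sup>2 - 2 * (?f * ?g) * norm X + (norm X)\<^sup>2"
        by (simp add: power2_diff)
      ultimately show ?thesis using zero_le_power2[of "norm X"] by linarith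
    qed
    then have "?f\<^sup>2 * ?g\<^sup>2 - ?S * ?g\<^sup>2 \<le> 2 * (?f * ?g) * norm X" using hS by (simp add: power_mult_distrib)
    moreover have "(2 * ?f / ?g * norm X) * ?g\<^sup>2 = 2 * (?f * ?g) * norm X"
      using gp by (simp add: power2_eq_square)
    ultimately have "(?f\<^sup>2 - ?S) * ?g\<^sup>2 \<le> (2 * ?f / ?g * norm X) * ?g\<^sup>2"
      unfolding left_diff_distrib by linarith
    then have "?f\<^sup>2 - ?S \<le> 2 * ?f / ?g * norm X" by (rule mult_right_le_imp_le) (use gp in simp)
    then show ?thesis using l[OF x] nX by simp
  qed
qed

text \<open>With \<open>Q\<close> constant, \<nu> = sgn (gradient u) is an eigenvector of the
  Hessian for - f, and the squared Frobenius norm of the Hessian is f^2. The Hessian is then the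
  rank one form - f \<nu> \<nu>, its image is parallel to the gradient, and the direction \<nu>
  cannot turn.\<close>

lemma rigidity_of_constant_P:
  fixes \<Omega> :: "'a::euclidean_space set"
  assumes \<Omega>: "open \<Omega>" and u: "Ck_on 3 u \<Omega>" and F: "\<And>t. (F has_real_derivative f t) (at t)"
    and eq: "\<And>x. x \<in> \<Omega> \<Longrightarrow> laplacian u x + f (u x) = 0"
    and C: "open C" "convex C" "C \<subseteq> \<Omega>" "C \<noteq> {}"
    and P: "\<And>x. x \<in> C \<Longrightarrow> P_function F u x = E" and g0: "\<And>x. x \<in> C \<Longrightarrow> gradient u x \<noteq> 0"
  shows "\<exists>\<nu>. norm \<nu> = 1 \<and> (\<forall>x\<in>C. gradient u x = norm (gradient u x) *\<^sub>R \<nu>) \<and>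
    (\<forall>x\<in>C. \<forall>h. hessian u x h = (- f (u x) * (\<nu> \<bullet> h)) *\<^sub>R \<nu>)"
proof -
  have u2: "twice_diff_on u \<Omega>" using u by (simp add: numeral_3_eq_3 twice_diff_on_def)
  have hess: "hessian u x h = (- f (u x) * (sgn (gradient u x) \<bullet> h)) *\<^sub>R sgn (gradient u x)" if x: "x \<in> C" for x h
  proof -
    have xO: "x \<in> \<Omega>" using x C by blast
    let ?Q = "\<lambda>x. E - P_function F u x"
    let ?g = "gradient u x" and ?S = "\<Sum>b\<in>Basis. \<Sum>c\<in>Basis. (partial_deriv c (partial_deriv b u) x)\<^sup>2"
    define \<nu> where "\<nu> = sgn ?g"
    define a where "a = f (u x)"
    note Q = P_function_deficit[OF \<Omega> u F eq, where E = E]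
    have cst: "twice_diff_on (\<lambda>x::'a. 0::real) UNIV" "gradient (\<lambda>x::'a. 0::real) x = 0" "laplacian (\<lambda>x::'a. 0::real) x = 0"
      using twice_diff_onI[OF open_UNIV, of "\<lambda>x::'a. 0" "\<lambda>_. 0" "\<lambda>_ _ _. 0"] by auto
    have "gradient ?Q x = 0" "laplacian ?Q x = 0"
      using gradient_cong_open[OF C(1) x, of ?Q "\<lambda>_. 0"] laplacian_cong_open[OF C(1) x, of ?Q "\<lambda>_. 0"] P cst by auto
    then have Hg: "hessian u x ?g = - a *\<^sub>R ?g" and S: "?S = a\<^sup>2"
      using Q(2,3)[OF _ xO] eq by (auto simp: a_def eq_neg_iff_add_eq_0)
    have gn: "norm ?g > 0" using g0[OF x] by simp
    have nn: "\<nu> \<bullet> \<nu> = 1" using gn by (simp add: \<nu>_def norm_sgn flip: norm_eq_1)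
    have "linear (hessian u x)" by (rule has_derivative_linear[OF has_derivative_hessian[OF u2 xO]])
    then have Hn: "hessian u x \<nu> = - a *\<^sub>R \<nu>" using Hg by (simp add: \<nu>_def sgn_div_norm linear_scale)
    let ?w = "\<lambda>b c. partial_deriv c (partial_deriv b u) x"
    have n1: "(\<Sum>b\<in>Basis. (\<nu> \<bullet> b)\<^sup>2) = 1" using nn by (subst (asm) euclidean_inner) (simp add: power2_eq_square)
    \<comment> \<open>The squared Frobenius distance of the Hessian from - a \<nu> \<nu> expands to
      a^2 + 2 a (- a) + a^2 = 0.\<close>
    have "(\<Sum>b\<in>Basis. \<Sum>c\<in>Basis. (?w b c + a * ((\<nu> \<bullet> b) * (\<nu> \<bullet> c)))\<^sup>2)
      = ?S + 2 * a * (\<Sum>b\<in>Basis. \<Sum>c\<in>Basis. (\<nu> \<bullet> c) * (\<nu> \<bullet> b) * ?w b c) + a\<^sup>2 * (\<Sum>b\<in>Basis. \<Sum>c\<in>Basis. (\<nu> \<bullet> b)\<^sup>2 * (\<nu> \<bullet> c)\<^sup>2)"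
      by (simp add: power2_sum power_mult_distrib sum.distrib sum_distrib_left mult_ac)
    also have "(\<Sum>b\<in>Basis. \<Sum>c\<in>Basis. (\<nu> \<bullet> c) * (\<nu> \<bullet> b) * ?w b c) = hessian u x \<nu> \<bullet> \<nu>"
      by (simp add: hessian_inner)
    also have "\<dots> = - a" using Hn nn by simp
    also have "(\<Sum>b\<in>Basis. \<Sum>c\<in>Basis. (\<nu> \<bullet> b)\<^sup>2 * (\<nu> \<bullet> c)\<^sup>2) = 1"
      using n1 by (simp add: sum_distrib_left[symmetric])
    finally have "(\<Sum>b\<in>Basis. \<Sum>c\<in>Basis. (?w b c + a * ((\<nu> \<bullet> b) * (\<nu> \<bullet> c)))\<^sup>2) = 0"
      using S by (simp add: power2_eq_square)
    then have w: "?w b c = - a * ((\<nu> \<bullet> b) * (\<nu> \<bullet> c))" if "b \<in> Basis" "c \<in> Basis" for b c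
      using that by (simp add: sum_nonneg_eq_0_iff sum_nonneg eq_neg_iff_add_eq_0)
    have "hessian u x h = (- a * (\<nu> \<bullet> h)) *\<^sub>R \<nu>"
    proof (rule euclidean_eqI)
      fix b :: 'a assume b: "b \<in> Basis"
      then have "hessian u x h \<bullet> b = h \<bullet> gradient (partial_deriv b u) x"
        by (simp add: hessian_def inner_sum_left inner_Basis if_distrib cong: if_cong)
      also have "\<dots> = (\<Sum>c\<in>Basis. (h \<bullet> c) * ?w b c)"
        by (subst euclidean_inner) (simp add: gradient_inner_Basis)
      also have "\<dots> = (\<Sum>c\<in>Basis. (- a * (\<nu> \<bullet> b)) * ((\<nu> \<bullet> c) * (h \<bullet> c)))"
        using w[OF b] by (intro sum.cong) auto
      also have "\<dots> = - a * (\<nu> \<bullet> b) * (\<nu> \<bullet> h)"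
        unfolding euclidean_inner[of \<nu> h] by (simp only: sum_distrib_left)
      finally show "hessian u x h \<bullet> b = ((- a * (\<nu> \<bullet> h)) *\<^sub>R \<nu>) \<bullet> b" by simp
    qed
    then show ?thesis by (simp add: a_def \<nu>_def)
  qed
  have "\<exists>\<nu>. \<forall>x\<in>C. sgn (gradient u x) = \<nu>"
  proof (rule has_derivative_zero_constant[OF C(2)])
    fix x assume x: "x \<in> C"
    then have xO: "x \<in> \<Omega>" using C by blast
    let ?g = "gradient u x"
    have gn: "norm ?g > 0" using g0[OF x] by simp
    have nn: "sgn ?g \<bullet> sgn ?g = 1" using gn by (simp add: norm_sgn flip: norm_eq_1)
    note D = has_derivative_sgn_compose[OF has_derivative_hessian[OF u2 xO] g0[OF x]]
    have "inverse (norm ?g) *\<^sub>R hessian u x h + (- (inverse (norm ?g) * (hessian u x h \<bullet> sgn ?g) * inverse (norm ?g))) *\<^sub>R ?g = 0" for h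
    proof -
      let ?k = "- f (u x) * (sgn ?g \<bullet> h)"
      have "hessian u x h = ?k *\<^sub>R sgn ?g" by (rule hess[OF x])
      then have h1: "hessian u x h \<bullet> sgn ?g = ?k" and h2: "hessian u x h = (?k * inverse (norm ?g)) *\<^sub>R ?g"
        using nn by (simp, simp add: sgn_div_norm)
      show ?thesis unfolding h1 unfolding h2 by (simp add: mult_ac)
    qed
    with D have "((\<lambda>x. sgn (gradient u x)) has_derivative (\<lambda>h. 0)) (at x)" by simp
    then show "((\<lambda>x. sgn (gradient u x)) has_derivative (\<lambda>h. 0)) (at x within C)"
      by (rule has_derivative_at_withinI)
  qed
  then obtain \<nu> where \<nu>: "\<And>x. x \<in> C \<Longrightarrow> sgn (gradient u x) = \<nu>" by blast
  obtain x0 where "x0 \<in> C" using C by blast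
  then have "norm \<nu> = 1" using \<nu>[of x0] g0[of x0] by (auto simp: norm_sgn)
  moreover have "gradient u x = norm (gradient u x) *\<^sub>R \<nu>" if "x \<in> C" for x
    using \<nu>[OF that] g0[OF that] by (auto simp: sgn_div_norm)
  ultimately show ?thesis using hess \<nu> by (intro exI[of _ \<nu>]) auto
qed

subsection \<open>Unique continuation of planar solutions\<close>

text \<open>On the segment from \<open>a\<close> to \<open>x\<close> the rank one Hessian turns the
  equation into an ordinary one with factor - (e \<bullet> h)^2, and uniqueness identifies
  \<open>u\<close> with the profile. The base point is allowed in the closure of \<open>C\<close>,
  so that a point of the frontier of \<Omega> can serve as start.\<close>

lemma solution_planar_near_regular_point:
  fixes \<Omega> :: "'a::euclidean_space set"
  assumes \<Omega>: "open \<Omega>" and u: "Ck_on 3 u \<Omega>" and F: "\<And>t. (F has_real_derivative f t) (at t)"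
    and eq: "\<And>x. x \<in> \<Omega> \<Longrightarrow> laplacian u x + f (u x) = 0" and L: "L-lipschitz_on UNIV f"
    and C: "open C" "convex C" "C \<subseteq> \<Omega>"
    and P: "\<And>x. x \<in> C \<Longrightarrow> P_function F u x = E" and g0: "\<And>x. x \<in> C \<Longrightarrow> gradient u x \<noteq> 0"
    and a: "a \<in> closure C" and uc: "continuous_on (closure C) u"
    and G: "continuous_on (closure C) G" "\<And>x. x \<in> C \<Longrightarrow> G x = gradient u x"
    and g: "\<And>t. (g has_real_derivative g' t) (at t)" and g': "\<And>t. (g' has_real_derivative - f (g t)) (at t)"
    and e: "norm e = 1" and ua: "u a = g \<tau>" and Ga: "G a = g' \<tau> *\<^sub>R e" and ne: "g' \<tau> \<noteq> 0" and x: "x \<in> C"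
  shows "u x = g (\<tau> + e \<bullet> (x - a))"
proof -
  have u2: "twice_diff_on u \<Omega>" using u by (simp add: numeral_3_eq_3 twice_diff_on_def)
  have "C \<noteq> {}" using x by blast
  from rigidity_of_constant_P[OF \<Omega> u F eq C this P g0] obtain \<nu> where
    nu: "norm \<nu> = 1" "\<And>x. x \<in> C \<Longrightarrow> gradient u x = norm (gradient u x) *\<^sub>R \<nu>"
    and hess: "\<And>x h. x \<in> C \<Longrightarrow> hessian u x h = (- f (u x) * (\<nu> \<bullet> h)) *\<^sub>R \<nu>" by blast
  have "G a - norm (G a) *\<^sub>R \<nu> = 0"
    by (rule continuous_constant_on_closure[of C "\<lambda>x. G x - norm (G x) *\<^sub>R \<nu>"])
       (use nu(2) G a in \<open>auto intro!: continuous_intros\<close>)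
  then have "g' \<tau> *\<^sub>R e = \<bar>g' \<tau>\<bar> *\<^sub>R \<nu>" using Ga e by simp
  then have "g' \<tau> *\<^sub>R e = g' \<tau> *\<^sub>R \<nu> \<or> g' \<tau> *\<^sub>R e = g' \<tau> *\<^sub>R (- \<nu>)"
    by (cases "g' \<tau> > 0") auto
  \<comment> \<open>The limit of the gradient determines \<nu> up to the sign of
    \<open>g' \<tau>\<close> only; the equation on the segment contains nothing but the square of
    the component along \<nu>.\<close>
  then have e_nu: "e = \<nu> \<or> e = - \<nu>" using ne unfolding scaleR_cancel_left by blast
  define h where "h = x - a"
  have eh: "(\<nu> \<bullet> h) * (\<nu> \<bullet> h) = (e \<bullet> h)\<^sup>2" using e_nu by (auto simp: power2_eq_square)
  have seg: "a + s *\<^sub>R h \<in> C" if "0 < s" "s < 1" for s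
  proof -
    have "x \<in> interior C" using x C(1) by (simp add: interior_open)
    have "a + s *\<^sub>R h \<in> interior C"
    proof (cases "a = x")
      case True
      then show ?thesis using \<open>x \<in> interior C\<close> by (simp add: h_def)
    next
      case False
      then have "a + s *\<^sub>R h \<in> open_segment x a"
        using that by (auto simp: open_segment_commute[of x a] in_segment h_def algebra_simps intro!: exI[of _ s])
      then show ?thesis
        using in_interior_closure_convex_segment[OF C(2) \<open>x \<in> interior C\<close> a] by blast
    qed
    then show ?thesis using interior_subset by blast
  qed
  have segc: "a + s *\<^sub>R h \<in> closure C" if "s \<in> {0..1}" for s
    using seg[of s] a x closure_subset[of C] that by (cases "s = 0"; cases "s = 1") (auto simp: h_def)
  have lin: "((\<lambda>s. \<tau> + s * (e \<bullet> h)) has_real_derivative (e \<bullet> h)) (at s)" for s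
    by (auto intro!: derivative_eq_intros)
  have D3: "((\<lambda>s. g (\<tau> + s * (e \<bullet> h))) has_real_derivative (e \<bullet> h) * g' (\<tau> + s * (e \<bullet> h))) (at s)" for s
    using DERIV_chain2[OF g lin, of s] by (simp only: mult.commute[of "g' _"])
  have D4: "((\<lambda>s. (e \<bullet> h) * g' (\<tau> + s * (e \<bullet> h))) has_real_derivative (- (e \<bullet> h)\<^sup>2) * f (g (\<tau> + s * (e \<bullet> h)))) (at s)" for s
    using DERIV_cmult[OF DERIV_chain2[OF g' lin], of "e \<bullet> h" s] by (simp add: power2_eq_square mult_ac)
  have "u (a + 1 *\<^sub>R h) = g (\<tau> + 1 * (e \<bullet> h))"
  proof (rule second_order_ode_unique[OF L, where ?y1.0 = "\<lambda>s. u (a + s *\<^sub>R h)" and ?z1.0 = "\<lambda>s. h \<bullet> G (a + s *\<^sub>R h)"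
        and ?y2.0 = "\<lambda>s. g (\<tau> + s * (e \<bullet> h))" and ?z2.0 = "\<lambda>s. (e \<bullet> h) * g' (\<tau> + s * (e \<bullet> h))" and c = "- (e \<bullet> h)\<^sup>2"])
    have c: "continuous_on {0..1} (\<lambda>s. a + s *\<^sub>R h)" by (intro continuous_intros)
    show "continuous_on {0..1} (\<lambda>s. u (a + s *\<^sub>R h))"
      by (rule continuous_on_compose2[OF uc c]) (use segc in auto)
    have "continuous_on {0..1} (\<lambda>s. G (a + s *\<^sub>R h))"
      by (rule continuous_on_compose2[OF G(1) c]) (use segc in auto)
    then show "continuous_on {0..1} (\<lambda>s. h \<bullet> G (a + s *\<^sub>R h))" by (intro continuous_intros)
    show "continuous_on {0..1} (\<lambda>s. g (\<tau> + s * (e \<bullet> h)))"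
      using D3 DERIV_isCont by (blast intro: continuous_at_imp_continuous_on)
    show "continuous_on {0..1} (\<lambda>s. (e \<bullet> h) * g' (\<tau> + s * (e \<bullet> h)))"
      using D4 DERIV_isCont by (blast intro: continuous_at_imp_continuous_on)
    fix s :: real assume s: "0 < s" "s < 1"
    have inC: "a + s *\<^sub>R h \<in> C" by (rule seg[OF s])
    then have inO: "a + s *\<^sub>R h \<in> \<Omega>" using C by blast
    show "((\<lambda>s. u (a + s *\<^sub>R h)) has_real_derivative h \<bullet> G (a + s *\<^sub>R h)) (at s)"
      using line_has_derivative[OF twice_diff_onD(1)[OF u2 inO]] G(2)[OF inC] by simp
    have "((\<lambda>s. h \<bullet> gradient u (a + s *\<^sub>R h)) has_real_derivative (- (e \<bullet> h)\<^sup>2) * f (u (a + s *\<^sub>R h))) (at s)"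
    proof -
      have l: "((\<lambda>s. a + s *\<^sub>R h) has_derivative (\<lambda>t. t *\<^sub>R h)) (at s)"
        by (auto intro!: derivative_eq_intros)
      have "((\<lambda>s. h \<bullet> gradient u (a + s *\<^sub>R h)) has_derivative (\<lambda>t. h \<bullet> hessian u (a + s *\<^sub>R h) (t *\<^sub>R h))) (at s)"
        by (intro has_derivative_inner_right has_derivative_compose[OF l has_derivative_hessian[OF u2 inO]])
      moreover have "h \<bullet> hessian u (a + s *\<^sub>R h) (t *\<^sub>R h) = ((- (e \<bullet> h)\<^sup>2) * f (u (a + s *\<^sub>R h))) * t" for t
        unfolding hess[OF inC] eh[symmetric] by (simp add: inner_commute[of h])
      ultimately show ?thesis by (simp only: has_field_derivative_def)
    qed
    then show "((\<lambda>s. h \<bullet> G (a + s *\<^sub>R h)) has_real_derivative (- (e \<bullet> h)\<^sup>2) * f (u (a + s *\<^sub>R h))) (at s)"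
    proof (rule has_field_derivative_transform_within_open[where S = "{0<..<1}"])
      show "h \<bullet> gradient u (a + t *\<^sub>R h) = h \<bullet> G (a + t *\<^sub>R h)" if "t \<in> {0<..<1}" for t
        using G(2)[OF seg[of t]] that by simp
    qed (use s in auto)
    show "((\<lambda>s. g (\<tau> + s * (e \<bullet> h))) has_real_derivative (e \<bullet> h) * g' (\<tau> + s * (e \<bullet> h))) (at s)" by (rule D3)
    show "((\<lambda>s. (e \<bullet> h) * g' (\<tau> + s * (e \<bullet> h))) has_real_derivative (- (e \<bullet> h)\<^sup>2) * f (g (\<tau> + s * (e \<bullet> h)))) (at s)" by (rule D4)
  qed (use ua Ga in \<open>simp_all add: inner_commute\<close>)
  then show ?thesis by (simp add: h_def)
qed

text \<open>Beyond a critical hyperplane the bound on \<open>P\<close> limits the speed of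
  \<open>u\<close> along lines in direction \<open>e\<close>, so the comparison at the turning point
  gives u \<ge> v for the planar solution v. Both solve the same equation and agree at
  \<open>x0\<close>; by the Lipschitz bound the strong maximum principle applies to u - v.\<close>

lemma fold_continuation_pos:
  fixes u :: "'a::euclidean_space \<Rightarrow> real"
  assumes d: "d > 0" and u2: "twice_diff_on u (ball x0 d)" and F: "\<And>t. (F has_real_derivative f t) (at t)"
    and eq: "\<And>x. x \<in> ball x0 d \<Longrightarrow> laplacian u x = - f (u x)" and L: "L-lipschitz_on UNIV f"
    and g: "\<And>t. (g has_real_derivative g' t) (at t)" and g': "\<And>t. (g' has_real_derivative - f (g t)) (at t)"
    and turn: "g' \<tau> = 0" "f (g \<tau>) > 0" and e: "norm e = 1"
    and P: "\<And>x. x \<in> ball x0 d \<Longrightarrow> P_function F u x \<le> 2 * F (g \<tau>)"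
    and lower: "\<And>x. x \<in> ball x0 d \<Longrightarrow> e \<bullet> (x - x0) \<le> 0 \<Longrightarrow> u x = g (\<tau> + e \<bullet> (x - x0))"
  shows "\<exists>d'>0. \<forall>x\<in>ball x0 d'. u x = g (\<tau> + e \<bullet> (x - x0))"
proof -
  have ee: "e \<bullet> e = 1" using e by (simp add: norm_eq_1)
  have L0: "L \<ge> 0" using L lipschitz_on_nonneg by blast
  have fc: "continuous_on UNIV f" using L by (rule lipschitz_on_continuous_on)
  obtain d1 where d1: "d1 > 0" "\<And>\<sigma> y y'. 0 < \<sigma> \<Longrightarrow> \<sigma> < d1 \<Longrightarrow> continuous_on {0..\<sigma>} y \<Longrightarrow> y 0 = g \<tau> \<Longrightarrow>
     (\<forall>s. 0 < s \<longrightarrow> s < \<sigma> \<longrightarrow> (y has_real_derivative y' s) (at s) \<and> (y' s)\<^sup>2 \<le> 2 * F (g \<tau>) - 2 * F (y s)) \<Longrightarrow>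
     g (\<tau> + \<sigma>) \<le> y \<sigma>"
    using turning_point_comparison[OF F fc g g' turn] by blast
  define r where "r = min (min d d1) 1"
  have r: "r > 0" "r \<le> d" "r \<le> d1" "r \<le> 1" using d d1(1) by (auto simp: r_def)
  have sub: "ball x0 r \<subseteq> ball x0 d" using r by auto
  let ?v = "\<lambda>x. g (\<tau> + e \<bullet> (x - x0))"
  have ge: "?v x \<le> u x" if x: "x \<in> ball x0 r" for x
  proof (cases "e \<bullet> (x - x0) \<le> 0")
    case True
    then show ?thesis using lower[of x] x sub by fastforce
  next
    case False
    define \<sigma> where "\<sigma> = e \<bullet> (x - x0)"
    define z where "z = x - \<sigma> *\<^sub>R e"
    have s0: "\<sigma> > 0" using False by (simp add: \<sigma>_def)
    have xr: "norm (x - x0) < r" using x by (simp add: dist_norm norm_minus_commute)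
    have sx: "\<sigma> < d1" using norm_cauchy_schwarz[of e "x - x0"] e xr r by (simp add: \<sigma>_def)
    have ez: "e \<bullet> (z - x0) = 0" by (simp add: z_def inner_diff_right ee \<sigma>_def)
    \<comment> \<open>The foot \<open>z\<close> lies in the hyperplane through \<open>x0\<close>, so
      by Pythagoras the segment from \<open>z\<close> to \<open>x\<close> is nowhere farther from
      \<open>x0\<close> than \<open>x\<close> is.\<close>
    have inb: "z + s *\<^sub>R e \<in> ball x0 d" if "0 \<le> s" "s \<le> \<sigma>" for s
    proof -
      have "(norm (z - x0 + s *\<^sub>R e))\<^sup>2 = (norm (z - x0))\<^sup>2 + s\<^sup>2" for s
        using ez ee unfolding power2_norm_eq_inner
        by (simp add: inner_add_left inner_add_right inner_commute[of "z - x0" e] power2_eq_square)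
      moreover have "s\<^sup>2 \<le> \<sigma>\<^sup>2" using that by (intro power_mono) auto
      ultimately have "(norm (z - x0 + s *\<^sub>R e))\<^sup>2 \<le> (norm (z - x0 + \<sigma> *\<^sub>R e))\<^sup>2" by simp
      then have "norm (z - x0 + s *\<^sub>R e) \<le> norm (z - x0 + \<sigma> *\<^sub>R e)" by (rule power2_le_imp_le) simp
      also have "z - x0 + \<sigma> *\<^sub>R e = x - x0" by (simp add: z_def)
      finally show ?thesis using xr r by (simp add: dist_norm norm_minus_commute algebra_simps)
    qed
    have der: "((\<lambda>s. u (z + s *\<^sub>R e)) has_real_derivative (e \<bullet> gradient u (z + s *\<^sub>R e))) (at s)"
      if "0 \<le> s" "s \<le> \<sigma>" for s
      by (rule line_has_derivative[OF twice_diff_onD(1)[OF u2 inb[OF that]]])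
    have "g (\<tau> + \<sigma>) \<le> u (z + \<sigma> *\<^sub>R e)"
    proof (rule d1(2)[where y = "\<lambda>s. u (z + s *\<^sub>R e)" and y' = "\<lambda>s. e \<bullet> gradient u (z + s *\<^sub>R e)", OF s0 sx])
      show "continuous_on {0..\<sigma>} (\<lambda>s. u (z + s *\<^sub>R e))"
        using der DERIV_isCont by (intro continuous_at_imp_continuous_on) fastforce
      show "u (z + 0 *\<^sub>R e) = g \<tau>" using lower[of z] inb[of 0] s0 ez by simp
      show "\<forall>s. 0 < s \<longrightarrow> s < \<sigma> \<longrightarrow> ((\<lambda>s. u (z + s *\<^sub>R e)) has_real_derivative (e \<bullet> gradient u (z + s *\<^sub>R e))) (at s) \<and>
         (e \<bullet> gradient u (z + s *\<^sub>R e))\<^sup>2 \<le> 2 * F (g \<tau>) - 2 * F (u (z + s *\<^sub>R e))"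
      proof (intro allI impI conjI)
        fix s assume s: "0 < s" "s < \<sigma>"
        show "((\<lambda>s. u (z + s *\<^sub>R e)) has_real_derivative (e \<bullet> gradient u (z + s *\<^sub>R e))) (at s)" using der s by simp
        have "\<bar>e \<bullet> gradient u (z + s *\<^sub>R e)\<bar> \<le> norm (gradient u (z + s *\<^sub>R e))"
          using Cauchy_Schwarz_ineq2[of e "gradient u (z + s *\<^sub>R e)"] e by simp
        then have "(e \<bullet> gradient u (z + s *\<^sub>R e))\<^sup>2 \<le> (norm (gradient u (z + s *\<^sub>R e)))\<^sup>2"
          by (metis abs_ge_zero power2_abs power_mono)
        then show "(e \<bullet> gradient u (z + s *\<^sub>R e))\<^sup>2 \<le> 2 * F (g \<tau>) - 2 * F (u (z + s *\<^sub>R e))"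
          using P[OF inb[of s]] s by (simp add: P_function_def)
      qed
    qed
    then show ?thesis by (simp add: z_def \<sigma>_def)
  qed
  note pl = planar_function[OF g g' e, where ?t0.0 = \<tau> and p = x0]
  have v2: "twice_diff_on ?v (ball x0 r)" by (rule twice_diff_on_subset[OF pl(1)]) simp
  have ur2: "twice_diff_on u (ball x0 r)" by (rule twice_diff_on_subset[OF u2 sub])
  let ?w = "\<lambda>x. 1 * u x + (- 1) * ?v x"
  note w = twice_diff_lincomb[OF open_ball ur2 v2, where a = 1 and c = "- 1"]
  have "?w x = 0" if x: "x \<in> ball x0 (r / 2)" for x
  proof (rule strong_max_principle_ball[OF r(1) L0 w(1) _ _ _ r(4)])
    show "0 \<le> ?w x" if "x \<in> ball x0 r" for x using ge[OF that] by simp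
    show "laplacian ?w x \<le> L * (norm (gradient ?w x) + ?w x)" if x: "x \<in> ball x0 r" for x
    proof -
      have "laplacian ?w x = - f (u x) + f (?v x)"
        using w(2)[OF x] eq[of x] pl(2)[of x] x sub by (simp add: subset_iff)
      also have "\<dots> \<le> L * \<bar>u x - ?v x\<bar>"
        using lipschitz_onD[OF L, of "u x" "?v x"] by (simp add: dist_real_def)
      also have "\<dots> = L * ?w x" using ge[OF x] by simp
      also have "\<dots> \<le> L * (norm (gradient ?w x) + ?w x)" using L0 by (intro mult_left_mono) auto
      finally show ?thesis .
    qed
    show "?w x0 = 0" using lower[of x0] d by simp
    show "dist x0 x < r / 2" using x by simp
  qed
  then show ?thesis using r(1) by (intro exI[of _ "r / 2"]) auto
qed

lemma gradient_uminus: "u differentiable at x \<Longrightarrow> gradient (\<lambda>x. - u x) x = - gradient u x"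
  by (rule gradient_eqI) (auto intro!: derivative_eq_intros dest: has_derivative_gradient)

text \<open>A negative value of \<open>f\<close> at the turning point is reduced to a positive one
  by the symmetry u, f t, F t to - u, - f (- t), F (- t), which leaves the P-function
  unchanged.\<close>

lemma fold_continuation:
  fixes u :: "'a::euclidean_space \<Rightarrow> real"
  assumes d: "d > 0" and u2: "twice_diff_on u (ball x0 d)" and F: "\<And>t. (F has_real_derivative f t) (at t)"
    and eq: "\<And>x. x \<in> ball x0 d \<Longrightarrow> laplacian u x = - f (u x)" and L: "L-lipschitz_on UNIV f"
    and g: "\<And>t. (g has_real_derivative g' t) (at t)" and g': "\<And>t. (g' has_real_derivative - f (g t)) (at t)"
    and turn: "g' \<tau> = 0" "f (g \<tau>) \<noteq> 0" and e: "norm e = 1"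
    and P: "\<And>x. x \<in> ball x0 d \<Longrightarrow> P_function F u x \<le> 2 * F (g \<tau>)"
    and lower: "\<And>x. x \<in> ball x0 d \<Longrightarrow> e \<bullet> (x - x0) \<le> 0 \<Longrightarrow> u x = g (\<tau> + e \<bullet> (x - x0))"
  shows "\<exists>d'>0. \<forall>x\<in>ball x0 d'. u x = g (\<tau> + e \<bullet> (x - x0))"
proof (cases "f (g \<tau>) > 0")
  case True
  show ?thesis by (rule fold_continuation_pos[OF d u2 F eq L g g' turn(1) True e P lower])
next
  case False
  let ?u = "\<lambda>x. - u x" and ?f = "\<lambda>t. - f (- t)" and ?F = "\<lambda>t. F (- t)"
  have lc: "twice_diff_on ?u (ball x0 d)" "\<And>x. x \<in> ball x0 d \<Longrightarrow> laplacian ?u x = - laplacian u x"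
    using twice_diff_lincomb[OF open_ball u2 u2, where a = "- 1" and c = 0] by simp_all
  have "\<exists>d'>0. \<forall>x\<in>ball x0 d'. ?u x = (\<lambda>t. - g t) (\<tau> + e \<bullet> (x - x0))"
  proof (rule fold_continuation_pos[OF d lc(1), where F = ?F and f = ?f and L = L and g' = "\<lambda>t. - g' t"])
    show "(?F has_real_derivative ?f t) (at t)" for t
      using F[of "- t"] DERIV_mirror[of F "f (- t)" t] by simp
    show "laplacian ?u x = - ?f (?u x)" if "x \<in> ball x0 d" for x
      using lc(2)[OF that] eq[OF that] by simp
    show "L-lipschitz_on UNIV ?f"
    proof (rule lipschitz_onI)
      show "dist (?f x) (?f y) \<le> L * dist x y" for x y
        using lipschitz_onD[OF L, of "- x" "- y"] by (simp add: dist_real_def abs_minus_commute)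
      show "0 \<le> L" using L lipschitz_on_nonneg by blast
    qed
    show "((\<lambda>t. - g t) has_real_derivative - g' t) (at t)" for t by (intro derivative_intros g)
    show "((\<lambda>t. - g' t) has_real_derivative - ?f (- g t)) (at t)" for t
      using DERIV_minus[OF g'[of t]] by simp
    show "P_function ?F ?u x \<le> 2 * ?F (- g \<tau>)" if "x \<in> ball x0 d" for x
      using P[OF that] gradient_uminus[OF twice_diff_onD(1)[OF u2 that]] by (simp add: P_function_def)
    show "?u x = - g (\<tau> + e \<bullet> (x - x0))" if "x \<in> ball x0 d" "e \<bullet> (x - x0) \<le> 0" for x
      using lower[OF that] by simp
  qed (use turn False e in auto)
  then show ?thesis by simp
qed

text \<open>The interior of the coincidence set is shown to be closed in \<Omega>. At a regular
  limit point \<open>Q\<close> vanishes, hence near it by the strong maximum principle, and rigidity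
  applies; at a critical limit point one full half ball already belongs to the set and the solution
  is folded across the hyperplane.\<close>

lemma planar_continuation:
  fixes \<Omega> :: "'a::euclidean_space set"
  assumes \<Omega>: "open \<Omega>" "connected \<Omega>" and u: "Ck_on 3 u \<Omega>" and F: "\<And>t. (F has_real_derivative f t) (at t)"
    and eq: "\<And>x. x \<in> \<Omega> \<Longrightarrow> laplacian u x + f (u x) = 0" and L: "L-lipschitz_on UNIV f"
    and g: "\<And>t. (g has_real_derivative g' t) (at t)" and g': "\<And>t. (g' has_real_derivative - f (g t)) (at t)"
    and g'0: "g' 0 \<noteq> 0" and e: "norm e = 1"
    and P: "\<And>x. x \<in> \<Omega> \<Longrightarrow> P_function F u x \<le> (g' 0)\<^sup>2 + 2 * F (g 0)"
    and B: "open B" "B \<noteq> {}" "B \<subseteq> \<Omega>" "\<And>x. x \<in> B \<Longrightarrow> u x = g (e \<bullet> (x - p))" and x: "x \<in> \<Omega>"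
  shows "u x = g (e \<bullet> (x - p))"
proof -
  have u2: "twice_diff_on u \<Omega>" using u by (simp add: numeral_3_eq_3 twice_diff_on_def)
  let ?v = "\<lambda>x. g (e \<bullet> (x - p))"
  note pl = planar_function[OF g g' e, where ?t0.0 = 0 and p = p, simplified]
  \<comment> \<open>On the interior the gradients agree as well, so both value and gradient of the
    planar solution pass to limit points in \<Omega> by continuity.\<close>
  define E where "E = interior {x \<in> \<Omega>. u x = ?v x}"
  have Eo: "open E" "E \<subseteq> {x \<in> \<Omega>. u x = ?v x}" unfolding E_def by (rule open_interior, rule interior_subset)
  have EI: "x0 \<in> E" if x0: "x0 \<in> \<Omega>" and "d > 0" "\<And>x. x \<in> ball x0 d \<Longrightarrow> u x = ?v x" for x0 d
  proof -
    obtain d' where d': "d' > 0" "ball x0 d' \<subseteq> \<Omega>" using \<Omega>(1) x0 open_contains_ball by blast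
    then have "ball x0 (min d d') \<subseteq> {x \<in> \<Omega>. u x = ?v x}"
      using that(3) by (auto simp: subset_iff)
    then have "ball x0 (min d d') \<subseteq> E" unfolding E_def by (rule interior_maximal) (rule open_ball)
    moreover have "x0 \<in> ball x0 (min d d')" using that(2) d'(1) by simp
    ultimately show ?thesis by blast
  qed
  have energy: "(g' t)\<^sup>2 + 2 * F (g t) = (g' 0)\<^sup>2 + 2 * F (g 0)" for t by (rule ode_energy[OF g g' F])
  let ?Pm = "(g' 0)\<^sup>2 + 2 * F (g 0)"
  have uco: "continuous_on \<Omega> u" using twice_diff_onD(3)[OF u2] by (blast intro: continuous_at_imp_continuous_on)
  have guco: "continuous_on \<Omega> (gradient u)"
    using has_derivative_hessian[OF u2] has_derivative_continuous by (blast intro: continuous_at_imp_continuous_on)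
  have vc: "continuous_on UNIV ?v" using twice_diff_onD(3)[OF pl(1)] by (blast intro: continuous_at_imp_continuous_on)
  have gvc: "continuous_on UNIV (\<lambda>x. g' (e \<bullet> (x - p)) *\<^sub>R e)"
  proof -
    have "continuous_on UNIV g'" using g' DERIV_isCont by (blast intro: continuous_at_imp_continuous_on)
    then have "continuous_on UNIV (\<lambda>x. g' (e \<bullet> (x - p)))"
      by (rule continuous_on_compose2) (auto intro!: continuous_intros)
    then show ?thesis by (rule continuous_on_scaleR[OF _ continuous_on_const])
  qed
  have data: "u x0 = ?v x0 \<and> gradient u x0 = g' (e \<bullet> (x0 - p)) *\<^sub>R e" if x0: "x0 \<in> \<Omega>" "x0 \<in> closure E" for x0
  proof -
    have gE: "gradient u y = g' (e \<bullet> (y - p)) *\<^sub>R e" if "y \<in> E" for y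
      using gradient_cong_open[OF Eo(1) that, of u ?v] Eo(2) pl(3)[of y] by auto
    obtain s where s: "\<And>n. s n \<in> E" "s \<longlonglongrightarrow> x0" using x0(2) unfolding closure_sequential by blast
    have sO: "\<And>n. s n \<in> \<Omega>" using s(1) Eo(2) by blast
    have lim: "(\<lambda>n. h (s n)) \<longlonglongrightarrow> h x0" if "continuous_on \<Omega> h" for h :: "'a \<Rightarrow> 'b::topological_space"
      by (rule continuous_on_tendsto_compose[OF that s(2) x0(1)]) (use sO in auto)
    have "(\<lambda>n. u (s n)) = (\<lambda>n. ?v (s n))" using s(1) Eo(2) by auto
    then have "u x0 = ?v x0"
      using LIMSEQ_unique[OF lim[OF uco]] lim[OF continuous_on_subset[OF vc subset_UNIV]] by simp
    moreover have "(\<lambda>n. gradient u (s n)) = (\<lambda>n. g' (e \<bullet> (s n - p)) *\<^sub>R e)" using gE s(1) by auto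
    then have "gradient u x0 = g' (e \<bullet> (x0 - p)) *\<^sub>R e"
      using LIMSEQ_unique[OF lim[OF guco]] lim[OF continuous_on_subset[OF gvc subset_UNIV]] by simp
    ultimately show ?thesis by blast
  qed
  have regular: "x0 \<in> E" if x0: "x0 \<in> \<Omega>" "x0 \<in> closure E" and ne: "g' (e \<bullet> (x0 - p)) \<noteq> 0" for x0
  proof -
    let ?\<tau> = "e \<bullet> (x0 - p)"
    have dat: "u x0 = g ?\<tau>" "gradient u x0 = g' ?\<tau> *\<^sub>R e" using data[OF x0] by auto
    let ?G = "gradient u"
    have "isCont ?G x0" using has_derivative_continuous[OF has_derivative_hessian[OF u2 x0(1)]] .
    moreover have gpos: "norm (?G x0) > 0" using dat ne e by simp
    ultimately obtain d1 where d1: "d1 > 0" "\<And>x. dist x x0 < d1 \<Longrightarrow> dist (?G x) (?G x0) < norm (?G x0) / 2"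
      unfolding continuous_at_eps_delta by (meson half_gt_zero)
    obtain M where M: "M > 0" "\<exists>d>0. \<forall>x. dist x x0 < d \<longrightarrow> \<bar>f (u x)\<bar> \<le> M"
    proof -
      have "isCont (\<lambda>x. f (u x)) x0"
        using continuous_on_compose2[OF lipschitz_on_continuous_on[OF L] uco] \<Omega>(1) x0(1)
        by (simp add: continuous_on_eq_continuous_at)
      then obtain d where d: "d > 0" "\<And>x. dist x x0 < d \<Longrightarrow> \<bar>f (u x) - f (u x0)\<bar> < 1"
        unfolding continuous_at_eps_delta dist_real_def by (meson zero_less_one)
      have "\<bar>f (u x)\<bar> \<le> \<bar>f (u x0)\<bar> + 1" if "dist x x0 < d" for x using d(2)[OF that] by linarith
      then show ?thesis using that[of "\<bar>f (u x0)\<bar> + 1"] d(1) by force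
    qed
    then obtain d2 where d2: "d2 > 0" "\<And>x. dist x x0 < d2 \<Longrightarrow> \<bar>f (u x)\<bar> \<le> M" by blast
    obtain d3 where d3: "d3 > 0" "ball x0 d3 \<subseteq> \<Omega>" using \<Omega>(1) x0(1) open_contains_ball by blast
    define d where "d = min (min d1 d2) (min d3 1)"
    have d: "d > 0" "d \<le> d1" "d \<le> d2" "d \<le> d3" "d \<le> 1" using d1(1) d2(1) d3(1) by (auto simp: d_def)
    have sub: "ball x0 d \<subseteq> \<Omega>" using d d3 by (auto simp: subset_iff)
    let ?Q = "\<lambda>x. ?Pm - P_function F u x"
    note Q = P_function_deficit[OF \<Omega>(1) u F eq, where E = ?Pm]
    have gl: "norm (?G x0) / 2 \<le> norm (?G x)" if "x \<in> ball x0 d" for x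
    proof -
      have "dist (?G x) (?G x0) < norm (?G x0) / 2" using d1(2)[of x] that d by (simp add: dist_commute)
      then show ?thesis using norm_triangle_ineq2[of "?G x0" "?G x"] by (simp add: dist_norm norm_minus_commute)
    qed
    have Q0: "?Q x = 0" if x: "x \<in> ball x0 (d / 2)" for x
    proof (rule strong_max_principle_ball[OF d(1), of "4 * M / norm (?G x0)" ?Q])
      show "0 \<le> 4 * M / norm (?G x0)" using M(1) by simp
      show "twice_diff_on ?Q (ball x0 d)" by (rule twice_diff_on_subset[OF Q(1) sub]) (auto simp: eq)
      show "0 \<le> ?Q x" if "x \<in> ball x0 d" for x using P[of x] that sub by auto
      show "laplacian ?Q x \<le> 4 * M / norm (?G x0) * (norm (gradient ?Q x) + ?Q x)" if x: "x \<in> ball x0 d" for x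
      proof -
        have xO: "x \<in> \<Omega>" using x sub by blast
        have gx: "norm (?G x) > 0" using gl[OF x] gpos by linarith
        have "laplacian ?Q x \<le> 2 * \<bar>f (u x)\<bar> / norm (?G x) * norm (gradient ?Q x)"
          by (rule Q(4)) (use eq xO gx in auto)
        also have "\<dots> \<le> 2 * M / (norm (?G x0) / 2) * norm (gradient ?Q x)"
          using d2(2)[of x] x d gl[OF x] gpos M(1)
          by (intro mult_right_mono frac_le) (auto simp: dist_commute)
        also have "\<dots> \<le> 4 * M / norm (?G x0) * (norm (gradient ?Q x) + ?Q x)"
          using P[OF xO] M(1) gpos by (simp add: mult_left_mono divide_right_mono)
        finally show ?thesis .
      qed
      show "?Q x0 = 0" using energy[of ?\<tau>] dat e by (simp add: P_function_def)
      show "d \<le> 1" by fact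
      show "dist x0 x < d / 2" using x by simp
    qed
    define r where "r = d / 4"
    have r: "r > 0" "cball x0 r \<subseteq> ball x0 (d / 2)" "cball x0 r \<subseteq> \<Omega>" "ball x0 r \<subseteq> ball x0 (d / 2)" "ball x0 r \<subseteq> \<Omega>"
      "ball x0 r \<subseteq> ball x0 d"
      using d sub by (auto simp: r_def subset_iff)
    have "u x = g (?\<tau> + e \<bullet> (x - x0))" if x: "x \<in> ball x0 r" for x
    proof (rule solution_planar_near_regular_point[OF \<Omega>(1) u F eq L open_ball convex_ball r(5), where E = ?Pm and G = ?G])
      show "P_function F u x = ?Pm" if "x \<in> ball x0 r" for x using Q0[of x] that r by auto
      show "?G x \<noteq> 0" if "x \<in> ball x0 r" for x using gl[of x] that r gpos by auto
      show "x0 \<in> closure (ball x0 r)" using r(1) closure_subset[of "ball x0 r"] by auto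
      show "continuous_on (closure (ball x0 r)) u" "continuous_on (closure (ball x0 r)) ?G"
        using continuous_on_subset[OF uco r(3)] continuous_on_subset[OF guco r(3)] r(1) by auto
    qed (use g g' e dat ne x in auto)
    then have "u x = ?v x" if "x \<in> ball x0 r" for x using that by (simp add: inner_diff_right)
    then show ?thesis using EI[OF x0(1) r(1)] by blast
  qed
  \<comment> \<open>\<epsilon> records from which side of the hyperplane \<open>E\<close>
    accumulates at \<open>x0\<close>. As \<open>f (g ?\<tau>)\<close> is nonzero, critical levels
    are isolated: the half ball \<open>S\<close> on that side is free of critical levels of the
    profile, and connectedness spreads \<open>E\<close> over all of it.\<close>
  have side: "x0 \<in> E" if x0: "x0 \<in> \<Omega>" "x0 \<in> closure E" and t0: "g' (e \<bullet> (x0 - p)) = 0"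
    and a: "\<And>d. d > 0 \<Longrightarrow> \<exists>a\<in>E \<inter> ball x0 d. \<epsilon> * (e \<bullet> (a - x0)) < 0" and \<epsilon>: "\<epsilon> = 1 \<or> \<epsilon> = - 1" for x0 and \<epsilon> :: real
  proof -
    let ?\<tau> = "e \<bullet> (x0 - p)"
    have f0: "f (g ?\<tau>) \<noteq> 0" by (rule ode_turning_point[OF L g g' g'0 t0])
    have "\<exists>d1>0. \<forall>t. t \<noteq> ?\<tau> \<and> \<bar>t - ?\<tau>\<bar> < d1 \<longrightarrow> g' t \<noteq> 0"
    proof (cases "f (g ?\<tau>) > 0")
      case True
      then have "- f (g ?\<tau>) < 0" by simp
      from DERIV_neg_dec_right[OF g' this] DERIV_neg_dec_left[OF g' this] obtain r1 r2 where
        r: "r1 > 0" "\<And>h. 0 < h \<Longrightarrow> h < r1 \<Longrightarrow> g' (?\<tau> + h) < 0" "r2 > 0" "\<And>h. 0 < h \<Longrightarrow> h < r2 \<Longrightarrow> g' (?\<tau> - h) > 0"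
        using t0 by auto
      show ?thesis
      proof (intro exI[of _ "min r1 r2"] conjI allI impI)
        fix t assume "t \<noteq> ?\<tau> \<and> \<bar>t - ?\<tau>\<bar> < min r1 r2"
        then show "g' t \<noteq> 0" using r(2)[of "t - ?\<tau>"] r(4)[of "?\<tau> - t"] by (cases "t > ?\<tau>") auto
      qed (use r in auto)
    next
      case False
      then have "- f (g ?\<tau>) > 0" using f0 by simp
      from DERIV_pos_inc_right[OF g' this] DERIV_pos_inc_left[OF g' this] obtain r1 r2 where
        r: "r1 > 0" "\<And>h. 0 < h \<Longrightarrow> h < r1 \<Longrightarrow> g' (?\<tau> + h) > 0" "r2 > 0" "\<And>h. 0 < h \<Longrightarrow> h < r2 \<Longrightarrow> g' (?\<tau> - h) < 0"
        using t0 by auto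
      show ?thesis
      proof (intro exI[of _ "min r1 r2"] conjI allI impI)
        fix t assume "t \<noteq> ?\<tau> \<and> \<bar>t - ?\<tau>\<bar> < min r1 r2"
        then show "g' t \<noteq> 0" using r(2)[of "t - ?\<tau>"] r(4)[of "?\<tau> - t"] by (cases "t > ?\<tau>") auto
      qed (use r in auto)
    qed
    then obtain d1 where d1: "d1 > 0" "\<And>t. t \<noteq> ?\<tau> \<Longrightarrow> \<bar>t - ?\<tau>\<bar> < d1 \<Longrightarrow> g' t \<noteq> 0" by blast
    obtain d3 where d3: "d3 > 0" "ball x0 d3 \<subseteq> \<Omega>" using \<Omega>(1) x0(1) open_contains_ball by blast
    define d where "d = min d1 d3"
    have d: "d > 0" "d \<le> d1" "ball x0 d \<subseteq> \<Omega>" using d1(1) d3 by (auto simp: d_def subset_iff)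
    define S where "S = ball x0 d \<inter> {x. (\<epsilon> *\<^sub>R e) \<bullet> x < (\<epsilon> *\<^sub>R e) \<bullet> x0}"
    have Siff: "x \<in> S \<longleftrightarrow> x \<in> ball x0 d \<and> \<epsilon> * (e \<bullet> (x - x0)) < 0" for x
      by (auto simp: S_def inner_diff_right right_diff_distrib)
    have "convex S" unfolding S_def by (intro convex_Int convex_ball convex_halfspace_lt)
    then have connS: "connected S" by (rule convex_connected)
    have reg: "x \<in> E" if "x \<in> S" "x \<in> closure E" for x
    proof (rule regular)
      have ne: "e \<bullet> (x - x0) \<noteq> 0" using that(1) Siff[of x] by auto
      have "\<bar>e \<bullet> (x - x0)\<bar> < d1"
        using Cauchy_Schwarz_ineq2[of e "x - x0"] that(1) Siff[of x] e d by (simp add: dist_norm norm_minus_commute)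
      then show "g' (e \<bullet> (x - p)) \<noteq> 0" using d1(2)[of "e \<bullet> (x - p)"] ne by (simp add: inner_diff_right)
      show "x \<in> \<Omega>" using that(1) Siff[of x] d by blast
    qed (rule that(2))
    have "openin (top_of_set S) (S \<inter> E)" using Eo(1) by (simp add: openin_open_Int)
    moreover have "closedin (top_of_set S) (S \<inter> E)"
    proof -
      have "S \<inter> E = S \<inter> closure E" using reg closure_subset[of E] by blast
      then show ?thesis by (simp add: closedin_closed_Int)
    qed
    moreover have "S \<inter> E \<noteq> {}" using a[OF d(1)] Siff by blast
    ultimately have "S \<inter> E = S" using connS unfolding connected_clopen by blast
    then have SE: "S \<subseteq> E" by blast
    \<comment> \<open>The folding lemma starts from the side where the inner product is at most 0.
      Reversing both \<open>e\<close> and the time of the profile changes the side, but not the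
      planar function, since \<epsilon>^2 = 1.\<close>
    let ?e = "\<epsilon> *\<^sub>R e" and ?g = "\<lambda>t. g (?\<tau> + \<epsilon> * t)" and ?g' = "\<lambda>t. \<epsilon> * g' (?\<tau> + \<epsilon> * t)"
    have ep2: "\<epsilon> * \<epsilon> = 1" using \<epsilon> by auto
    have arg: "?\<tau> + \<epsilon> * (0 + ?e \<bullet> (x - x0)) = e \<bullet> (x - p)" for x
    proof -
      have "\<epsilon> * (?e \<bullet> (x - x0)) = e \<bullet> (x - x0)"
        by (simp only: inner_scaleR_left mult.assoc[symmetric] ep2 mult_1)
      then show ?thesis by (simp only: add_0) (simp add: inner_diff_right)
    qed
    have lower: "u x = ?g (0 + ?e \<bullet> (x - x0))" if x: "x \<in> ball x0 d" "?e \<bullet> (x - x0) \<le> 0" for x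
    proof -
      have vx: "?g (0 + ?e \<bullet> (x - x0)) = ?v x" unfolding arg ..
      have "u x = ?v x"
      proof (cases "?e \<bullet> (x - x0) < 0")
        case True
        then have "x \<in> S" using x Siff by simp
        then show ?thesis using SE Eo by blast
      next
        case False
        then have ez: "?e \<bullet> (x - x0) = 0" using x by simp
        have xO: "x \<in> \<Omega>" using x d by blast
        have "x \<in> closure E"
          unfolding closure_approachable
        proof (intro allI impI)
          fix r :: real assume r: "r > 0"
          define s where "s = min r (d - dist x0 x) / 2"
          have s: "s > 0" "s < r" "s < d - dist x0 x" using r x(1) by (auto simp: s_def min_def)
          have ds: "dist (x - s *\<^sub>R ?e) x = s" using s \<epsilon> e by (auto simp: dist_norm)
          have "dist x0 (x - s *\<^sub>R ?e) < d" using dist_triangle[of x0 "x - s *\<^sub>R ?e" x] ds s by (simp add: dist_commute)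
          moreover have "?e \<bullet> (x - s *\<^sub>R ?e - x0) < 0"
          proof -
            have "?e \<bullet> ?e = 1" using \<epsilon> e by (auto simp: norm_eq_1)
            then have "?e \<bullet> (x - s *\<^sub>R ?e - x0) = ?e \<bullet> (x - x0) - s"
              by (simp only: inner_diff_right inner_scaleR_right)
            then show ?thesis using ez s(1) by linarith
          qed
          ultimately have "x - s *\<^sub>R ?e \<in> S" using Siff[of "x - s *\<^sub>R ?e"] by simp
          then show "\<exists>y\<in>E. dist y x < r" using SE ds s(2) by (intro bexI[of _ "x - s *\<^sub>R ?e"]) auto
        qed
        then show ?thesis using data[OF xO] by blast
      qed
      then show ?thesis using vx by simp
    qed
    have "\<exists>d'>0. \<forall>x\<in>ball x0 d'. u x = ?g (0 + ?e \<bullet> (x - x0))"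
    proof (rule fold_continuation[OF d(1) twice_diff_on_subset[OF u2 d(3)] F _ L, where g' = ?g' and \<tau> = 0])
      have lin: "((\<lambda>t. ?\<tau> + \<epsilon> * t) has_real_derivative \<epsilon>) (at t)" for t by (auto intro!: derivative_eq_intros)
      show "laplacian u x = - f (u x)" if "x \<in> ball x0 d" for x using eq[of x] that d by auto
      show "(?g has_real_derivative ?g' t) (at t)" for t
        using DERIV_chain2[OF g lin, of t] by (simp only: mult.commute[of "g' _"])
      show "(?g' has_real_derivative - f (?g t)) (at t)" for t
        using DERIV_cmult[OF DERIV_chain2[OF g' lin], of \<epsilon> t] \<epsilon> by auto
      show "P_function F u x \<le> 2 * F (?g 0)" if "x \<in> ball x0 d" for x
        using P[of x] that d energy[of ?\<tau>] t0 by auto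
      show "norm ?e = 1" using \<epsilon> e by auto
    qed (use t0 f0 lower in auto)
    then obtain d' where d': "d' > 0" "\<And>x. x \<in> ball x0 d' \<Longrightarrow> u x = ?g (0 + ?e \<bullet> (x - x0))" by blast
    have "u x = ?v x" if "x \<in> ball x0 d'" for x
      using d'(2)[OF that] unfolding arg .
    then show ?thesis using EI[OF x0(1) d'(1)] by blast
  qed
  have clos: "x0 \<in> E" if x0: "x0 \<in> \<Omega>" "x0 \<in> closure E" for x0
  proof (cases "g' (e \<bullet> (x0 - p)) = 0")
    case False
    then show ?thesis using regular x0 by blast
  next
    case True
    \<comment> \<open>\<open>E\<close> is open, so a point of it lying in the hyperplane can be
      moved off along \<open>e\<close>; hence at least one side contains points of \<open>E\<close>
      arbitrarily close to \<open>x0\<close>.\<close>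
    have near: "\<exists>a\<in>E \<inter> ball x0 d. e \<bullet> (a - x0) \<noteq> 0" if d: "d > 0" for d
    proof -
      obtain y where y: "y \<in> E" "dist y x0 < d" using x0(2) d closure_approachable by blast
      have "open (E \<inter> ball x0 d)" using Eo(1) by blast
      moreover have "y \<in> E \<inter> ball x0 d" using y by (simp add: dist_commute)
      ultimately obtain r where r: "r > 0" "ball y r \<subseteq> E \<inter> ball x0 d" using open_contains_ball by blast
      let ?y = "y + (r / 2) *\<^sub>R e"
      have "?y \<in> ball y r" using r(1) e by (simp add: dist_norm)
      moreover have "e \<bullet> (?y - x0) = e \<bullet> (y - x0) + r / 2"
        using e by (simp add: inner_diff_right inner_add_right norm_eq_1)
      ultimately show ?thesis
        using r y \<open>y \<in> E \<inter> ball x0 d\<close> by (cases "e \<bullet> (y - x0) = 0") force+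
    qed
    show ?thesis
    proof (cases "\<forall>d>0. \<exists>a\<in>E \<inter> ball x0 d. e \<bullet> (a - x0) < 0")
      case True
      then show ?thesis using side[of x0 1] x0 \<open>g' _ = 0\<close> by simp
    next
      case False
      then obtain d0 where d0: "d0 > 0" "\<And>a. a \<in> E \<inter> ball x0 d0 \<Longrightarrow> \<not> e \<bullet> (a - x0) < 0" by blast
      have "\<exists>a\<in>E \<inter> ball x0 d. - 1 * (e \<bullet> (a - x0)) < 0" if d: "d > 0" for d
      proof -
        obtain a where a: "a \<in> E \<inter> ball x0 (min d d0)" "e \<bullet> (a - x0) \<noteq> 0"
          using near[of "min d d0"] d d0(1) by auto
        then have "\<not> e \<bullet> (a - x0) < 0" using d0(2)[of a] by auto
        then show ?thesis using a by (intro bexI[of _ a]) auto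
      qed
      then show ?thesis using side[of x0 "- 1"] x0 \<open>g' _ = 0\<close> by simp
    qed
  qed
  have "openin (top_of_set \<Omega>) (\<Omega> \<inter> E)" using Eo(1) by (simp add: openin_open_Int)
  moreover have "closedin (top_of_set \<Omega>) (\<Omega> \<inter> E)"
  proof -
    have "\<Omega> \<inter> E = \<Omega> \<inter> closure E" using clos closure_subset[of E] by blast
    then show ?thesis by (simp add: closedin_closed_Int)
  qed
  moreover have "\<Omega> \<inter> E \<noteq> {}"
  proof -
    have "B \<subseteq> E" unfolding E_def by (rule interior_maximal) (use B in auto)
    then show ?thesis using B by blast
  qed
  ultimately have "\<Omega> \<inter> E = \<Omega>" using \<Omega>(2) unfolding connected_clopen by blast
  then show ?thesis using x Eo(2) by blast
qed

subsection \<open>The overdetermined problem\<close>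

text \<open>Fixes the objects that the assumptions provide only as existing: \<open>G\<close> is the
  continuous extension of the gradient to the closure, \<open>L\<close> a Lipschitz constant, and
  \<open>g\<close> the one-dimensional solution.\<close>

locale overdetermined_solution =
  fixes \<Omega> :: "'a::euclidean_space set" and f F :: "real \<Rightarrow> real" and \<kappa> L :: real
    and u :: "'a \<Rightarrow> real" and G :: "'a \<Rightarrow> 'a" and g g' :: "real \<Rightarrow> real"
  assumes dim: "DIM('a) \<ge> 2"
    and domain: "regular_domain \<Omega>"
    and f_Lipschitz: "L-lipschitz_on UNIV f"
    and F: "\<And>t. (F has_real_derivative f t) (at t)"
    and kappa: "\<kappa> \<noteq> 0"
    and u_C3: "Ck_on 3 u \<Omega>"
    and u_cont: "continuous_on (closure \<Omega>) u"
    and G_cont: "continuous_on (closure \<Omega>) G"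
    and G_eq: "\<And>x. x \<in> \<Omega> \<Longrightarrow> G x = gradient u x"
    and u_bounded: "bounded (u ` \<Omega>)"
    and equation: "\<And>x. x \<in> \<Omega> \<Longrightarrow> laplacian u x + f (u x) = 0"
    and positive: "\<And>x. x \<in> \<Omega> \<Longrightarrow> u x > 0"
    and Dirichlet: "\<And>x. x \<in> frontier \<Omega> \<Longrightarrow> u x = 0"
    and Neumann: "\<And>x. x \<in> frontier \<Omega> \<Longrightarrow> normal_derivative \<Omega> u x = - \<kappa>"
    and P_bound: "\<And>x. x \<in> \<Omega> \<Longrightarrow> P_function F u x \<le> \<kappa>\<^sup>2 + 2 * F 0"
    and g: "\<And>t. (g has_real_derivative g' t) (at t)"
    and g': "\<And>t. (g' has_real_derivative - f (g t)) (at t)"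
    and g0: "g 0 = 0" and g'0: "g' 0 = \<kappa>"
begin

abbreviation "Pmax \<equiv> \<kappa>\<^sup>2 + 2 * F 0"
abbreviation "Q \<equiv> \<lambda>x. Pmax - P_function F u x"

lemma open_domain: "open \<Omega>" and connected_domain: "connected \<Omega>"
  using domain by (auto simp: regular_domain_def)

lemma u_twice: "twice_diff_on u \<Omega>"
  using u_C3 by (simp add: numeral_3_eq_3 twice_diff_on_def)

lemma L_nonneg: "0 \<le> L"
  using f_Lipschitz lipschitz_on_nonneg by blast

lemma F_cont: "continuous_on S F"
  using F DERIV_isCont by (blast intro: continuous_at_imp_continuous_on)

lemma f_cont: "continuous_on UNIV f"
  using f_Lipschitz by (rule lipschitz_on_continuous_on)

lemma g_isCont: "isCont g t" "isCont g' t"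
  using g g' DERIV_isCont by blast+

lemma energy: "(g' t)\<^sup>2 + 2 * F (g t) = Pmax"
  using ode_energy[OF g g' F, of t 0] g0 g'0 by simp

lemma gradient_bound_G: "x \<in> closure \<Omega> \<Longrightarrow> (norm (G x))\<^sup>2 + 2 * F (u x) \<le> Pmax"
proof (rule continuous_le_on_closure[of \<Omega> "\<lambda>x. (norm (G x))\<^sup>2 + 2 * F (u x)"])
  have "continuous_on (closure \<Omega>) (\<lambda>x. F (u x))"
    by (rule continuous_on_compose2[OF F_cont[of UNIV] u_cont]) auto
  then show "continuous_on (closure \<Omega>) (\<lambda>x. (norm (G x))\<^sup>2 + 2 * F (u x))"
    by (intro continuous_intros G_cont)
  show "(norm (G x))\<^sup>2 + 2 * F (u x) \<le> Pmax" if "x \<in> \<Omega>" for x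
    using P_bound[OF that] G_eq[OF that] by (simp add: P_function_def)
qed

text \<open>The bound on \<open>P\<close> forces the gradient at the boundary to be normal, because its
  normal component already has the maximal length \<open>\<bar>\<kappa>\<bar>\<close>.\<close>

lemma boundary_gradient:
  assumes p: "p \<in> frontier \<Omega>"
  shows "G p = \<kappa> *\<^sub>R (- outward_normal \<Omega> p)"
proof -
  let ?n = "outward_normal \<Omega> p"
  have n1: "norm ?n = 1" using boundary_geometry[OF domain p dim refl] by simp
  have pc: "p \<in> closure \<Omega>" "p \<notin> \<Omega>" using p open_domain by (auto simp: frontier_def interior_open)
  then have "p islimpt \<Omega>" by (simp add: closure_def)
  then have nontriv: "at p within \<Omega> \<noteq> bot" by (simp add: trivial_limit_within)
  have "(G \<longlongrightarrow> G p) (at p within closure \<Omega>)" using G_cont pc(1) by (simp add: continuous_on_def)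
  then have "(G \<longlongrightarrow> G p) (at p within \<Omega>)" by (rule tendsto_within_subset) (rule closure_subset)
  moreover have "\<forall>\<^sub>F x in at p within \<Omega>. G x = gradient u x"
    using G_eq by (auto simp: eventually_at intro!: exI[of _ 1])
  ultimately have "(gradient u \<longlongrightarrow> G p) (at p within \<Omega>)" using tendsto_cong by blast
  then have "Lim (at p within \<Omega>) (gradient u) = G p" by (rule tendsto_Lim[OF nontriv])
  then have Gn: "G p \<bullet> ?n = - \<kappa>" using Neumann[OF p] by (simp add: normal_derivative_def)
  have "(norm (G p))\<^sup>2 \<le> \<kappa>\<^sup>2" using gradient_bound_G[OF pc(1)] Dirichlet[OF p] by simp
  moreover have "(norm (G p + \<kappa> *\<^sub>R ?n))\<^sup>2 = (norm (G p))\<^sup>2 + 2 * \<kappa> * (G p \<bullet> ?n) + \<kappa>\<^sup>2"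
    using n1 unfolding power2_norm_eq_inner
    by (simp add: inner_add_left inner_add_right inner_commute[of ?n "G p"] norm_eq_1 power2_eq_square algebra_simps)
  ultimately have "(norm (G p + \<kappa> *\<^sub>R ?n))\<^sup>2 \<le> 0" by (simp add: Gn power2_eq_square)
  then have "G p + \<kappa> *\<^sub>R ?n = 0" by simp
  then show ?thesis by (simp add: eq_neg_iff_add_eq_0)
qed

text \<open>Continuity of \<open>G\<close> up to \<open>p\<close> makes the derivative of a u + h
  along the inner normal tend to a \<kappa> + h' 0. It serves twice: with a = 1, h = 0 for the sign
  of \<kappa>, and with a = - 1, h = g to show that \<open>V\<close> vanishes to first order along
  the normal.\<close>

lemma inner_ray:
  fixes h h' :: "real \<Rightarrow> real"
  assumes p: "p \<in> frontier \<Omega>" and e: "e = - outward_normal \<Omega> p"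
    and R: "R > 0" "ball (p + R *\<^sub>R e) R \<subseteq> \<Omega>"
    and h: "\<And>t. (h has_real_derivative h' t) (at t)" "isCont h' 0" "h 0 = 0"
    and c: "a * \<kappa> + h' 0 < c"
  shows "\<exists>\<delta>>0. \<forall>t. 0 < t \<longrightarrow> t < \<delta> \<longrightarrow> a * u (p + t *\<^sub>R e) + h t < c * t"
proof -
  have e1: "norm e = 1" using boundary_geometry[OF domain p dim e] by simp
  have pc: "p \<in> closure \<Omega>" using p by (auto simp: frontier_def)
  have in\<Omega>: "p + t *\<^sub>R e \<in> \<Omega>" if "0 < t" "t < R" for t
  proof -
    have "dist (p + R *\<^sub>R e) (p + t *\<^sub>R e) = norm ((R - t) *\<^sub>R e)" by (simp add: dist_norm algebra_simps)
    then have "p + t *\<^sub>R e \<in> ball (p + R *\<^sub>R e) R" using that e1 by simp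
    then show ?thesis using R by blast
  qed
  have inc: "p + t *\<^sub>R e \<in> closure \<Omega>" if "t \<in> {0..<R}" for t
    using that in\<Omega>[of t] pc closure_subset[of \<Omega>] by (cases "t = 0") auto
  have lin: "continuous_on {0..<R} (\<lambda>t. p + t *\<^sub>R e)" by (intro continuous_intros)
  have uc: "continuous_on {0..<R} (\<lambda>t. u (p + t *\<^sub>R e))"
    by (rule continuous_on_compose2[OF u_cont lin]) (use inc in auto)
  have Gc: "continuous_on {0..<R} (\<lambda>t. G (p + t *\<^sub>R e))"
    by (rule continuous_on_compose2[OF G_cont lin]) (use inc in auto)
  have ee: "e \<bullet> e = 1" using e1 by (simp add: norm_eq_1)
  have Gp: "e \<bullet> G p = \<kappa>" using boundary_gradient[OF p] e ee by simp
  define D where "D = (\<lambda>t. a * (e \<bullet> G (p + t *\<^sub>R e)) + h' t - c)"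
  have "((\<lambda>t. G (p + t *\<^sub>R e)) \<longlongrightarrow> G (p + 0 *\<^sub>R e)) (at 0 within {0..<R})"
    by (rule Gc[unfolded continuous_on_def, rule_format]) (use R(1) in simp)
  moreover have "(h' \<longlongrightarrow> h' 0) (at 0 within {0..<R})"
    using h(2) unfolding isCont_def by (rule tendsto_within_subset) simp
  ultimately have "(D \<longlongrightarrow> a * (e \<bullet> G (p + 0 *\<^sub>R e)) + h' 0 - c) (at 0 within {0..<R})"
    unfolding D_def by (intro tendsto_intros)
  then have "\<forall>\<^sub>F t in at 0 within {0..<R}. D t < 0"
    by (rule order_tendstoD) (use c Gp in simp)
  then obtain d where d: "d > 0" "\<And>t. t \<in> {0..<R} \<Longrightarrow> t \<noteq> 0 \<Longrightarrow> dist t 0 < d \<Longrightarrow> D t < 0"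
    unfolding eventually_at by blast
  show ?thesis
  proof (intro exI[of _ "min d R"] conjI allI impI)
    show "0 < min d R" using d(1) R(1) by simp
    fix t assume t: "0 < t" "t < min d R"
    let ?k = "\<lambda>t. a * u (p + t *\<^sub>R e) + h t - c * t"
    have "?k t < ?k 0"
    proof (rule DERIV_neg_imp_decreasing_open[OF t(1)])
      have "continuous_on {0..t} h" using h(1) DERIV_isCont by (blast intro: continuous_at_imp_continuous_on)
      moreover have "continuous_on {0..t} (\<lambda>t. u (p + t *\<^sub>R e))" using t(2) by (intro continuous_on_subset[OF uc]) auto
      ultimately show "continuous_on {0..t} ?k" by (intro continuous_intros)
      fix s assume s: "0 < s" "s < t"
      then have sO: "p + s *\<^sub>R e \<in> \<Omega>" using in\<Omega>[of s] t by simp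
      have "(?k has_real_derivative a * (e \<bullet> gradient u (p + s *\<^sub>R e)) + h' s - c) (at s)"
        using line_has_derivative[OF twice_diff_onD(1)[OF u_twice sO]] h(1)[of s]
        by (auto intro!: derivative_eq_intros)
      moreover have "a * (e \<bullet> gradient u (p + s *\<^sub>R e)) + h' s - c < 0"
        using d(2)[of s] s t G_eq[OF sO] by (simp add: D_def)
      ultimately show "\<exists>y. (?k has_real_derivative y) (at s) \<and> y < 0" by blast
    qed
    then show "a * u (p + t *\<^sub>R e) + h t < c * t" using Dirichlet[OF p] h(3) by simp
  qed
qed

text \<open>For negative \<kappa> the function \<open>u\<close> would be negative just inside the
  boundary.\<close>

lemma kappa_pos: "\<kappa> > 0"
proof (rule ccontr)
  assume "\<not> \<kappa> > 0"
  then have neg: "1 * \<kappa> + (\<lambda>_. 0) 0 < (0::real)" using kappa by simp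
  obtain p where p: "p \<in> frontier \<Omega>" using domain by (auto simp: regular_domain_def)
  let ?e = "- outward_normal \<Omega> p"
  obtain R where R: "R > 0" "ball (p + R *\<^sub>R ?e) R \<subseteq> \<Omega>" and e1: "norm ?e = 1"
    using boundary_geometry[OF domain p dim refl] by blast
  obtain d where d: "d > 0" "\<And>t. 0 < t \<Longrightarrow> t < d \<Longrightarrow> 1 * u (p + t *\<^sub>R ?e) + 0 < 0 * t"
    using inner_ray[OF p refl R, of "\<lambda>_. 0" "\<lambda>_. 0" 1 0] neg by auto
  define t where "t = min d R / 2"
  have t: "0 < t" "t < d" "t < R" using d(1) R(1) by (auto simp: t_def)
  have "dist (p + R *\<^sub>R ?e) (p + t *\<^sub>R ?e) = norm ((R - t) *\<^sub>R ?e)" by (simp add: dist_norm algebra_simps)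
  also have "\<dots> < R" using t e1 unfolding norm_scaleR by simp
  finally have "p + t *\<^sub>R ?e \<in> \<Omega>" using R by auto
  then show False using positive d(2)[OF t(1,2)] by fastforce
qed

end

text \<open>All data attached to one boundary point: up to time \<open>s0\<close> the profile keeps
  slope at least \<kappa> / 2, \<open>M\<close> bounds the squared truncated speed on the range of
  the bounded function \<open>u\<close>, and \<open>T\<close> and \<open>k\<close> are principal
  directions and curvatures.\<close>

locale boundary_point = overdetermined_solution +
  fixes p e :: 'a and R s0 M :: real and \<Phi> :: "real \<Rightarrow> real" and T :: "'a set" and k :: "'a \<Rightarrow> real"
  assumes p: "p \<in> frontier \<Omega>" and e: "e = - outward_normal \<Omega> p"
    and R: "R > 0" "ball (p + R *\<^sub>R e) R \<subseteq> \<Omega>"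
    and s0: "s0 > 0" "\<And>t. \<bar>t\<bar> \<le> s0 \<Longrightarrow> g' t \<ge> \<kappa> / 2"
    and \<Phi>: "\<And>t. (\<Phi> has_real_derivative 1 / sqrt (max (Pmax - 2 * F t) ((\<kappa> / 2)\<^sup>2))) (at t)"
      "strict_mono \<Phi>" "\<Phi> 0 = 0"
    and M: "M > 0" "\<And>x. x \<in> \<Omega> \<Longrightarrow> max (Pmax - 2 * F (u x)) ((\<kappa> / 2)\<^sup>2) \<le> M"
    and T: "finite T" "\<And>b. b \<in> T \<Longrightarrow> norm b = 1" "\<And>b. b \<in> T \<Longrightarrow> b \<bullet> e = 0"
      "(\<Sum>b\<in>T. k b) = (real DIM('a) - 1) * mean_curvature \<Omega> p"
    and descent: "\<And>\<epsilon>. \<epsilon> > 0 \<Longrightarrow> \<exists>\<delta>>0. \<forall>x\<in>\<Omega> \<inter> ball p \<delta>. \<exists>\<sigma>>0. x - \<sigma> *\<^sub>R e \<in> frontier \<Omega> \<and>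
         (\<forall>\<tau>. 0 \<le> \<tau> \<longrightarrow> \<tau> < \<sigma> \<longrightarrow> x - \<tau> *\<^sub>R e \<in> \<Omega>) \<and>
         \<sigma> \<le> e \<bullet> (x - p) - (\<Sum>b\<in>T. (k b / 2 - \<epsilon>) * (b \<bullet> (x - p))\<^sup>2)"
begin

lemma e_norm: "norm e = 1" "e \<bullet> e = 1"
  using boundary_geometry[OF domain p dim e] by (simp_all add: norm_eq_1)

text \<open>While the slope of \<open>g\<close> is at least \<kappa> / 2 the truncation is inactive,
  and by the energy identity \<Phi> \<circ> g has derivative 1.\<close>

lemma \<Phi>_g: "\<bar>t\<bar> \<le> s0 \<Longrightarrow> \<Phi> (g t) = t"
proof -
  assume t: "\<bar>t\<bar> \<le> s0"
  have D: "((\<lambda>t. \<Phi> (g t) - t) has_real_derivative 0) (at s)" if s: "\<bar>s\<bar> \<le> s0" for s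
  proof -
    have "Pmax - 2 * F (g s) = (g' s)\<^sup>2" using energy[of s] by simp
    moreover have "(\<kappa> / 2)\<^sup>2 \<le> (g' s)\<^sup>2" using s0(2)[OF s] kappa_pos by (intro power_mono) auto
    moreover have "g' s > 0" using s0(2)[OF s] kappa_pos by linarith
    ultimately have E: "1 / sqrt (max (Pmax - 2 * F (g s)) ((\<kappa> / 2)\<^sup>2)) * g' s = 1" by (simp add: max_def)
    have "((\<lambda>t. \<Phi> (g t)) has_real_derivative 1 / sqrt (max (Pmax - 2 * F (g s)) ((\<kappa> / 2)\<^sup>2)) * g' s) (at s)"
      by (rule DERIV_chain2[OF \<Phi>(1) g])
    then have "((\<lambda>t. \<Phi> (g t)) has_real_derivative 1) (at s)" unfolding E .
    then show ?thesis by (auto intro!: derivative_eq_intros)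
  qed
  have "\<exists>c. \<forall>s\<in>{- s0..s0}. \<Phi> (g s) - s = c"
  proof (rule has_field_derivative_zero_constant)
    show "((\<lambda>s. \<Phi> (g s) - s) has_real_derivative 0) (at s within {- s0..s0})" if "s \<in> {- s0..s0}" for s
      by (rule has_field_derivative_at_within[OF D]) (use that in auto)
  qed simp
  then obtain c where c: "\<And>s. \<bar>s\<bar> \<le> s0 \<Longrightarrow> \<Phi> (g s) - s = c" by (auto simp: abs_le_iff)
  have "\<Phi> (g 0) - 0 = c" by (rule c) (use s0 in simp)
  then have "c = 0" using g0 \<Phi>(3) by simp
  then show ?thesis using c[OF t] by simp
qed

lemma u_le_g: "\<Phi> (u x) \<le> t \<Longrightarrow> \<bar>t\<bar> \<le> s0 \<Longrightarrow> u x \<le> g t"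
  using \<Phi>_g[of t] \<Phi>(2) by (metis strict_mono_less_eq)

text \<open>With c the truncated speed, |gradient u|^2 \<le> c^2 - Q, and sqrt (c^2 - q) \<le> c - q
  / (2 c); so \<Phi> \<circ> u climbs with slope at most 1 - Q / (2 M). Slope 1 is used on the lower
  part of the segment, the improved slope on the top part of length \<open>l\<close>, where a lower
  bound for \<open>Q\<close> is known. For l = 0 this is the plain Lipschitz bound.\<close>

lemma vertical_gain:
  assumes x: "x - \<sigma> *\<^sub>R e \<in> frontier \<Omega>" "\<And>\<tau>. 0 \<le> \<tau> \<Longrightarrow> \<tau> < \<sigma> \<Longrightarrow> x - \<tau> *\<^sub>R e \<in> \<Omega>"
    and l: "0 \<le> l" "l < \<sigma>" and q: "\<And>\<tau>. 0 \<le> \<tau> \<Longrightarrow> \<tau> \<le> l \<Longrightarrow> q \<le> Q (x - \<tau> *\<^sub>R e)"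
  shows "\<Phi> (u x) \<le> \<sigma> - l * (q / (2 * M))"
proof -
  let ?z = "x - \<sigma> *\<^sub>R e"
  let ?y = "\<lambda>s. \<Phi> (u (?z + s *\<^sub>R e))"
  let ?\<Gamma> = "\<lambda>x. sqrt (max (Pmax - 2 * F (u x)) ((\<kappa> / 2)\<^sup>2))"
  have pt: "?z + s *\<^sub>R e = x - (\<sigma> - s) *\<^sub>R e" for s by (simp add: algebra_simps)
  have in\<Omega>: "?z + s *\<^sub>R e \<in> \<Omega>" if "0 < s" "s \<le> \<sigma>" for s
    unfolding pt by (rule x(2)) (use that in auto)
  have inc: "?z + s *\<^sub>R e \<in> closure \<Omega>" if "0 \<le> s" "s \<le> \<sigma>" for s
    using in\<Omega>[of s] that x(1) closure_subset[of \<Omega>] by (cases "s = 0") (auto simp: frontier_def)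
  have "continuous_on UNIV \<Phi>" using \<Phi>(1) DERIV_isCont by (blast intro: continuous_at_imp_continuous_on)
  moreover have "continuous_on {0..\<sigma>} (\<lambda>s. u (?z + s *\<^sub>R e))"
    by (rule continuous_on_compose2[OF u_cont]) (use inc in \<open>auto intro!: continuous_intros\<close>)
  ultimately have yc: "continuous_on {0..\<sigma>} ?y" by (rule continuous_on_compose2) auto
  have D: "(?y has_real_derivative (e \<bullet> gradient u (?z + s *\<^sub>R e)) / ?\<Gamma> (?z + s *\<^sub>R e)) (at s)"
    if "0 < s" "s \<le> \<sigma>" for s
    using DERIV_chain2[OF \<Phi>(1) line_has_derivative[OF twice_diff_onD(1)[OF u_twice in\<Omega>[OF that]]]] by simp
  have slope: "(e \<bullet> gradient u w) / ?\<Gamma> w \<le> 1 - Q w / (2 * M)" if w: "w \<in> \<Omega>" for w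
  proof -
    define c where "c = ?\<Gamma> w"
    define q where "q = Q w"
    have c2: "c\<^sup>2 = max (Pmax - 2 * F (u w)) ((\<kappa> / 2)\<^sup>2)" by (simp add: c_def le_max_iff_disj)
    have cpos: "c > 0" using kappa_pos by (simp add: c_def less_max_iff_disj)
    have q0: "q \<ge> 0" using P_bound[OF w] by (simp add: q_def)
    have nu: "(norm (gradient u w))\<^sup>2 \<le> c\<^sup>2 - q"
      unfolding c2 by (simp add: q_def P_function_def le_max_iff_disj)
    have qc: "q \<le> c\<^sup>2" using nu zero_le_power2[of "norm (gradient u w)"] by linarith
    have "norm (gradient u w) \<le> c - q / (2 * c)"
    proof (rule power2_le_imp_le)
      have "(c - q / (2 * c))\<^sup>2 = c\<^sup>2 - q + (q / (2 * c))\<^sup>2"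
        using cpos by (simp add: power2_diff)
      then show "(norm (gradient u w))\<^sup>2 \<le> (c - q / (2 * c))\<^sup>2"
        using nu zero_le_power2[of "q / (2 * c)"] by linarith
      have "q / (2 * c) \<le> c\<^sup>2 / (1 * c)" using qc cpos q0 by (intro frac_le) auto
      then show "0 \<le> c - q / (2 * c)" using cpos by (simp add: power2_eq_square)
    qed
    then have "e \<bullet> gradient u w \<le> c - q / (2 * c)"
      using norm_cauchy_schwarz[of e "gradient u w"] e_norm by simp
    then have "(e \<bullet> gradient u w) / c \<le> (c - q / (2 * c)) / c"
      using cpos by (intro divide_right_mono) auto
    also have "\<dots> = 1 - q / (2 * c\<^sup>2)" using cpos by (simp add: diff_divide_distrib power2_eq_square)
    also have "\<dots> \<le> 1 - q / (2 * M)"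
      using M(2)[OF w, folded c2] cpos q0 by (intro diff_left_mono frac_le) auto
    finally show ?thesis by (simp add: c_def q_def)
  qed
  have "?y (\<sigma> - l) - (\<sigma> - l) \<le> ?y 0 - 0"
  proof (rule DERIV_nonpos_imp_decreasing_open[of 0 "\<sigma> - l" "\<lambda>s. ?y s - s"])
    show "continuous_on {0..\<sigma> - l} (\<lambda>s. ?y s - s)"
      using l by (intro continuous_intros continuous_on_subset[OF yc]) auto
    fix s assume s: "0 < s" "s < \<sigma> - l"
    then have ss: "0 < s" "s \<le> \<sigma>" using l by auto
    have "(e \<bullet> gradient u (?z + s *\<^sub>R e)) / ?\<Gamma> (?z + s *\<^sub>R e) - 1 \<le> 0"
      using slope[OF in\<Omega>[OF ss]] P_bound[OF in\<Omega>[OF ss]] M(1)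
      by (smt (verit) divide_nonneg_pos)
    then show "\<exists>y. ((\<lambda>s. ?y s - s) has_real_derivative y) (at s) \<and> y \<le> 0"
      using DERIV_diff[OF D[OF ss] DERIV_ident] by blast
  qed (use l in auto)
  moreover have "?y 0 = 0" using Dirichlet[OF x(1)] \<Phi>(3) by simp
  moreover have "?y \<sigma> - (1 - q / (2 * M)) * \<sigma> \<le> ?y (\<sigma> - l) - (1 - q / (2 * M)) * (\<sigma> - l)"
  proof (rule DERIV_nonpos_imp_decreasing_open[of "\<sigma> - l" \<sigma> "\<lambda>s. ?y s - (1 - q / (2 * M)) * s"])
    show "continuous_on {\<sigma> - l..\<sigma>} (\<lambda>s. ?y s - (1 - q / (2 * M)) * s)"
      using l by (intro continuous_intros continuous_on_subset[OF yc]) auto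
    fix s assume s: "\<sigma> - l < s" "s < \<sigma>"
    then have ss: "0 < s" "s \<le> \<sigma>" using l by auto
    have "q \<le> Q (?z + s *\<^sub>R e)" unfolding pt by (rule q) (use s in auto)
    then have "q / (2 * M) \<le> Q (?z + s *\<^sub>R e) / (2 * M)" using M(1) by (intro divide_right_mono) auto
    then have "(e \<bullet> gradient u (?z + s *\<^sub>R e)) / ?\<Gamma> (?z + s *\<^sub>R e) - (1 - q / (2 * M)) \<le> 0"
      using slope[OF in\<Omega>[OF ss]] by linarith
    moreover have "((\<lambda>s. ?y s - (1 - q / (2 * M)) * s) has_real_derivative
        (e \<bullet> gradient u (?z + s *\<^sub>R e)) / ?\<Gamma> (?z + s *\<^sub>R e) - (1 - q / (2 * M))) (at s)"
      using DERIV_diff[OF D[OF ss] DERIV_cmult[OF DERIV_ident, of "1 - q / (2 * M)"]] by simp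
    ultimately show "\<exists>y. ((\<lambda>s. ?y s - (1 - q / (2 * M)) * s) has_real_derivative y) (at s) \<and> y \<le> 0"
      by blast
  qed (use l in auto)
  moreover have "(1 - c) * \<sigma> = (1 - c) * (\<sigma> - l) + l - l * c" for c by (simp add: algebra_simps)
  note this[of "q / (2 * M)"]
  moreover have "?y \<sigma> = \<Phi> (u x)" by simp
  ultimately show ?thesis by linarith
qed

definition "\<psi> \<epsilon> x = e \<bullet> (x - p) - (\<Sum>b\<in>T. (k b / 2 - \<epsilon>) * (b \<bullet> (x - p))\<^sup>2)"

lemma \<psi>:
  fixes \<epsilon> :: real
  shows "twice_diff_on (\<psi> \<epsilon>) UNIV"
    and "laplacian (\<psi> \<epsilon>) x = 2 * \<epsilon> * real (card T) - (real DIM('a) - 1) * mean_curvature \<Omega> p"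
    and "\<psi> \<epsilon> (p + t *\<^sub>R e) = t" and "gradient (\<psi> \<epsilon>) p = e" and "isCont (gradient (\<psi> \<epsilon>)) p"
proof -
  have "\<psi> \<epsilon> = (\<lambda>x. e \<bullet> (x - p) - (\<Sum>b\<in>T. (k b / 2 - \<epsilon>) * (b \<bullet> (x - p))\<^sup>2))"
    by (simp add: \<psi>_def fun_eq_iff)
  note tw = twice_diff_affine_minus_squares[of e p "\<lambda>b. k b / 2 - \<epsilon>" T, folded this]
  show "twice_diff_on (\<psi> \<epsilon>) UNIV" by (rule tw(1))
  have "laplacian (\<psi> \<epsilon>) x = - 2 * (\<Sum>b\<in>T. k b / 2 - \<epsilon>)" using tw(2)[of x] T(2) by simp
  also have "\<dots> = 2 * \<epsilon> * real (card T) - (\<Sum>b\<in>T. k b)"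
    by (simp add: sum_subtractf sum_divide_distrib[symmetric] right_diff_distrib)
  finally show "laplacian (\<psi> \<epsilon>) x = 2 * \<epsilon> * real (card T) - (real DIM('a) - 1) * mean_curvature \<Omega> p"
    using T(4) by simp
  show "\<psi> \<epsilon> (p + t *\<^sub>R e) = t" using T(3) e_norm by (simp add: \<psi>_def)
  show "gradient (\<psi> \<epsilon>) p = e" using tw(3)[of p] by simp
  show "isCont (gradient (\<psi> \<epsilon>)) p"
    using has_derivative_continuous[OF has_derivative_hessian[OF tw(1)]] by simp
qed

abbreviation "V \<epsilon> \<equiv> \<lambda>x. g (\<psi> \<epsilon> x) - u x"

lemma V_derivatives:
  assumes S: "open S" "S \<subseteq> \<Omega>"
  shows "twice_diff_on (V \<epsilon>) S"
    and "x \<in> S \<Longrightarrow> laplacian (V \<epsilon>) x = - f (g (\<psi> \<epsilon> x)) * (norm (gradient (\<psi> \<epsilon>) x))\<^sup>2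
      + g' (\<psi> \<epsilon> x) * laplacian (\<psi> \<epsilon>) x + f (u x)"
proof -
  have pS: "twice_diff_on (\<psi> \<epsilon>) S" by (rule twice_diff_on_subset[OF \<psi>(1)]) simp
  note c = twice_diff_compose[OF S(1) pS g g']
  note lc = twice_diff_lincomb[OF S(1) c(1) twice_diff_on_subset[OF u_twice S(2)], where a = 1 and c = "- 1"]
  show "twice_diff_on (V \<epsilon>) S" using lc(1) by simp
  show "laplacian (V \<epsilon>) x = - f (g (\<psi> \<epsilon> x)) * (norm (gradient (\<psi> \<epsilon>) x))\<^sup>2
      + g' (\<psi> \<epsilon> x) * laplacian (\<psi> \<epsilon>) x + f (u x)" if "x \<in> S"
    using lc(2)[OF that] c(2)[OF that] equation[of x] S that by auto
qed

text \<open>The Laplacian of \<open>V\<close> is a difference of values of \<open>f\<close>,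
  controlled by L V, plus the remainder \<open>?B\<close>. The remainder contains only \<psi> and
  \<open>g\<close>, hence is continuous at \<open>p\<close>, where |gradient \<psi>| = 1 and its
  value is \<kappa> times the Laplacian of \<psi>. The sign of \<open>V\<close> comes from
  \<open>vertical_gain\<close> with l = 0.\<close>

lemma V_supersolution:
  fixes \<epsilon> :: real
  assumes \<epsilon>: "\<epsilon> > 0"
    and \<eta>: "\<kappa> * (2 * \<epsilon> * real (card T) - (real DIM('a) - 1) * mean_curvature \<Omega> p) < \<eta>"
  shows "\<exists>\<delta>>0. \<forall>x\<in>\<Omega> \<inter> ball p \<delta>. \<bar>\<psi> \<epsilon> x\<bar> \<le> s0 / 2 \<and> 0 \<le> V \<epsilon> x \<and>
    laplacian (V \<epsilon>) x \<le> L * (norm (gradient (V \<epsilon>) x) + V \<epsilon> x) + \<eta> \<and>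
    (\<exists>\<sigma>>0. x - \<sigma> *\<^sub>R e \<in> frontier \<Omega> \<and> (\<forall>\<tau>. 0 \<le> \<tau> \<longrightarrow> \<tau> < \<sigma> \<longrightarrow> x - \<tau> *\<^sub>R e \<in> \<Omega>) \<and> \<sigma> \<le> \<psi> \<epsilon> x)"
proof -
  let ?m = "2 * \<epsilon> * real (card T) - (real DIM('a) - 1) * mean_curvature \<Omega> p"
  let ?B = "\<lambda>x. f (g (\<psi> \<epsilon> x)) * (1 - (norm (gradient (\<psi> \<epsilon>) x))\<^sup>2) + g' (\<psi> \<epsilon> x) * ?m"
  have psip: "\<psi> \<epsilon> p = 0" using \<psi>(3)[of \<epsilon> 0] by simp
  have pc: "isCont (\<psi> \<epsilon>) p" by (rule twice_diff_onD(3)[OF \<psi>(1)]) simp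
  have "isCont (\<lambda>x. g (\<psi> \<epsilon> x)) p" "isCont (\<lambda>x. g' (\<psi> \<epsilon> x)) p"
    using g_isCont pc by (auto intro: isCont_o2)
  moreover from this(1) have "isCont (\<lambda>x. f (g (\<psi> \<epsilon> x))) p"
    by (rule isCont_o2) (use f_cont in \<open>simp add: continuous_on_eq_continuous_at\<close>)
  ultimately have "isCont ?B p" by (intro continuous_intros \<psi>(5))
  moreover have "?B p = \<kappa> * ?m" using psip g0 g'0 e_norm \<psi>(4) by simp
  ultimately have "\<forall>\<^sub>F x in at p. ?B x < \<eta>"
    using \<eta> unfolding isCont_def by (intro order_tendstoD(2)) auto
  then obtain d1 where d1: "d1 > 0" "\<And>x. x \<noteq> p \<Longrightarrow> dist x p < d1 \<Longrightarrow> ?B x < \<eta>"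
    unfolding eventually_at by auto
  have "(\<psi> \<epsilon> \<longlongrightarrow> 0) (at p)" using pc psip unfolding isCont_def by simp
  then obtain d2 where d2: "d2 > 0" "\<And>x. x \<noteq> p \<Longrightarrow> dist x p < d2 \<Longrightarrow> \<bar>\<psi> \<epsilon> x\<bar> < s0 / 2"
    using s0(1) unfolding tendsto_iff eventually_at by (auto dest!: spec[of _ "s0 / 2"])
  obtain d3 where d3: "d3 > 0" "\<And>x. x \<in> \<Omega> \<inter> ball p d3 \<Longrightarrow> \<exists>\<sigma>>0. x - \<sigma> *\<^sub>R e \<in> frontier \<Omega> \<and>
         (\<forall>\<tau>. 0 \<le> \<tau> \<longrightarrow> \<tau> < \<sigma> \<longrightarrow> x - \<tau> *\<^sub>R e \<in> \<Omega>) \<and> \<sigma> \<le> \<psi> \<epsilon> x"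
    using descent[OF \<epsilon>] unfolding \<psi>_def by auto
  define \<delta> where "\<delta> = min d1 (min d2 d3)"
  have "\<delta> > 0" using d1(1) d2(1) d3(1) by (simp add: \<delta>_def)
  moreover have "\<bar>\<psi> \<epsilon> x\<bar> \<le> s0 / 2 \<and> 0 \<le> V \<epsilon> x \<and>
    laplacian (V \<epsilon>) x \<le> L * (norm (gradient (V \<epsilon>) x) + V \<epsilon> x) + \<eta> \<and>
    (\<exists>\<sigma>>0. x - \<sigma> *\<^sub>R e \<in> frontier \<Omega> \<and> (\<forall>\<tau>. 0 \<le> \<tau> \<longrightarrow> \<tau> < \<sigma> \<longrightarrow> x - \<tau> *\<^sub>R e \<in> \<Omega>) \<and> \<sigma> \<le> \<psi> \<epsilon> x)"
    if x: "x \<in> \<Omega> \<inter> ball p \<delta>" for x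
  proof -
    have xp: "x \<noteq> p" using x p open_domain by (auto simp: frontier_def interior_open)
    have xd: "dist x p < d1" "dist x p < d2" "x \<in> \<Omega> \<inter> ball p d3" using x by (auto simp: \<delta>_def dist_commute)
    from d3(2)[OF xd(3)] obtain \<sigma> where \<sigma>: "\<sigma> > 0" "x - \<sigma> *\<^sub>R e \<in> frontier \<Omega>"
      "\<forall>\<tau>. 0 \<le> \<tau> \<longrightarrow> \<tau> < \<sigma> \<longrightarrow> x - \<tau> *\<^sub>R e \<in> \<Omega>" "\<sigma> \<le> \<psi> \<epsilon> x" by blast
    have ps: "\<bar>\<psi> \<epsilon> x\<bar> < s0 / 2" by (rule d2(2)[OF xp xd(2)])
    have "\<Phi> (u x) \<le> \<sigma> - 0 * (0 / (2 * M))"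
      by (rule vertical_gain[OF \<sigma>(2)]) (use \<sigma> P_bound[of x] x in auto)
    then have Vx: "0 \<le> V \<epsilon> x" using u_le_g[of x "\<psi> \<epsilon> x"] \<sigma>(4) ps s0(1) by simp
    have "laplacian (V \<epsilon>) x = (f (u x) - f (g (\<psi> \<epsilon> x))) + ?B x"
      using V_derivatives(2)[OF open_domain order.refl, of x \<epsilon>] x \<psi>(2)[of \<epsilon> x] by (simp add: algebra_simps)
    also have "\<dots> \<le> L * \<bar>u x - g (\<psi> \<epsilon> x)\<bar> + \<eta>"
      using lipschitz_onD[OF f_Lipschitz, of "u x" "g (\<psi> \<epsilon> x)"] d1(2)[OF xp xd(1)]
      by (simp add: dist_real_def abs_le_iff)
    also have "\<dots> = L * V \<epsilon> x + \<eta>" using Vx by simp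
    also have "\<dots> \<le> L * (norm (gradient (V \<epsilon>) x) + V \<epsilon> x) + \<eta>"
      using L_nonneg by (intro add_right_mono mult_left_mono) auto
    finally show ?thesis using ps Vx \<sigma> by auto
  qed
  ultimately show ?thesis by blast
qed

text \<open>In the tangent ball Hopf's lemma gives V \<ge> c t at \<open>p + t *\<^sub>R e\<close>,
  whereas the derivatives \<kappa> of g (\<psi>) and of u cancel there, so that V < c t for small
  t.\<close>

lemma hopf_contradiction:
  assumes r: "0 < r" "r \<le> 1" "ball (p + r *\<^sub>R e) r \<subseteq> \<Omega>"
    and nonneg: "\<And>x. x \<in> ball (p + r *\<^sub>R e) r \<Longrightarrow> 0 \<le> V \<epsilon> x"
    and lap: "\<And>x. x \<in> ball (p + r *\<^sub>R e) r \<Longrightarrow>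
       laplacian (V \<epsilon>) x \<le> L * (norm (gradient (V \<epsilon>) x) + V \<epsilon> x) + \<eta>"
    and eta: "0 \<le> \<eta>" "\<eta> * r\<^sup>2 * exp \<alpha> < m" and m: "0 < m"
    and inner: "\<And>x. dist (p + r *\<^sub>R e) x \<le> r / 2 \<Longrightarrow> m \<le> V \<epsilon> x"
    and alpha: "\<alpha> = 2 * real DIM('a) + 3 * L + 1"
  shows False
proof -
  let ?y = "p + r *\<^sub>R e"
  define c where "c = m * exp (- \<alpha>) * \<alpha> / r"
  have a0: "\<alpha> > 0" using L_nonneg unfolding alpha by (simp add: add_nonneg_pos)
  then have c: "c > 0" using m r by (simp add: c_def)
  obtain \<delta> where \<delta>: "\<delta> > 0" "\<And>t. 0 < t \<Longrightarrow> t < \<delta> \<Longrightarrow> (- 1) * u (p + t *\<^sub>R e) + g t < c * t"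
    using inner_ray[OF p e R g g_isCont(2) g0, of "- 1" c] c g'0 by auto
  define t where "t = min \<delta> r / 2"
  have t: "0 < t" "t < \<delta>" "t \<le> r / 2" using \<delta>(1) r(1) by (auto simp: t_def)
  let ?x = "p + t *\<^sub>R e"
  have "dist ?y ?x = norm ((r - t) *\<^sub>R e)" by (simp add: dist_norm algebra_simps)
  then have dx: "dist ?y ?x = r - t" using t r e_norm by simp
  have "m * exp (- \<alpha>) * \<alpha> * (1 - (dist ?y ?x)\<^sup>2 / r\<^sup>2) \<le> V \<epsilon> ?x"
    by (rule hopf_lower_bound[OF r(1,2) L_nonneg eta(1) m V_derivatives(1)[OF open_ball r(3)] nonneg lap inner _ eta(2)])
       (use t dx alpha in auto)
  moreover have "t / r \<le> 1 - (dist ?y ?x)\<^sup>2 / r\<^sup>2"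
  proof -
    have "t * t \<le> r * t" using t by (intro mult_right_mono) auto
    then have "t * r \<le> r\<^sup>2 - (r - t)\<^sup>2" by (simp add: power2_eq_square algebra_simps)
    then have "t * r / r\<^sup>2 \<le> (r\<^sup>2 - (r - t)\<^sup>2) / r\<^sup>2" by (intro divide_right_mono) auto
    then show ?thesis using r(1) unfolding dx by (simp add: diff_divide_distrib power2_eq_square)
  qed
  then have "(m * exp (- \<alpha>) * \<alpha>) * (t / r) \<le> (m * exp (- \<alpha>) * \<alpha>) * (1 - (dist ?y ?x)\<^sup>2 / r\<^sup>2)"
    using m a0 by (intro mult_left_mono) auto
  ultimately have "c * t \<le> V \<epsilon> ?x" by (simp add: c_def)
  then show False using \<delta>(2)[OF t(1,2)] \<psi>(3)[of \<epsilon> t] by simp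
qed

lemma nested_ball: "r \<le> R' \<Longrightarrow> ball (p + r *\<^sub>R e) r \<subseteq> ball (p + R' *\<^sub>R e) R'"
proof
  fix x assume r: "r \<le> R'" and x: "x \<in> ball (p + r *\<^sub>R e) r"
  have "dist (p + R' *\<^sub>R e) (p + r *\<^sub>R e) = norm ((R' - r) *\<^sub>R e)" by (simp add: dist_norm algebra_simps)
  also have "\<dots> = R' - r" using r e_norm by simp
  finally show "x \<in> ball (p + R' *\<^sub>R e) R'"
    using x dist_triangle[of "p + R' *\<^sub>R e" x "p + r *\<^sub>R e"] by simp
qed

lemma ball_near: "x \<in> ball (p + r *\<^sub>R e) r \<Longrightarrow> dist p x < 2 * r"
proof -
  assume x: "x \<in> ball (p + r *\<^sub>R e) r"
  then have "r > 0" by (metis ball_empty empty_iff not_le)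
  then have "dist p (p + r *\<^sub>R e) = r" using e_norm by (simp add: dist_norm)
  then show ?thesis using x dist_triangle[of p x "p + r *\<^sub>R e"] by simp
qed

text \<open>Positive curvature leaves a strictly negative constant on the right of the inequality
  for \<open>V\<close>. It first forces \<open>V\<close> to be positive in a tangent ball and can
  then be dropped, so Hopf's lemma applies with \<eta> = 0.\<close>

lemma mean_curvature_nonpos: "mean_curvature \<Omega> p \<le> 0"
proof (rule ccontr)
  let ?H = "(real DIM('a) - 1) * mean_curvature \<Omega> p"
  assume "\<not> mean_curvature \<Omega> p \<le> 0"
  then have H: "?H > 0" using dim by (intro mult_pos_pos) auto
  \<comment> \<open>Small enough that the slack 2 \<epsilon> card T uses up at most half of the
    curvature term \<open>?H\<close>.\<close>
  define \<epsilon> where "\<epsilon> = ?H / (4 * (real (card T) + 1))"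
  have e0: "\<epsilon> > 0" using H by (simp add: \<epsilon>_def add_nonneg_pos)
  have "2 * \<epsilon> * real (card T) \<le> 2 * \<epsilon> * (real (card T) + 1)" using e0 by (intro mult_left_mono) auto
  also have "\<dots> = ?H / 2" by (simp add: \<epsilon>_def field_simps add_nonneg_eq_0_iff)
  finally have "2 * \<epsilon> * real (card T) - ?H \<le> - ?H / 2" by simp
  then have "\<kappa> * (2 * \<epsilon> * real (card T) - ?H) \<le> \<kappa> * (- ?H / 2)" using kappa_pos by (intro mult_left_mono) auto
  also have "\<dots> < \<kappa> * (- ?H / 4)" 
    by (rule mult_strict_left_mono[OF _ kappa_pos]) (use H in linarith)
  finally obtain \<delta> where \<delta>: "\<delta> > 0" "\<And>x. x \<in> \<Omega> \<inter> ball p \<delta> \<Longrightarrow> 0 \<le> V \<epsilon> x \<and>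
    laplacian (V \<epsilon>) x \<le> L * (norm (gradient (V \<epsilon>) x) + V \<epsilon> x) + \<kappa> * (- ?H / 4)"
    using V_supersolution[OF e0] by blast
  have neg: "\<kappa> * (- ?H / 4) < 0"
  proof (rule mult_pos_neg[OF kappa_pos])
    show "- ?H / 4 < 0" using H by linarith
  qed
  define r where "r = min (min R 1) (\<delta> / 2)"
  have r: "r > 0" "r \<le> R" "r \<le> 1" "2 * r \<le> \<delta>" using R(1) \<delta>(1) by (auto simp: r_def)
  let ?B = "ball (p + r *\<^sub>R e) r"
  have sub: "?B \<subseteq> \<Omega>" using nested_ball[OF r(2)] R(2) by blast
  have ss: "x \<in> \<Omega> \<inter> ball p \<delta>" if "x \<in> ?B" for x using that sub ball_near[OF that] r(4) by auto
  note Vd = V_derivatives(1)[OF open_ball sub, of \<epsilon>]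
  \<comment> \<open>A zero would be an interior minimum, with vanishing gradient and nonnegative
    Laplacian, against the negative constant.\<close>
  have pos: "0 < V \<epsilon> x" if x: "x \<in> ?B" for x
  proof (rule ccontr)
    assume "\<not> 0 < V \<epsilon> x"
    then have V0: "V \<epsilon> x = 0" using \<delta>(2)[OF ss[OF x]] by simp
    have "V \<epsilon> x \<le> V \<epsilon> y" if "y \<in> ?B" for y using V0 \<delta>(2)[OF ss[OF that]] by simp
    from local_min_gradient_laplacian[OF open_ball Vd x this]
    have "gradient (V \<epsilon>) x = 0" "0 \<le> laplacian (V \<epsilon>) x" by auto
    then show False using \<delta>(2)[OF ss[OF x]] V0 neg by simp
  qed
  have csub: "cball (p + r *\<^sub>R e) (r / 2) \<subseteq> ?B" using r(1) by auto
  have "continuous_on (cball (p + r *\<^sub>R e) (r / 2)) (V \<epsilon>)"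
    using twice_diff_onD(3)[OF Vd] csub by (intro continuous_at_imp_continuous_on) blast
  then obtain m where m: "m > 0" "\<And>x. x \<in> cball (p + r *\<^sub>R e) (r / 2) \<Longrightarrow> m \<le> V \<epsilon> x"
    using positive_lower_bound_compact[OF compact_cball, of _ _ "V \<epsilon>"] pos csub by blast
  show False
  proof (rule hopf_contradiction[OF r(1,3) sub, of \<epsilon> 0 _ m])
    show "laplacian (V \<epsilon>) x \<le> L * (norm (gradient (V \<epsilon>) x) + V \<epsilon> x) + 0" if "x \<in> ?B" for x
      using \<delta>(2)[OF ss[OF that]] neg by simp
    show "0 \<le> V \<epsilon> x" if "x \<in> ?B" for x using pos[OF that] by simp
  qed (use m in auto)
qed

end

section \<open>Boundary points of zero mean curvature and the conclusion\<close>

context boundary_point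
begin

lemma dist_center_sq: "(dist (p + r *\<^sub>R e) (p + z))\<^sup>2 = (norm z)\<^sup>2 - 2 * r * (e \<bullet> z) + r\<^sup>2"
proof -
  have "dist (p + r *\<^sub>R e) (p + z) = norm (z - r *\<^sub>R e)" by (simp add: dist_norm norm_minus_commute)
  then show ?thesis
    using e_norm(2) unfolding power2_norm_eq_inner
    by (simp add: power2_norm_eq_inner inner_diff_left inner_diff_right inner_commute[of z e] power2_eq_square[of r] algebra_simps)
qed

text \<open>If \<open>Q\<close> is positive, then by Hopf it grows at least linearly away from \<open>p\<close>, so vertical
  integration yields \<open>V \<ge> c r\<^sup>2\<close> on the half-sized ball inside the tangent ball of radius
  \<open>r\<close>. On that scale the error \<open>\<eta>\<close> in the inequality for \<open>V\<close> is negligible.\<close>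

lemma Q_zero_near_flat_point:
  assumes H: "mean_curvature \<Omega> p = 0" and R1: "0 < R1" "R1 \<le> R" "R1 \<le> 1"
    and K: "0 \<le> K" and lapQ: "\<And>x. x \<in> ball (p + R1 *\<^sub>R e) R1 \<Longrightarrow> laplacian Q x \<le> K * (norm (gradient Q x) + Q x)"
  shows "\<exists>x\<in>ball (p + R1 *\<^sub>R e) R1. Q x = 0"
proof (rule ccontr)
  let ?y = "p + R1 *\<^sub>R e"
  let ?B = "ball ?y R1"
  have sub: "?B \<subseteq> \<Omega>" using nested_ball[OF R1(2)] R(2) by blast
  assume "\<not> (\<exists>x\<in>?B. Q x = 0)"
  then have Qne: "\<And>x. x \<in> ?B \<Longrightarrow> Q x \<noteq> 0" by blast
  have Qpos: "Q x > 0" if x: "x \<in> ?B" for x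
  proof -
    have "x \<in> \<Omega>" using x sub by blast
    then show ?thesis using Qne[OF x] P_bound[of x] by simp
  qed
  have Q2: "twice_diff_on Q ?B"
    by (rule twice_diff_on_subset[OF P_function_deficit(1)[OF open_domain u_C3 F equation] sub])
  have csub: "cball ?y (R1 / 2) \<subseteq> ?B" using R1(1) by auto
  have "continuous_on (cball ?y (R1 / 2)) Q"
    using twice_diff_onD(3)[OF Q2] csub by (intro continuous_at_imp_continuous_on) blast
  then obtain m1 where m1: "m1 > 0" "\<And>x. x \<in> cball ?y (R1 / 2) \<Longrightarrow> m1 \<le> Q x"
    using positive_lower_bound_compact[OF compact_cball, of _ _ Q] Qpos csub by blast
  define \<alpha>1 where "\<alpha>1 = 2 * real DIM('a) + 3 * K + 1"
  have a1: "\<alpha>1 > 0" using K by (simp add: \<alpha>1_def add_nonneg_pos)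
  define c1 where "c1 = m1 * exp (- \<alpha>1) * \<alpha>1"
  have c1: "c1 > 0" using m1 a1 by (simp add: c1_def)
  have hopfQ: "c1 * ((2 * R1 * (e \<bullet> z) - (norm z)\<^sup>2) / R1\<^sup>2) \<le> Q (p + z)"
    if z: "norm z \<le> R1 / 2" "(norm z)\<^sup>2 < 2 * R1 * (e \<bullet> z)" for z
  proof -
    have "(dist ?y (p + z))\<^sup>2 < R1\<^sup>2" unfolding dist_center_sq using z(2) by simp
    then have lt: "dist ?y (p + z) < R1" using R1(1) by (rule power2_less_imp_less[OF _ less_imp_le])
    have "dist ?y (p + z) \<ge> R1 / 2"
      using norm_triangle_ineq2[of "R1 *\<^sub>R e" z] z(1) R1(1) e_norm by (simp add: dist_norm)
    then have "m1 * exp (- \<alpha>1) * \<alpha>1 * (1 - (dist ?y (p + z))\<^sup>2 / R1\<^sup>2) \<le> Q (p + z)"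
      by (rule hopf_lower_bound[OF R1(1,3) K order.refl m1(1) Q2, rotated 5])
         (use lt lapQ Qpos m1 in \<open>auto simp: \<alpha>1_def less_imp_le\<close>)
    moreover have "1 - (dist ?y (p + z))\<^sup>2 / R1\<^sup>2 = (2 * R1 * (e \<bullet> z) - (norm z)\<^sup>2) / R1\<^sup>2"
      unfolding dist_center_sq using R1(1) by (simp add: field_simps)
    ultimately show ?thesis by (simp add: c1_def)
  qed
  \<comment> \<open>The constants follow the estimate: \<open>Q\<close> is at least c2 r on a
    vertical segment of length r / 4, integration over it gains c3 r^2 in the parameter \<Phi>, and
    the slope \<kappa> / 2 of \<open>g\<close> turns this into c4 r^2 for \<open>V\<close>.\<close>
  define c2 where "c2 = c1 / (4 * R1)"
  define c3 where "c3 = c2 / (8 * M)"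
  define c4 where "c4 = \<kappa> / 2 * c3"
  have c2: "c2 > 0" using c1 R1(1) by (simp add: c2_def)
  have c3: "c3 > 0" using c2 M(1) by (simp add: c3_def)
  have c4: "c4 > 0" using c3 kappa_pos by (simp add: c4_def)
  define \<alpha> where "\<alpha> = 2 * real DIM('a) + 3 * L + 1"
  \<comment> \<open>Both \<eta> r^2 exp \<alpha> and the lower bound for \<open>V\<close> scale like
    r^2, so \<eta> can be fixed from \<open>c4\<close> before r; the factor 1 / 2 makes the
    inequality strict.\<close>
  define \<eta> where "\<eta> = c4 * exp (- \<alpha>) / 2"
  have eta: "\<eta> > 0" using c4 by (simp add: \<eta>_def)
  define \<epsilon> where "\<epsilon> = \<eta> / (4 * \<kappa> * (real (card T) + 1))"
  have eps: "\<epsilon> > 0" using eta kappa_pos by (simp add: \<epsilon>_def add_nonneg_pos)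
  have "\<kappa> * (2 * \<epsilon> * real (card T) - (real DIM('a) - 1) * mean_curvature \<Omega> p) \<le> \<kappa> * (2 * \<epsilon> * (real (card T) + 1))"
    using H kappa_pos eps by (intro mult_left_mono) auto
  also have "\<dots> = \<eta> / 2" using kappa_pos by (simp add: \<epsilon>_def field_simps add_nonneg_eq_0_iff)
  also have "\<dots> < \<eta>" using eta by simp
  finally obtain \<delta> where \<delta>: "\<delta> > 0" "\<And>x. x \<in> \<Omega> \<inter> ball p \<delta> \<Longrightarrow> \<bar>\<psi> \<epsilon> x\<bar> \<le> s0 / 2 \<and> 0 \<le> V \<epsilon> x \<and>
    laplacian (V \<epsilon>) x \<le> L * (norm (gradient (V \<epsilon>) x) + V \<epsilon> x) + \<eta> \<and>
    (\<exists>\<sigma>>0. x - \<sigma> *\<^sub>R e \<in> frontier \<Omega> \<and> (\<forall>\<tau>. 0 \<le> \<tau> \<longrightarrow> \<tau> < \<sigma> \<longrightarrow> x - \<tau> *\<^sub>R e \<in> \<Omega>) \<and> \<sigma> \<le> \<psi> \<epsilon> x)"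
    using V_supersolution[OF eps] by blast
  \<comment> \<open>R1 / 16 makes |z|^2 \<le> 4 r^2 small against R1 r, \<delta> / 2 keeps the ball
    where \<open>V\<close> is controlled, and s0 / (2 c3) keeps the shifted parameter in the range
    where \<Phi> inverts \<open>g\<close>.\<close>
  define r where "r = min (R1 / 16) (min (\<delta> / 2) (s0 / (2 * c3)))"
  have r: "r > 0" using R1(1) \<delta>(1) s0(1) c3 by (simp add: r_def)
  have r2: "r \<le> R1 / 16" "r \<le> \<delta> / 2" "r \<le> s0 / (2 * c3)" unfolding r_def by linarith+
  have r1: "r \<le> 1" "r \<le> R1" using r2(1) R1 by auto
  have sub_r: "ball (p + r *\<^sub>R e) r \<subseteq> \<Omega>" using nested_ball[OF r1(2)] sub by blast
  have ss: "x \<in> \<Omega> \<inter> ball p \<delta>" if "x \<in> ball (p + r *\<^sub>R e) r" for x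
    using that sub_r ball_near[OF that] r2(2) by auto
  have inner: "c4 * r\<^sup>2 \<le> V \<epsilon> x" if x: "dist (p + r *\<^sub>R e) x \<le> r / 2" for x
  proof -
    have xb: "x \<in> ball (p + r *\<^sub>R e) r" using x r by simp
    define w where "w = x - (p + r *\<^sub>R e)"
    have w: "norm w \<le> r / 2" using x by (simp add: w_def dist_norm norm_minus_commute)
    \<comment> \<open>Lowering a point of the half-sized ball by at most r / 4 leaves its height
      above the tangent plane at least r / 4, so it stays in the large tangent ball, deep enough for
      Hopf's bound on \<open>Q\<close> to be of order r.\<close>
    have Qx: "x - \<tau> *\<^sub>R e \<in> \<Omega> \<and> c2 * r \<le> Q (x - \<tau> *\<^sub>R e)" if \<tau>: "0 \<le> \<tau>" "\<tau> \<le> r / 4" for \<tau>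
    proof -
      define z where "z = w + (r - \<tau>) *\<^sub>R e"
      have pz: "x - \<tau> *\<^sub>R e = p + z" by (simp add: z_def w_def algebra_simps)
      have "\<bar>e \<bullet> w\<bar> \<le> r / 2" using Cauchy_Schwarz_ineq2[of e w] w e_norm by simp
      then have ez: "r / 4 \<le> e \<bullet> z" using \<tau> e_norm by (simp add: z_def inner_add_right)
      have "norm z \<le> norm w + \<bar>r - \<tau>\<bar>" using norm_triangle_ineq[of w "(r - \<tau>) *\<^sub>R e"] e_norm by (simp add: z_def)
      then have nz: "norm z \<le> 2 * r" using w \<tau> r by simp
      then have "(norm z)\<^sup>2 \<le> (2 * r)\<^sup>2" by (intro power_mono) auto
      also have "\<dots> = 4 * r * r" by (simp add: power2_eq_square)
      also have "\<dots> \<le> 4 * r * (R1 / 16)" using r r2(1) by (intro mult_left_mono) auto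
      finally have "(norm z)\<^sup>2 \<le> R1 * r / 4" by simp
      moreover have "2 * R1 * (r / 4) \<le> 2 * R1 * (e \<bullet> z)" using ez R1(1) by (intro mult_left_mono) auto
      ultimately have low: "R1 * r / 4 \<le> 2 * R1 * (e \<bullet> z) - (norm z)\<^sup>2" by simp
      moreover have "R1 * r / 4 > 0" using R1(1) r by simp
      ultimately have zz: "(norm z)\<^sup>2 < 2 * R1 * (e \<bullet> z)" by linarith
      have "c2 * r = c1 * ((R1 * r / 4) / R1\<^sup>2)" using R1(1) by (simp add: c2_def power2_eq_square)
      also have "\<dots> \<le> c1 * ((2 * R1 * (e \<bullet> z) - (norm z)\<^sup>2) / R1\<^sup>2)"
        using low c1 by (intro mult_left_mono divide_right_mono) auto
      also have "\<dots> \<le> Q (p + z)" by (rule hopfQ[OF _ zz]) (use nz r2(1) r in linarith)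
      finally have "c2 * r \<le> Q (x - \<tau> *\<^sub>R e)" unfolding pz .
      moreover have "(dist ?y (p + z))\<^sup>2 < R1\<^sup>2" unfolding dist_center_sq using zz by simp
      then have "dist ?y (p + z) < R1" using R1(1) by (rule power2_less_imp_less[OF _ less_imp_le])
      then have "x - \<tau> *\<^sub>R e \<in> \<Omega>" unfolding pz using sub by auto
      ultimately show ?thesis by blast
    qed
    from \<delta>(2)[OF ss[OF xb]] obtain \<sigma> where \<sigma>: "\<sigma> > 0" "x - \<sigma> *\<^sub>R e \<in> frontier \<Omega>"
      "\<And>\<tau>. 0 \<le> \<tau> \<Longrightarrow> \<tau> < \<sigma> \<Longrightarrow> x - \<tau> *\<^sub>R e \<in> \<Omega>" "\<sigma> \<le> \<psi> \<epsilon> x" and ps: "\<bar>\<psi> \<epsilon> x\<bar> \<le> s0 / 2" by blast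
    have "r / 4 < \<sigma>"
    proof (rule ccontr)
      assume "\<not> r / 4 < \<sigma>"
      then have "x - \<sigma> *\<^sub>R e \<in> \<Omega>" using Qx[of \<sigma>] \<sigma>(1) by simp
      then show False using \<sigma>(2) open_domain by (simp add: frontier_def interior_open)
    qed
    then have "\<Phi> (u x) \<le> \<sigma> - r / 4 * (c2 * r / (2 * M))"
      using Qx r by (intro vertical_gain[OF \<sigma>(2,3)]) auto
    also have "r / 4 * (c2 * r / (2 * M)) = c3 * r\<^sup>2" by (simp add: c3_def power2_eq_square)
    also have "\<sigma> - c3 * r\<^sup>2 \<le> \<psi> \<epsilon> x - c3 * r\<^sup>2" using \<sigma>(4) by simp
    finally have Ph: "\<Phi> (u x) \<le> \<psi> \<epsilon> x - c3 * r\<^sup>2" .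
    let ?\<theta> = "\<psi> \<epsilon> x - c3 * r\<^sup>2"
    have "c3 * r\<^sup>2 \<le> c3 * (s0 / (2 * c3))"
    proof (rule mult_left_mono)
      have "r\<^sup>2 \<le> r" using r r1 by (simp add: power2_eq_square mult_left_le_one_le)
      then show "r\<^sup>2 \<le> s0 / (2 * c3)" using r2(3) by linarith
    qed (use c3 in simp)
    then have cr: "c3 * r\<^sup>2 \<le> s0 / 2" using c3 by simp
    have cr0: "c3 * r\<^sup>2 > 0" using c3 r by simp
    have th: "\<bar>?\<theta>\<bar> \<le> s0" using ps cr cr0 by linarith
    have "u x \<le> g ?\<theta>" by (rule u_le_g[OF Ph th])
    moreover have "g ?\<theta> - \<kappa> / 2 * ?\<theta> \<le> g (\<psi> \<epsilon> x) - \<kappa> / 2 * \<psi> \<epsilon> x"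
    proof (rule DERIV_nonneg_imp_nondecreasing[of ?\<theta> "\<psi> \<epsilon> x" "\<lambda>t. g t - \<kappa> / 2 * t"])
      show "?\<theta> \<le> \<psi> \<epsilon> x" using cr0 by simp
      fix t assume t: "?\<theta> \<le> t" "t \<le> \<psi> \<epsilon> x"
      have "\<bar>t\<bar> \<le> s0" using t th ps by linarith
      then have "0 \<le> g' t - \<kappa> / 2" using s0(2) by simp
      moreover have "((\<lambda>t. g t - \<kappa> / 2 * t) has_real_derivative g' t - \<kappa> / 2) (at t)"
        using DERIV_diff[OF g DERIV_cmult[OF DERIV_ident, of "\<kappa> / 2"], of t] by simp
      ultimately show "\<exists>y. ((\<lambda>t. g t - \<kappa> / 2 * t) has_real_derivative y) (at t) \<and> 0 \<le> y" by blast
    qed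
    moreover have "\<kappa> / 2 * \<psi> \<epsilon> x - \<kappa> / 2 * ?\<theta> = c4 * r\<^sup>2" by (simp add: c4_def right_diff_distrib)
    ultimately show ?thesis by linarith
  qed
  show False
  proof (rule hopf_contradiction[OF r r1(1) sub_r, of \<epsilon> \<eta> \<alpha> "c4 * r\<^sup>2"])
    have "\<eta> * r\<^sup>2 * exp \<alpha> = c4 * r\<^sup>2 / 2 * (exp (- \<alpha>) * exp \<alpha>)" by (simp add: \<eta>_def)
    also have "\<dots> = c4 * r\<^sup>2 / 2" by (simp add: exp_minus)
    also have "\<dots> < c4 * r\<^sup>2" using c4 r by simp
    finally show "\<eta> * r\<^sup>2 * exp \<alpha> < c4 * r\<^sup>2" .
  qed (use \<delta>(2)[OF ss] inner eta c4 r \<alpha>_def in auto)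
qed

text \<open>Near \<open>p\<close> the gradient has length at least \<kappa> / 2 and
  \<open>f (u x)\<close> is bounded, so the inequality for \<open>Q\<close> has a constant
  coefficient on a tangent ball. One zero of \<open>Q\<close> makes it vanish on that ball, and the
  Cauchy data at \<open>p\<close> itself select the profile \<open>g\<close>.\<close>

lemma planar_of_zero_curvature:
  assumes H: "mean_curvature \<Omega> p = 0" and x: "x \<in> \<Omega>"
  shows "u x = g (e \<bullet> (x - p))"
proof -
  have pc: "p \<in> closure \<Omega>" using p by (simp add: frontier_def)
  have Gp: "G p = \<kappa> *\<^sub>R e" using boundary_gradient[OF p] e by simp
  then have nG: "norm (G p) = \<kappa>" using e_norm kappa_pos by simp
  obtain d where d: "d > 0" "\<And>x. x \<in> closure \<Omega> \<Longrightarrow> dist x p < d \<Longrightarrow> dist (G x) (G p) < \<kappa> / 2"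
    using G_cont pc kappa_pos unfolding continuous_on_iff by (meson half_gt_zero)
  have Glow: "\<kappa> / 2 \<le> norm (gradient u x)" if "x \<in> \<Omega>" "dist x p < d" for x
  proof -
    have "dist (G x) (G p) < \<kappa> / 2" using d(2)[of x] that closure_subset by blast
    then show ?thesis using norm_triangle_ineq2[of "G p" "G x"] nG G_eq[OF that(1)]
      by (simp add: dist_norm norm_minus_commute)
  qed
  obtain b where b: "\<And>x. x \<in> \<Omega> \<Longrightarrow> \<bar>u x\<bar> \<le> b" using u_bounded by (auto simp: bounded_iff)
  define M1 where "M1 = \<bar>f 0\<bar> + L * \<bar>b\<bar>"
  have M1: "M1 \<ge> 0" using L_nonneg by (simp add: M1_def)
  have fb: "\<bar>f (u x)\<bar> \<le> M1" if "x \<in> \<Omega>" for x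
  proof -
    have "\<bar>f (u x) - f 0\<bar> \<le> L * \<bar>u x\<bar>" using lipschitz_onD[OF f_Lipschitz, of "u x" 0] by (simp add: dist_real_def)
    also have "\<dots> \<le> L * \<bar>b\<bar>" using b[OF that] L_nonneg by (intro mult_left_mono) auto
    finally show ?thesis by (simp add: M1_def)
  qed
  define R1 where "R1 = min (min R 1) (d / 2)"
  have R1: "0 < R1" "R1 \<le> R" "R1 \<le> 1" "2 * R1 \<le> d" using R(1) d(1) by (auto simp: R1_def)
  let ?B = "ball (p + R1 *\<^sub>R e) R1"
  have sub: "?B \<subseteq> \<Omega>" using nested_ball[OF R1(2)] R(2) by blast
  have near: "x \<in> \<Omega>" "dist x p < d" if "x \<in> ?B" for x
    using that sub ball_near[OF that] R1(4) by (auto simp: dist_commute)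
  define K where "K = 2 * M1 / (\<kappa> / 2)"
  have K: "K \<ge> 0" using M1 kappa_pos by (simp add: K_def)
  have Q2: "twice_diff_on Q ?B"
    by (rule twice_diff_on_subset[OF P_function_deficit(1)[OF open_domain u_C3 F equation] sub])
  have Qnn: "0 \<le> Q x" if "x \<in> ?B" for x using P_bound[OF near(1)[OF that]] by simp
  have lapQ: "laplacian Q x \<le> K * (norm (gradient Q x) + Q x)" if x: "x \<in> ?B" for x
  proof -
    have gx: "\<kappa> / 2 \<le> norm (gradient u x)" by (rule Glow[OF near[OF x]])
    then have "gradient u x \<noteq> 0" using kappa_pos by auto
    then have "laplacian Q x \<le> 2 * \<bar>f (u x)\<bar> / norm (gradient u x) * norm (gradient Q x)"
      by (intro P_function_deficit(4)[OF open_domain u_C3 F] equation near(1)[OF x])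
    also have "\<dots> \<le> K * norm (gradient Q x)"
      unfolding K_def using gx fb[OF near(1)[OF x]] kappa_pos M1
      by (intro mult_right_mono frac_le) auto
    also have "\<dots> \<le> K * (norm (gradient Q x) + Q x)" using K Qnn[OF x] by (intro mult_left_mono) auto
    finally show ?thesis .
  qed
  obtain x0 where x0: "x0 \<in> ?B" "Q x0 = 0"
    using Q_zero_near_flat_point[OF H R1(1-3) K lapQ] by blast
  have Q0: "Q y = 0" if y: "y \<in> ?B" for y
  proof (rule strong_max_principle[OF open_ball connected_ball Q2 Qnn _ x0 y])
    show "\<exists>d>0. \<exists>K. \<forall>y\<in>ball x d \<inter> ?B. laplacian Q y \<le> K * (norm (gradient Q y) + Q y)" if "x \<in> ?B" for x
      using lapQ by (intro exI[of _ 1] conjI exI[of _ K]) auto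
  qed
  have clo: "closure ?B \<subseteq> closure \<Omega>" by (rule closure_mono[OF sub])
  have uB: "u y = g (0 + e \<bullet> (y - p))" if y: "y \<in> ?B" for y
  proof (rule solution_planar_near_regular_point[OF open_domain u_C3 F equation f_Lipschitz open_ball convex_ball sub,
        where E = Pmax and G = G and g' = g'])
    show "P_function F u z = Pmax" if "z \<in> ?B" for z using Q0[OF that] by simp
    show "gradient u z \<noteq> 0" if "z \<in> ?B" for z using Glow[OF near[OF that]] kappa_pos by auto
    show "p \<in> closure ?B" using R1(1) e_norm by (simp add: dist_norm)
    show "continuous_on (closure ?B) u" "continuous_on (closure ?B) G"
      using continuous_on_subset[OF u_cont clo] continuous_on_subset[OF G_cont clo] by auto
    show "G z = gradient u z" if "z \<in> ?B" for z by (rule G_eq[OF near(1)[OF that]])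
  qed (use y g g' e_norm Dirichlet[OF p] g0 g'0 Gp kappa in auto)
  show ?thesis
  proof (rule planar_continuation[OF open_domain connected_domain u_C3 F equation f_Lipschitz g g' _ e_norm(1) _ open_ball _ sub _ x])
    show "u y = g (e \<bullet> (y - p))" if "y \<in> ?B" for y using uB[OF that] by simp
    show "?B \<noteq> {}" using R1(1) by simp
  qed (use g0 g'0 kappa P_bound in auto)
qed

text \<open>The heights \<open>?h\<close> of points of \<Omega> form an interval on which
  \<open>g\<close> is positive. It starts at 0 because \<Omega> touches \<open>p\<close>, and it
  ends at the first later time at which \<open>g\<close> fails to be positive, if there is
  one.\<close>

lemma planar_consequences:
  assumes pl: "\<And>x. x \<in> \<Omega> \<Longrightarrow> u x = g (e \<bullet> (x - p))"
  shows "P_function F u constant_on \<Omega> \<and> one_dimensional \<Omega> u \<and> (half_space \<Omega> \<or> slab \<Omega>)"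
proof (intro conjI)
  let ?h = "\<lambda>x. e \<bullet> (x - p)"
  have "P_function F u x = Pmax" if x: "x \<in> \<Omega>" for x
  proof -
    have "gradient u x = g' (?h x) *\<^sub>R e"
      using gradient_cong_open[OF open_domain x pl] planar_function(3)[OF g g' e_norm(1), of 0 p x] by simp
    then show ?thesis using energy[of "?h x"] pl[OF x] e_norm by (simp add: P_function_def)
  qed
  then show "P_function F u constant_on \<Omega>" by (auto simp: constant_on_def)
  show "one_dimensional \<Omega> u" unfolding one_dimensional_def using pl by blast
  have e0: "e \<noteq> 0" using e_norm by auto
  have hc: "continuous_on S ?h" for S by (intro continuous_intros)
  have gc: "continuous_on S g" for S using g_isCont(1) by (blast intro: continuous_at_imp_continuous_on)
  have clos: "u x = g (?h x)" if "x \<in> closure \<Omega>" for x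
  proof -
    have "u x - g (?h x) = 0"
    proof (rule continuous_constant_on_closure[of \<Omega> "\<lambda>x. u x - g (?h x)"])
      show "continuous_on (closure \<Omega>) (\<lambda>x. u x - g (?h x))"
        by (intro continuous_on_diff u_cont continuous_on_compose2[OF gc hc]) auto
    qed (use pl that in auto)
    then show ?thesis by simp
  qed
  have ray: "p + t *\<^sub>R e \<in> \<Omega>" "?h (p + t *\<^sub>R e) = t" if "0 < t" "t < R" for t
  proof -
    have "(norm (t *\<^sub>R e))\<^sup>2 < 2 * R * (e \<bullet> t *\<^sub>R e)" using that e_norm by (simp add: power2_eq_square)
    then have "(dist (p + R *\<^sub>R e) (p + t *\<^sub>R e))\<^sup>2 < R\<^sup>2" unfolding dist_center_sq by simp
    then have "dist (p + R *\<^sub>R e) (p + t *\<^sub>R e) < R" using R(1) by (rule power2_less_imp_less[OF _ less_imp_le])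
    then show "p + t *\<^sub>R e \<in> \<Omega>" using R(2) by auto
    show "?h (p + t *\<^sub>R e) = t" using e_norm by simp
  qed
  have gpos: "g (?h x) > 0" if "x \<in> \<Omega>" for x using positive[OF that] pl[OF that] by simp
  have gray: "g t > 0" if "0 < t" "t < R" for t using gpos[OF ray(1)[OF that]] unfolding ray(2)[OF that] .
  have conn: "connected (?h ` \<Omega>)" by (rule connected_continuous_image[OF hc connected_domain])
  have half: "R / 2 \<in> ?h ` \<Omega>"
  proof -
    have "0 < R / 2" "R / 2 < R" using R(1) by auto
    then show ?thesis using ray[of "R / 2"] by (metis image_eqI)
  qed
  have hpos: "?h x > 0" if x: "x \<in> \<Omega>" for x
  proof (rule ccontr)
    assume "\<not> ?h x > 0"
    then have "0 \<in> ?h ` \<Omega>"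
      by (intro connectedD_interval[OF conn imageI[OF x] half]) (use R(1) in auto)
    then obtain z where "z \<in> \<Omega>" "0 = ?h z" unfolding image_iff by blast
    then show False using gpos[of z] g0 by simp
  qed
  \<comment> \<open>A convex set is connected; if it properly contained \<Omega> it would meet the
    frontier, where \<open>u\<close> vanishes although it equals the positive number
    \<open>g (?h x)\<close>.\<close>
  have whole: "\<Omega> = S" if S: "\<Omega> \<subseteq> S" "convex S" "\<And>x. x \<in> S \<Longrightarrow> g (?h x) > 0" for S
  proof (rule ccontr)
    assume "\<Omega> \<noteq> S"
    then have "S - \<Omega> \<noteq> {}" using S(1) by blast
    moreover have "S \<inter> \<Omega> \<noteq> {}" using half S(1) by blast
    ultimately obtain x where x: "x \<in> S" "x \<in> frontier \<Omega>"
      using connected_Int_frontier[OF convex_connected[OF S(2)], of \<Omega>] by blast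
    then have "u x = g (?h x)" by (intro clos) (simp add: frontier_def)
    then show False using Dirichlet[OF x(2)] S(3)[OF x(1)] by simp
  qed
  show "half_space \<Omega> \<or> slab \<Omega>"
  proof (cases "\<exists>t>0. g t \<le> 0")
    case False
    have "\<Omega> = {x. (- e) \<bullet> x < - (e \<bullet> p)}"
    proof (rule whole)
      show "convex {x. (- e) \<bullet> x < - (e \<bullet> p)}" by (rule convex_halfspace_lt)
      show "\<Omega> \<subseteq> {x. (- e) \<bullet> x < - (e \<bullet> p)}" using hpos by (auto simp: inner_diff_right)
      show "g (?h x) > 0" if "x \<in> {x. (- e) \<bullet> x < - (e \<bullet> p)}" for x
        using False that by (auto simp: inner_diff_right not_le)
    qed
    then have "half_space \<Omega>" unfolding half_space_def using e0 by (intro exI[of _ "- e"] exI[of _ "- (e \<bullet> p)"]) auto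
    then show ?thesis ..
  next
    case True
    \<comment> \<open>g 0 = 0 would be an unwanted first element. Cutting at R / 2 excludes it and
      leaves a closed set, and nothing else is lost because \<open>g\<close> is positive on (0,
      R).\<close>
    define Z where "Z = {t \<in> {R / 2..}. g t \<le> 0}"
    have ZI: "t \<in> Z" if "t > 0" "g t \<le> 0" for t
      using gray[of t] that R(1) by (auto simp: Z_def) (smt (verit) field_sum_of_halves)
    have "closed Z" unfolding Z_def
      by (rule continuous_on_closed_Collect_le[OF gc continuous_on_const closed_atLeast])
    moreover have Zne: "Z \<noteq> {}" using True ZI by blast
    moreover have bdd: "bdd_below Z" by (rule bdd_belowI[of _ "R / 2"]) (auto simp: Z_def)
    ultimately have bZ: "Inf Z \<in> Z" by (intro closed_contains_Inf)
    define b where "b = Inf Z"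
    have b: "g b \<le> 0" "b \<ge> R / 2" using bZ by (auto simp: Z_def b_def)
    have gb: "g t > 0" if "0 < t" "t < b" for t
    proof (rule ccontr)
      assume "\<not> g t > 0"
      then have "t \<in> Z" using ZI that by simp
      then have "b \<le> t" unfolding b_def using bdd by (rule cInf_lower)
      then show False using that by simp
    qed
    have hb: "?h x < b" if x: "x \<in> \<Omega>" for x
    proof (rule ccontr)
      assume "\<not> ?h x < b"
      then have "b \<in> ?h ` \<Omega>"
        by (intro connectedD_interval[OF conn half imageI[OF x]]) (use b(2) in auto)
      then obtain z where "z \<in> \<Omega>" "b = ?h z" unfolding image_iff by blast
      then show False using gpos[of z] b(1) by simp
    qed
    have "\<Omega> = {x. e \<bullet> p < e \<bullet> x} \<inter> {x. e \<bullet> x < e \<bullet> p + b}"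
    proof (rule whole)
      show "convex ({x. e \<bullet> p < e \<bullet> x} \<inter> {x. e \<bullet> x < e \<bullet> p + b})"
        using convex_halfspace_gt[of "e \<bullet> p" e] by (intro convex_Int convex_halfspace_lt) auto
      show "\<Omega> \<subseteq> {x. e \<bullet> p < e \<bullet> x} \<inter> {x. e \<bullet> x < e \<bullet> p + b}"
      proof
        fix x assume "x \<in> \<Omega>"
        from hpos[OF this] hb[OF this] show "x \<in> {x. e \<bullet> p < e \<bullet> x} \<inter> {x. e \<bullet> x < e \<bullet> p + b}"
          by (simp add: inner_diff_right)
      qed
      show "g (?h x) > 0" if "x \<in> {x. e \<bullet> p < e \<bullet> x} \<inter> {x. e \<bullet> x < e \<bullet> p + b}" for x
        using that by (intro gb) (auto simp: inner_diff_right)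
    qed
    then have "\<Omega> = {x. e \<bullet> p < e \<bullet> x \<and> e \<bullet> x < e \<bullet> p + b}" by auto
    then have "slab \<Omega>" unfolding slab_def using e0 b(2) R(1)
      by (intro exI[of _ e] exI[of _ "e \<bullet> p"] exI[of _ "e \<bullet> p + b"]) auto
    then show ?thesis ..
  qed
qed

end

lemma (in overdetermined_solution) boundary_point_exists:
  assumes p: "p \<in> frontier \<Omega>"
  shows "\<exists>R s0 M \<Phi> T k. boundary_point \<Omega> f F \<kappa> L u G g g' p (- outward_normal \<Omega> p) R s0 M \<Phi> T k"
proof -
  let ?e = "- outward_normal \<Omega> p"
  from boundary_geometry[OF domain p dim refl] obtain R T k where
    R: "R > 0" "ball (p + R *\<^sub>R ?e) R \<subseteq> \<Omega>"
    and T: "finite T" "\<forall>b\<in>T. norm b = 1 \<and> b \<bullet> ?e = 0" "(\<Sum>b\<in>T. k b) = (real DIM('a) - 1) * mean_curvature \<Omega> p"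
    and descent: "\<forall>\<epsilon>>0. \<exists>\<delta>>0. \<forall>x\<in>\<Omega> \<inter> ball p \<delta>. \<exists>\<sigma>>0. x - \<sigma> *\<^sub>R ?e \<in> frontier \<Omega> \<and>
         (\<forall>\<tau>. 0 \<le> \<tau> \<longrightarrow> \<tau> < \<sigma> \<longrightarrow> x - \<tau> *\<^sub>R ?e \<in> \<Omega>) \<and>
         \<sigma> \<le> ?e \<bullet> (x - p) - (\<Sum>b\<in>T. (k b / 2 - \<epsilon>) * (b \<bullet> (x - p))\<^sup>2)"
    by (elim conjE exE) blast
  have k2: "\<kappa> / 2 > 0" using kappa_pos by simp
  obtain d where d: "d > 0" "\<And>t. \<bar>t\<bar> < d \<Longrightarrow> \<bar>g' t - \<kappa>\<bar> < \<kappa> / 2"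
  proof -
    from g_isCont(2)[of 0, unfolded continuous_at_eps_delta dist_real_def, rule_format, OF k2]
    obtain d where "d > 0" "\<forall>t. \<bar>t - 0\<bar> < d \<longrightarrow> \<bar>g' t - g' 0\<bar> < \<kappa> / 2" by blast
    then show ?thesis using that[of d] g'0 by simp
  qed
  obtain \<Phi> where \<Phi>: "\<And>t. (\<Phi> has_real_derivative 1 / sqrt (max (Pmax - 2 * F t) ((\<kappa> / 2)\<^sup>2))) (at t)"
    "strict_mono \<Phi>" "\<Phi> 0 = 0"
    using truncated_speed_function[OF F_cont k2, of Pmax] by blast
  obtain b where b: "\<And>x. x \<in> \<Omega> \<Longrightarrow> \<bar>u x\<bar> \<le> b" using u_bounded by (auto simp: bounded_iff)
  have "bounded (F ` {- b..b})" by (intro compact_imp_bounded compact_continuous_image F_cont compact_Icc)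
  then obtain C where C: "\<forall>t\<in>{- b..b}. \<bar>F t\<bar> \<le> C" by (auto simp: bounded_iff)
  \<comment> \<open>F is bounded on the compact range available to \<open>u\<close>; the last
    summand covers the truncated case and makes \<open>M\<close> positive.\<close>
  define M where "M = \<bar>Pmax\<bar> + 2 * \<bar>C\<bar> + (\<kappa> / 2)\<^sup>2"
  have "M > 0" using k2 by (simp add: M_def add_nonneg_pos)
  moreover have "max (Pmax - 2 * F (u x)) ((\<kappa> / 2)\<^sup>2) \<le> M" if "x \<in> \<Omega>" for x
  proof -
    have "\<bar>F (u x)\<bar> \<le> \<bar>C\<bar>" using bspec[OF C, of "u x"] b[OF that] by (simp add: abs_le_iff)
    then have "Pmax - 2 * F (u x) \<le> M" "(\<kappa> / 2)\<^sup>2 \<le> M"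
      unfolding M_def using zero_le_power2[of "\<kappa> / 2"] by linarith+
    then show ?thesis by (rule max.boundedI)
  qed
  moreover have "\<kappa> / 2 \<le> g' t" if "\<bar>t\<bar> \<le> d / 2" for t
    using d(2)[of t] that d(1) by linarith
  ultimately have "boundary_point \<Omega> f F \<kappa> L u G g g' p ?e R (d / 2) M \<Phi> T k"
    by (intro boundary_point.intro overdetermined_solution_axioms boundary_point_axioms.intro
        p refl R \<Phi> T(1,3) T(2)[THEN bspec, THEN conjunct1] T(2)[THEN bspec, THEN conjunct2]
        descent[rule_format] half_gt_zero d(1)) assumption+
  then show ?thesis by blast
qed

theorem theorem1p3:
  fixes \<Omega> :: "(real ^ 'n) set"
    and f F :: "real \<Rightarrow> real"
    and \<kappa> :: real
    and u :: "real ^ 'n \<Rightarrow> real"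
  assumes dim: "CARD('n) \<ge> 2"
    and domain: "regular_domain \<Omega>"
    and f_Lipschitz: "\<exists>L. L-lipschitz_on UNIV f"
    and F_primitive: "\<And>t. (F has_real_derivative f t) (at t)"
    and kappa: "\<kappa> \<noteq> 0"
    and u_C3: "Ck_on 3 u \<Omega>"
    and u_C1_closure: "C1_up_to_boundary \<Omega> u"
    and u_bounded: "bounded (u ` \<Omega>)"
    and equation: "\<And>x. x \<in> \<Omega> \<Longrightarrow> laplacian u x + f (u x) = 0"
    and positive: "\<And>x. x \<in> \<Omega> \<Longrightarrow> u x > 0"
    and Dirichlet: "\<And>x. x \<in> frontier \<Omega> \<Longrightarrow> u x = 0"
    and Neumann: "\<And>x. x \<in> frontier \<Omega> \<Longrightarrow> normal_derivative \<Omega> u x = - \<kappa>"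
    and P_bound: "\<And>x. x \<in> \<Omega> \<Longrightarrow> P_function F u x \<le> \<kappa>\<^sup>2 + 2 * F 0"
  shows "(\<forall>p\<in>frontier \<Omega>. mean_curvature \<Omega> p \<le> 0) \<and>
         ((\<exists>p\<in>frontier \<Omega>. mean_curvature \<Omega> p = 0) \<longrightarrow>
            P_function F u constant_on \<Omega> \<and> one_dimensional \<Omega> u \<and> (half_space \<Omega> \<or> slab \<Omega>))"
proof -
  obtain L where L: "L-lipschitz_on UNIV f" using f_Lipschitz by blast
  obtain G where G: "continuous_on (closure \<Omega>) G" "\<forall>x\<in>\<Omega>. G x = gradient u x"
    and uc: "continuous_on (closure \<Omega>) u"
    using u_C1_closure by (auto simp: C1_up_to_boundary_def)
  obtain g g' where g: "\<And>t. (g has_real_derivative g' t) (at t)"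
    "\<And>t. (g' has_real_derivative - f (g t)) (at t)" "g 0 = 0" "g' 0 = \<kappa>"
    using second_order_ode_exists[OF L, of \<kappa>] by blast
  interpret overdetermined_solution \<Omega> f F \<kappa> L u G g g'
    by unfold_locales (use assms L G uc g in auto)
  have "mean_curvature \<Omega> p \<le> 0" if p: "p \<in> frontier \<Omega>" for p
  proof -
    obtain R s0 M \<Phi> T k where "boundary_point \<Omega> f F \<kappa> L u G g g' p (- outward_normal \<Omega> p) R s0 M \<Phi> T k"
      using boundary_point_exists[OF p] by blast
    then show ?thesis by (rule boundary_point.mean_curvature_nonpos)
  qed
  moreover have "P_function F u constant_on \<Omega> \<and> one_dimensional \<Omega> u \<and> (half_space \<Omega> \<or> slab \<Omega>)"
    if p: "p \<in> frontier \<Omega>" and H: "mean_curvature \<Omega> p = 0" for p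
  proof -
    obtain R s0 M \<Phi> T k where "boundary_point \<Omega> f F \<kappa> L u G g g' p (- outward_normal \<Omega> p) R s0 M \<Phi> T k"
      using boundary_point_exists[OF p] by blast
    then interpret boundary_point \<Omega> f F \<kappa> L u G g g' p "- outward_normal \<Omega> p" R s0 M \<Phi> T k .
    show ?thesis by (rule planar_consequences[OF planar_of_zero_curvature[OF H]])
  qed
  ultimately show ?thesis by blast
qed

end
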